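(* Let $S>0$ and let $\bar v^{(S)}_h=\bar v^{(S)}_{h,\delta,\rho}\in V_h$ be a minimizer of the problem of minimizing $E_{h,\delta,\rho}[u]$ over $u\in X_S$. Assume that there exists $c_0>0$ such that $\delta\le c_0h$. Moreover, suppose that the physical parameters satisfy $$\frac{1}{\sqrt{2C\sigma}}\left[\sigma+4\gamma\left(\frac{T[\psi]}{\sigma}+c_0\right)\right]+\arctan\left(|\psi|_{W^{1,\infty}(0,1)}+2c_0\right)\le\bar\phi$$ for some $\bar\phi\in(0,\pi/2)$ which is independent of $h,\delta,\rho$ and $S$. Then the sequence $\{\bar v^{(S)}_h\}_h$ satisfies $$|\bar v^{(S)}_h|_{W^{1,\infty}(0,1)}\le\tan\bar\phi$$ for all $S>0$. Therefore, the problem of minimizing $E[u]$ over $u\in H^1_\pi$ has at least one solution $\bar v$, and the sequence $\{\bar v^{(S)}_h\}_h$ (as $h,\delta,\rho\downarrow0$) has a subsequence that converges to $\bar v$ in $H^1_\pi$.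
   Context: Constants and obstacle: $C,\sigma,\gamma>0$ are constants and $\psi$ is a given smooth real function on $[0,1]$, periodic (i.e. the restriction of a smooth $1$-periodic function). Spaces: $H^1_\pi=\{u\in H^1(0,1): u(0)=u(1)\}$ with the $H^1$ norm, $H^2_\pi=\{u\in H^2(0,1)\cap H^1_\pi: u'\in H^1_\pi\}$, $X^2=\{u\in H^2_\pi: u\ge\psi\}$. For $S>0$, $X_S=\{v\in H^1_\pi\cap W^{1,\infty}(0,1): \|v\|_{W^{1,\infty}(0,1)}\le S\}$, with the topology (metric) induced from $H^1_\pi$. The seminorm is $|v|_{W^{1,\infty}(0,1)}=\|v'\|_{L^\infty(0,1)}$. Continuous energy $E:H^1_\pi\to\mathbb{R}\cup\{+\infty\}$: $E[u]=B[u]+T[u]-A[u]$ if $u\in X^2$ and $E[u]=+\infty$ if $u\in H^1_\pi\setminus X^2$, where $B[u]=\frac C2\int\kappa^2\,ds=\frac C2\int_0^1\frac{|u''|^2}{(1+|u'|^2)^{5/2}}dx$, $T[u]=\sigma\int ds=\sigma\int_0^1\sqrt{1+|u'|^2}\,dx$, $A[u]=\gamma\int_{\{u=\psi\}}ds=\gamma\int_{\{x\in(0,1):\,u(x)=\psi(x)\}}\sqrt{1+|u'|^2}\,dx$. Discretization: $N\in\mathbb{N}$, $h=1/N$, $x_j=jh$, $I_j=(x_{j-1},x_j)$; all indices are extended $N$-periodically. $V_h$ is the space of continuous functions $v_h$ on $[0,1]$ with $v_h(0)=v_h(1)$ that are affine on each $I_j$. For $v_h\in V_h$: $v_j=v_h(x_j)$,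 $d_j=(v_j-v_{j-1})/h$, $l_j=\frac h2\sqrt{1+d_j^2}$, $\theta_j=\arccos\left[\frac{1+d_jd_{j+1}}{\sqrt{1+d_j^2}\sqrt{1+d_{j+1}^2}}\right]$, $\psi_j=\psi(x_j)$. Fix $\zeta\in C^1(\mathbb{R})$ with $0\le\zeta\le1$, $\zeta(-t)=\zeta(t)$, $\zeta=0$ on $(1,\infty)$, $\zeta'\le0$ on $[0,1]$, $\zeta(0)=1$. For $\delta>0$ set $\zeta_\delta(t)=\zeta(t/\delta)$ and $\zeta_{\delta,j}=\zeta_\delta(v_j-\psi_j)$. For $\rho>0$ and $v_h\in V_h$ let $B_h[v_h]=\frac C2\sum_{j=1}^N\theta_j^2\frac{l_j^3+l_{j+1}^3}{l_jl_{j+1}(l_j+l_{j+1})^2}$, $A_{h,\delta}[v_h]=\gamma\sum_{j=1}^N\zeta_{\delta,j-1}\zeta_{\delta,j}\cdot 2l_j$, $P_{h,\rho}[v_h]=\frac1\rho\sum_{j=1}^N|(v_j-\psi_j)_-|^2h$, where $(x)_-=\max\{0,-x\}$. Discrete energy on $H^1_\pi$: $E_{h,\delta,\rho}[v]=B_h[v]+T[v]-A_{h,\delta}[v]+P_{h,\rho}[v]$ if $v\in V_h$, and $E_{h,\delta,\rho}[v]=+\infty$ if $v\in H^1_\pi\setminus V_h$.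
   Formalization: The convergence of a subsequence is stated only for S at least the sup norm of ψ plus 2 tan φ̄, since it fails for small S (e.g. ψ constant and larger than S); the slope bound for all S>0 and the existence of a minimizer are unrestricted. *)

theory Defs
  imports "HOL-Probability.Essential_Supremum"
begin

subsection \<open>Sobolev spaces on the unit interval\<close>

text \<open>Functions on [0,1] are represented by total functions on the reals; their values outside
  [0,1] are never used. Elements of \<open>H1\<close> are identified with their continuous representatives.\<close>

definition unit_meas :: "real measure" where
  "unit_meas = lebesgue_on {0<..<1}"

definition square_integrable :: "(real \<Rightarrow> real) \<Rightarrow> bool" where
  "square_integrable f \<longleftrightarrow>
     f \<in> borel_measurable unit_meas \<and> integrable unit_meas (\<lambda>x. (f x)\<^sup>2)"

text \<open>A closed set contained in (0,1) is compact, so these are the compactly supported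
  \<open>C\<^sup>1\<close> functions on (0,1).\<close>

definition test_function :: "(real \<Rightarrow> real) \<Rightarrow> bool" where
  "test_function \<phi> \<longleftrightarrow>
     \<phi> C1_differentiable_on UNIV \<and> closure {x. \<phi> x \<noteq> 0} \<subseteq> {0<..<1}"

definition has_weak_deriv :: "(real \<Rightarrow> real) \<Rightarrow> (real \<Rightarrow> real) \<Rightarrow> bool" where
  "has_weak_deriv u g \<longleftrightarrow> square_integrable g \<and>
     (\<forall>\<phi>. test_function \<phi> \<longrightarrow>
        (LINT x|unit_meas. u x * deriv \<phi> x) = - (LINT x|unit_meas. g x * \<phi> x))"

text \<open>The weak derivative is determined only almost everywhere; \<open>wderiv\<close> picks one version
  and is used only under integrals and essential suprema.\<close>

definition wderiv :: "(real \<Rightarrow> real) \<Rightarrow> real \<Rightarrow> real" where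
  "wderiv u = (SOME g. has_weak_deriv u g)"

definition H1 :: "(real \<Rightarrow> real) set" where
  "H1 = {u. continuous_on {0..1} u \<and> square_integrable u \<and> (\<exists>g. has_weak_deriv u g)}"

definition H1_norm :: "(real \<Rightarrow> real) \<Rightarrow> real" where
  "H1_norm u = sqrt ((LINT x|unit_meas. (u x)\<^sup>2) + (LINT x|unit_meas. (wderiv u x)\<^sup>2))"

definition H1_per :: "(real \<Rightarrow> real) set" where
  "H1_per = {u \<in> H1. u 0 = u 1}"

definition H2_per :: "(real \<Rightarrow> real) set" where
  "H2_per = {u \<in> H1_per. \<exists>g \<in> H1_per. has_weak_deriv u g}"

definition Linf_norm :: "(real \<Rightarrow> real) \<Rightarrow> ereal" where
  "Linf_norm f = esssup unit_meas (\<lambda>x. ereal \<bar>f x\<bar>)"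

definition W1inf_seminorm :: "(real \<Rightarrow> real) \<Rightarrow> ereal" where
  "W1inf_seminorm v = Linf_norm (wderiv v)"

definition W1inf_norm :: "(real \<Rightarrow> real) \<Rightarrow> ereal" where
  "W1inf_norm v = Linf_norm v + W1inf_seminorm v"

text \<open>Finiteness of the norm gives membership in \<open>W\<^sup>1\<^sup>,\<^sup>\<infinity>\<close>.\<close>

definition X_ball :: "real \<Rightarrow> (real \<Rightarrow> real) set" where
  "X_ball S = {v \<in> H1_per. W1inf_norm v \<le> ereal S}"


subsection \<open>Obstacle and cut-off function\<close>

definition smooth_periodic :: "(real \<Rightarrow> real) \<Rightarrow> bool" where
  "smooth_periodic \<psi> \<longleftrightarrow>
     (\<forall>n. (deriv ^^ n) \<psi> differentiable_on UNIV) \<and> (\<forall>x. \<psi> (x + 1) = \<psi> x)"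

definition cutoff :: "(real \<Rightarrow> real) \<Rightarrow> bool" where
  "cutoff \<zeta> \<longleftrightarrow> \<zeta> C1_differentiable_on UNIV \<and>
     (\<forall>t. 0 \<le> \<zeta> t \<and> \<zeta> t \<le> 1) \<and> (\<forall>t. \<zeta> (- t) = \<zeta> t) \<and> (\<forall>t>1. \<zeta> t = 0) \<and>
     (\<forall>t\<in>{0..1}. deriv \<zeta> t \<le> 0) \<and> \<zeta> 0 = 1"


subsection \<open>Continuous energy\<close>

definition X2 :: "(real \<Rightarrow> real) \<Rightarrow> (real \<Rightarrow> real) set" where
  "X2 \<psi> = {u \<in> H2_per. \<forall>x\<in>{0..1}. \<psi> x \<le> u x}"

definition bending :: "real \<Rightarrow> (real \<Rightarrow> real) \<Rightarrow> real" where
  "bending C u = C / 2 *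
     (LINT x|unit_meas. (wderiv (wderiv u) x)\<^sup>2 / (1 + (wderiv u x)\<^sup>2) powr (5 / 2))"

definition tension :: "real \<Rightarrow> (real \<Rightarrow> real) \<Rightarrow> real" where
  "tension \<sigma> u = \<sigma> * (LINT x|unit_meas. sqrt (1 + (wderiv u x)\<^sup>2))"

definition adhesion :: "real \<Rightarrow> (real \<Rightarrow> real) \<Rightarrow> (real \<Rightarrow> real) \<Rightarrow> real" where
  "adhesion \<gamma> \<psi> u =
     \<gamma> * (LINT x|lebesgue_on {x\<in>{0<..<1}. u x = \<psi> x}. sqrt (1 + (wderiv u x)\<^sup>2))"

definition energy ::
    "real \<Rightarrow> real \<Rightarrow> real \<Rightarrow> (real \<Rightarrow> real) \<Rightarrow> (real \<Rightarrow> real) \<Rightarrow> ereal" where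
  "energy C \<sigma> \<gamma> \<psi> u =
     (if u \<in> X2 \<psi> then ereal (bending C u + tension \<sigma> u - adhesion \<gamma> \<psi> u) else \<infinity>)"


subsection \<open>Discrete energy\<close>

text \<open>The mesh size is \<open>h = 1 / N\<close>. Node values are extended periodically in the index by reducing
  it modulo \<open>N\<close>; this is consistent at \<open>j = N\<close> because all functions involved take the same value
  at 0 and 1. In \<open>slope\<close>, \<open>seg\<close> and \<open>angle\<close> the index satisfies \<open>j \<ge> 1\<close>.\<close>

definition V_h :: "nat \<Rightarrow> (real \<Rightarrow> real) set" where
  "V_h N = {v. continuous_on {0..1} v \<and> v 0 = v 1 \<and>
     (\<forall>j\<in>{1..N}. \<exists>a b. \<forall>x\<in>{(real j - 1) / real N<..<real j / real N}. v x = a + b * x)}"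

definition nodal :: "nat \<Rightarrow> (real \<Rightarrow> real) \<Rightarrow> nat \<Rightarrow> real" where
  "nodal N v j = v (real (j mod N) / real N)"

definition slope :: "nat \<Rightarrow> (real \<Rightarrow> real) \<Rightarrow> nat \<Rightarrow> real" where
  "slope N v j = (nodal N v j - nodal N v (j - 1)) / (1 / real N)"

text \<open>\<open>seg\<close> is half the length of the j-th segment of the graph.\<close>

definition seg :: "nat \<Rightarrow> (real \<Rightarrow> real) \<Rightarrow> nat \<Rightarrow> real" where
  "seg N v j = (1 / real N) / 2 * sqrt (1 + (slope N v j)\<^sup>2)"

definition angle :: "nat \<Rightarrow> (real \<Rightarrow> real) \<Rightarrow> nat \<Rightarrow> real" where
  "angle N v j = arccos ((1 + slope N v j * slope N v (j + 1)) /
     (sqrt (1 + (slope N v j)\<^sup>2) * sqrt (1 + (slope N v (j + 1))\<^sup>2)))"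

definition bending_h :: "real \<Rightarrow> nat \<Rightarrow> (real \<Rightarrow> real) \<Rightarrow> real" where
  "bending_h C N v = C / 2 * (\<Sum>j=1..N. (angle N v j)\<^sup>2 *
     (((seg N v j) ^ 3 + (seg N v (j + 1)) ^ 3) /
      (seg N v j * seg N v (j + 1) * (seg N v j + seg N v (j + 1))\<^sup>2)))"

definition cutoff_node ::
    "(real \<Rightarrow> real) \<Rightarrow> (real \<Rightarrow> real) \<Rightarrow> nat \<Rightarrow> real \<Rightarrow> (real \<Rightarrow> real) \<Rightarrow> nat \<Rightarrow> real" where
  "cutoff_node \<zeta> \<psi> N \<delta> v j = \<zeta> ((nodal N v j - nodal N \<psi> j) / \<delta>)"

definition adhesion_h ::
    "real \<Rightarrow> (real \<Rightarrow> real) \<Rightarrow> (real \<Rightarrow> real) \<Rightarrow> nat \<Rightarrow> real \<Rightarrow> (real \<Rightarrow> real) \<Rightarrow> real" where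
  "adhesion_h \<gamma> \<zeta> \<psi> N \<delta> v = \<gamma> * (\<Sum>j=1..N.
     cutoff_node \<zeta> \<psi> N \<delta> v (j - 1) * cutoff_node \<zeta> \<psi> N \<delta> v j * (2 * seg N v j))"

definition penalty_h :: "(real \<Rightarrow> real) \<Rightarrow> nat \<Rightarrow> real \<Rightarrow> (real \<Rightarrow> real) \<Rightarrow> real" where
  "penalty_h \<psi> N \<rho> v =
     1 / \<rho> * (\<Sum>j=1..N. \<bar>max 0 (- (nodal N v j - nodal N \<psi> j))\<bar>\<^sup>2 * (1 / real N))"

definition energy_h ::
    "real \<Rightarrow> real \<Rightarrow> real \<Rightarrow> (real \<Rightarrow> real) \<Rightarrow> (real \<Rightarrow> real) \<Rightarrow>
     nat \<Rightarrow> real \<Rightarrow> real \<Rightarrow> (real \<Rightarrow> real) \<Rightarrow> ereal" where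
  "energy_h C \<sigma> \<gamma> \<psi> \<zeta> N \<delta> \<rho> v =
     (if v \<in> V_h N
      then ereal (bending_h C N v + tension \<sigma> v - adhesion_h \<gamma> \<zeta> \<psi> N \<delta> v + penalty_h \<psi> N \<rho> v)
      else \<infinity>)"

definition discrete_minimizer ::
    "real \<Rightarrow> real \<Rightarrow> real \<Rightarrow> (real \<Rightarrow> real) \<Rightarrow> (real \<Rightarrow> real) \<Rightarrow>
     real \<Rightarrow> nat \<Rightarrow> real \<Rightarrow> real \<Rightarrow> (real \<Rightarrow> real) \<Rightarrow> bool" where
  "discrete_minimizer C \<sigma> \<gamma> \<psi> \<zeta> S N \<delta> \<rho> v \<longleftrightarrow>
     v \<in> V_h N \<and> is_arg_min (energy_h C \<sigma> \<gamma> \<psi> \<zeta> N \<delta> \<rho>) (\<lambda>u. u \<in> X_ball S) v"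

definition minimizer ::
    "real \<Rightarrow> real \<Rightarrow> real \<Rightarrow> (real \<Rightarrow> real) \<Rightarrow> (real \<Rightarrow> real) \<Rightarrow> bool" where
  "minimizer C \<sigma> \<gamma> \<psi> u \<longleftrightarrow> is_arg_min (energy C \<sigma> \<gamma> \<psi>) (\<lambda>u. u \<in> H1_per) u"

end

theory Submission
  imports Defs "HOL-Complex_Analysis.Great_Picard"
begin

text \<open>
The first claim rests on one estimate: energy controls turning. If \<open>\<theta>\<^sub>j\<close> is the angle between two
consecutive segments and \<open>L\<^sub>j = l\<^sub>j + l\<^sub>j\<^sub>+\<^sub>1\<close>, then the arithmetic-geometric mean inequality gives
\<open>sqrt (2 C \<sigma>) \<theta>\<^sub>j \<le> C/2 \<theta>\<^sub>j\<^sup>2 / L\<^sub>j + \<sigma> L\<^sub>j\<close>. The slopes of a periodic function change sign, so the sum over \<open>j\<close>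
bounds \<open>sqrt (2 C \<sigma>) |arctan d\<^sub>j|\<close> by bending plus tension (\<open>turning_bound\<close>). This sum is bounded in turn by
comparing a minimizer \<open>v\<close> with the constant \<open>max v\<close>: it lies in the same ball \<open>X\<^sub>S\<close>, it has no bending, and its
penalty is at most that of \<open>v\<close> (\<open>near_minimizer_bound\<close>). What remains is the adhesion of \<open>v\<close>. Both ends
of an adhering segment are within \<open>\<delta>\<close> of the obstacle, so the segment is longer than the corresponding chord of
the obstacle by at most \<open>2 \<delta>\<close>, and \<open>\<delta> \<le> c\<^sub>0 h\<close> bounds the total excess by \<open>2 c\<^sub>0\<close> (\<open>adhesion_h_le\<close>).

The second claim is a \<open>\<Gamma>\<close>-convergence argument, carried out for functions that are minimal up to an error that
tends to zero. Such functions exist because the energy is bounded below, so the same argument yields the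
minimizer of the limit problem and the convergence of discrete minimizers.

Lower bound (locale \<open>convergent_sequence\<close>): bounded slopes and bounded bending make the slopes uniformly
Hoelder continuous with exponent 1/2, up to jumps that tend to zero, so the Arzela-Ascoli theorem gives a
limit \<open>u\<close> with continuous derivative \<open>p\<close>. If \<open>G' = (1 + t\<^sup>2)\<^sup>-\<^sup>5\<^sup>/\<^sup>4\<close>, the bending energy of \<open>u\<close> is \<open>C/2\<close> times the Dirichlet energy of \<open>G \<circ> p\<close>,
and Dirichlet energies are lower semicontinuous (\<open>weak_limit_primitive\<close>). Adhesion is upper semicontinuous,
because away from the contact set the cut-off factors vanish eventually.

Upper bound (locale \<open>competitor\<close>): the nodal interpolants of an admissible \<open>w\<close> may lose all adhesion if
\<open>\<delta>\<close> is much smaller than the mesh width and the nodes miss the contact set. Therefore, all nodes of cells that meet the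
contact set are moved onto the obstacle. The function \<open>z = w - \<psi>\<close> vanishes on the contact set together
with \<open>z'\<close>, and \<open>z''\<close> vanishes there almost everywhere, so the cost in bending is bounded by the integral of
\<open>(z'')\<^sup>2\<close> over cells that shrink to the contact set (\<open>excess_tendsto\<close>). It suffices to do this for \<open>w\<close> in the
interior of \<open>X\<^sub>S\<close>: a function with energy below \<open>\<sigma>\<close>, which bounds the energy of a constant above the obstacle, touches the
obstacle, and it has slope strictly less than \<open>tan \<phi>\<^sub>0\<close> by the continuous version of the turning bound (\<open>bounded_competitor\<close>).

Throughout, a Sobolev function is represented as the indefinite integral of its weak derivative
(\<open>is_primitive\<close>); this is justified by the lemma of du Bois-Reymond.
\<close>

section \<open>Integrals over the unit interval\<close>

lemma AE_unit_iff: "(AE x in unit_meas. P x) \<longleftrightarrow> negligible {x \<in> {0<..<1}. \<not> P x}"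
proof -
  have "(AE x in unit_meas. P x) \<longleftrightarrow> (AE x in lebesgue. x \<in> {0<..<1::real} \<longrightarrow> P x)"
    unfolding unit_meas_def by (rule AE_restrict_space_iff) auto
  also have "\<dots> \<longleftrightarrow> {x \<in> {0<..<1}. \<not> P x} \<in> null_sets lebesgue"
    unfolding completion.AE_iff_null_sets by (intro arg_cong[where f="\<lambda>S. S \<in> _"]) auto
  finally show ?thesis by (simp add: negligible_iff_null_sets)
qed

lemma integrable_unit_iff:
  fixes f :: "real \<Rightarrow> real"
  shows "integrable unit_meas f \<longleftrightarrow> f absolutely_integrable_on {0..1}"
proof -
  have "integrable unit_meas f \<longleftrightarrow> f absolutely_integrable_on {0<..<1}"
    unfolding unit_meas_def set_integrable_def by (rule integrable_restrict_space) auto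
  also have "\<dots> \<longleftrightarrow> f absolutely_integrable_on {0..1}"
    using absolutely_integrable_on_open_interval[of 0 1 f] by simp
  finally show ?thesis .
qed

lemma integral_unit:
  fixes f :: "real \<Rightarrow> real"
  assumes "f absolutely_integrable_on {0..1}"
  shows "(LINT x|unit_meas. f x) = integral {0..1} f"
proof -
  have "integrable (lebesgue_on {0<..<1}) f"
    using assms integrable_unit_iff unfolding unit_meas_def by blast
  then show ?thesis
    unfolding unit_meas_def integral_open_interval_real
    by (rule lebesgue_integral_eq_integral) auto
qed

lemma square_integrable_imp:
  assumes "square_integrable g"
  shows "g absolutely_integrable_on {0..1}" "(\<lambda>x. (g x)\<^sup>2) absolutely_integrable_on {0..1}"
proof -
  show 2: "(\<lambda>x. (g x)\<^sup>2) absolutely_integrable_on {0..1}"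
    using assms unfolding square_integrable_def integrable_unit_iff by auto
  have "integrable unit_meas (\<lambda>x. 1 + (g x)\<^sup>2)"
    using 2 unfolding integrable_unit_iff
    by (intro set_integral_add) (auto intro: absolutely_integrable_continuous_real)
  moreover have "\<bar>t\<bar> \<le> 1 + t\<^sup>2" for t :: real
  proof -
    have "0 \<le> (\<bar>t\<bar> - 1)\<^sup>2" by simp
    then have "2 * \<bar>t\<bar> \<le> 1 + t\<^sup>2" by (simp add: power2_diff)
    then show ?thesis by simp
  qed
  ultimately have "integrable unit_meas g"
    using assms borel_measurable_integrable unfolding square_integrable_def
    by (intro Bochner_Integration.integrable_bound[of unit_meas "\<lambda>x. 1 + (g x)\<^sup>2" g]) auto
  then show "g absolutely_integrable_on {0..1}" by (simp add: integrable_unit_iff)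
qed

lemma square_integrableI:
  assumes "g absolutely_integrable_on {0..1}" "(\<lambda>x. (g x)\<^sup>2) integrable_on {0..1}"
  shows "square_integrable g"
proof -
  have "integrable unit_meas g" using assms by (simp add: integrable_unit_iff)
  moreover have "(\<lambda>x. (g x)\<^sup>2) absolutely_integrable_on {0..1}"
    using assms(2) by (rule nonnegative_absolutely_integrable_1) auto
  ultimately show ?thesis
    unfolding square_integrable_def by (simp add: integrable_unit_iff borel_measurable_integrable)
qed

lemma abs_int_cong_AE:
  fixes f g :: "real \<Rightarrow> real"
  assumes "AE x in unit_meas. f x = g x" "0 \<le> a" "b \<le> 1"
  shows "f absolutely_integrable_on {a..b} \<longleftrightarrow> g absolutely_integrable_on {a..b}"
    and "integral {a..b} f = integral {a..b} g"
proof -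
  let ?S = "{x \<in> {0<..<1}. \<not> f x = g x} \<union> {0, 1}"
  have S: "negligible ?S"
    using assms(1) unfolding AE_unit_iff by auto
  have eq: "f x = g x" if "x \<in> {a..b} - ?S" for x
    using that assms by force
  have "g absolutely_integrable_on {a..b}" if "f absolutely_integrable_on {a..b}"
    by (rule absolutely_integrable_spike[OF that S eq[symmetric]])
  moreover have "f absolutely_integrable_on {a..b}" if "g absolutely_integrable_on {a..b}"
    by (rule absolutely_integrable_spike[OF that S eq])
  ultimately show "f absolutely_integrable_on {a..b} \<longleftrightarrow> g absolutely_integrable_on {a..b}"
    by blast
  show "integral {a..b} f = integral {a..b} g"
    by (rule integral_spike[OF S eq[symmetric]])
qed

lemma abs_intD:
  fixes f :: "real \<Rightarrow> real"
  assumes "f absolutely_integrable_on S"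
  shows "f integrable_on S" "(\<lambda>x. \<bar>f x\<bar>) integrable_on S"
  using assms by (auto simp: absolutely_integrable_on_def)

lemma integrable_cmult_real:
  fixes f :: "real \<Rightarrow> real"
  shows "f integrable_on S \<Longrightarrow> (\<lambda>x. c * f x) integrable_on S"
  using integrable_on_cmult_left[of f S c] by simp

lemma abs_int_sub:
  fixes f :: "real \<Rightarrow> real"
  assumes "f absolutely_integrable_on {a..b}" "a \<le> c" "d \<le> b"
  shows "f absolutely_integrable_on {c..d}" "f integrable_on {c..d}"
proof -
  show "f absolutely_integrable_on {c..d}"
    by (rule absolutely_integrable_on_subinterval[OF assms(1)]) (use assms in auto)
  then show "f integrable_on {c..d}"
    by (rule set_lebesgue_integral_eq_integral)
qed

lemma abs_int_mult_continuous:
  fixes f g :: "real \<Rightarrow> real"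
  assumes "continuous_on {a..b} f" "g absolutely_integrable_on {a..b}"
  shows "(\<lambda>x. f x * g x) absolutely_integrable_on {a..b}"
proof (rule absolutely_integrable_bounded_measurable_product_real)
  show "f \<in> borel_measurable (lebesgue_on {a..b})"
    using assms(1) by (rule continuous_imp_measurable_on_sets_lebesgue) auto
  show "bounded (f ` {a..b})"
    using assms(1) by (intro compact_imp_bounded compact_continuous_image) auto
qed (use assms in auto)

section \<open>Calculus of indefinite integrals\<close>

text \<open>Over a fine uniform partition, the local increments telescope and leave an error of at most
  \<open>\<epsilon>\<close> times the integral of \<open>k\<close>, for every \<open>\<epsilon>\<close>.\<close>

lemma telescope_local:
  fixes \<Phi> m k :: "real \<Rightarrow> real"
  assumes "a \<le> b" and m: "m integrable_on {a..b}" and k: "k integrable_on {a..b}"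
    and loc: "\<And>\<epsilon>. \<epsilon> > 0 \<Longrightarrow> \<exists>\<eta>>0. \<forall>c d. a \<le> c \<longrightarrow> c \<le> d \<longrightarrow> d \<le> b \<longrightarrow> d - c < \<eta> \<longrightarrow>
                \<bar>\<Phi> d - \<Phi> c - integral {c..d} m\<bar> \<le> \<epsilon> * integral {c..d} k"
  shows "\<Phi> b - \<Phi> a = integral {a..b} m"
proof -
  have bound: "\<bar>\<Phi> b - \<Phi> a - integral {a..b} m\<bar> \<le> \<epsilon> * integral {a..b} k" if "\<epsilon> > 0" for \<epsilon>
  proof -
    obtain \<eta> where "\<eta> > 0" and \<eta>: "\<And>c d. \<lbrakk>a \<le> c; c \<le> d; d \<le> b; d - c < \<eta>\<rbrakk> \<Longrightarrow>
                \<bar>\<Phi> d - \<Phi> c - integral {c..d} m\<bar> \<le> \<epsilon> * integral {c..d} k"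
      using loc[OF \<open>\<epsilon> > 0\<close>] by blast
    obtain n0 :: nat where "(b - a) / \<eta> < real n0" using reals_Archimedean2 by blast
    then obtain n :: nat where n: "(b - a) / \<eta> < real n" "n > 0"
      by (intro that[of "Suc n0"]) auto
    define t where "t = (\<lambda>i::nat. a + real i * ((b - a) / real n))"
    have w: "(b - a) / real n < \<eta>" "0 \<le> (b - a) / real n"
      using n \<open>a \<le> b\<close> \<open>\<eta> > 0\<close> by (auto simp: field_simps)
    have step: "t (Suc i) - t i < \<eta>" "t i \<le> t (Suc i)" "a \<le> t i" for i
    proof -
      have "t (Suc i) = t i + (b - a) / real n" by (simp add: t_def add_divide_distrib distrib_right)
      then show "t (Suc i) - t i < \<eta>" "t i \<le> t (Suc i)" using w by auto
      show "a \<le> t i" using mult_nonneg_nonneg[OF _ w(2), of "real i"] by (simp add: t_def)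
    qed
    have tb: "t i \<le> b" if "i \<le> n" for i
    proof -
      have "real i * ((b - a) / real n) \<le> real n * ((b - a) / real n)"
        using that \<open>a \<le> b\<close> by (intro mult_right_mono) auto
      also have "\<dots> = b - a" using n by simp
      finally show ?thesis by (simp add: t_def)
    qed
    have "i \<le> n \<Longrightarrow> \<bar>\<Phi> (t i) - \<Phi> a - integral {a..t i} m\<bar> \<le> \<epsilon> * integral {a..t i} k" for i
    proof (induction i)
      case 0
      then show ?case by (simp add: t_def)
    next
      case (Suc i)
      have "integral {a..t i} f + integral {t i..t (Suc i)} f = integral {a..t (Suc i)} f"
        if "f integrable_on {a..b}" for f :: "real \<Rightarrow> real"
        using step[of i] tb[OF Suc.prems] that
        by (intro Henstock_Kurzweil_Integration.integral_combine)
           (auto intro: integrable_subinterval_real)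
      note this[OF m, symmetric] this[OF k, symmetric]
      moreover have "\<bar>\<Phi> (t (Suc i)) - \<Phi> (t i) - integral {t i..t (Suc i)} m\<bar>
          \<le> \<epsilon> * integral {t i..t (Suc i)} k"
        using step[of i] tb[OF Suc.prems] by (intro \<eta>) auto
      ultimately show ?case using Suc by (simp add: algebra_simps)
    qed
    from this[of n] show ?thesis using n by (simp add: t_def)
  qed
  show ?thesis
  proof (rule ccontr)
    define x where "x = \<bar>\<Phi> b - \<Phi> a - integral {a..b} m\<bar>"
    assume "\<Phi> b - \<Phi> a \<noteq> integral {a..b} m"
    then have "x > 0" by (simp add: x_def)
    have "x \<le> (x / (2 * (\<bar>integral {a..b} k\<bar> + 1))) * integral {a..b} k"
      unfolding x_def[symmetric] using bound[of "x / (2 * (\<bar>integral {a..b} k\<bar> + 1))"] \<open>x > 0\<close>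
      unfolding x_def[symmetric] by auto
    also have "\<dots> \<le> (x / (2 * (\<bar>integral {a..b} k\<bar> + 1))) * (\<bar>integral {a..b} k\<bar> + 1)"
      using \<open>x > 0\<close> by (intro mult_left_mono) auto
    also have "\<dots> = x / 2"
      using abs_ge_zero[of "integral {a..b} k"] by (simp add: field_simps)
    finally show False using \<open>x > 0\<close> by simp
  qed
qed

text \<open>On short intervals, \<open>r \<xi>\<close> differs little from \<open>r x\<close>, so
  \<open>telescope_local\<close> applies with \<open>k = |g|\<close>. In this form the mean value theorem
  gives chain rules for functions that are only indefinite integrals.\<close>

lemma integral_of_mean_value:
  fixes \<Phi> r g :: "real \<Rightarrow> real"
  assumes "a \<le> b" and r: "continuous_on {a..b} r" and g: "g absolutely_integrable_on {a..b}"
    and mv: "\<And>c d. \<lbrakk>a \<le> c; c \<le> d; d \<le> b\<rbrakk> \<Longrightarrow> \<exists>\<xi>\<in>{c..d}. \<Phi> d - \<Phi> c = r \<xi> * integral {c..d} g"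
  shows "\<Phi> b - \<Phi> a = integral {a..b} (\<lambda>x. r x * g x)"
proof (rule telescope_local[OF \<open>a \<le> b\<close>, where k = "\<lambda>x. \<bar>g x\<bar>"])
  have rg: "(\<lambda>x. r x * g x) absolutely_integrable_on {a..b}"
    using r g by (rule abs_int_mult_continuous)
  then show "(\<lambda>x. r x * g x) integrable_on {a..b}"
    by (rule abs_intD)
  have ag: "(\<lambda>x. \<bar>g x\<bar>) integrable_on {a..b}"
    using g by (rule abs_intD)
  then show "(\<lambda>x. \<bar>g x\<bar>) integrable_on {a..b}" .
  fix \<epsilon> :: real assume "\<epsilon> > 0"
  have "uniformly_continuous_on {a..b} r"
    using r by (rule compact_uniformly_continuous) auto
  then obtain \<eta> where "\<eta> > 0" and
    \<eta>: "\<And>x y. \<lbrakk>x \<in> {a..b}; y \<in> {a..b}; dist y x < \<eta>\<rbrakk> \<Longrightarrow> dist (r y) (r x) < \<epsilon>"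
    unfolding uniformly_continuous_on_def using \<open>\<epsilon> > 0\<close> by metis
  show "\<exists>\<eta>>0. \<forall>c d. a \<le> c \<longrightarrow> c \<le> d \<longrightarrow> d \<le> b \<longrightarrow> d - c < \<eta> \<longrightarrow>
      \<bar>\<Phi> d - \<Phi> c - integral {c..d} (\<lambda>x. r x * g x)\<bar> \<le> \<epsilon> * integral {c..d} (\<lambda>x. \<bar>g x\<bar>)"
  proof (intro exI[of _ \<eta>] conjI allI impI \<open>\<eta> > 0\<close>)
    fix c d assume cd: "a \<le> c" "c \<le> d" "d \<le> b" "d - c < \<eta>"
    obtain \<xi> where \<xi>: "\<xi> \<in> {c..d}" "\<Phi> d - \<Phi> c = r \<xi> * integral {c..d} g"
      using mv[OF cd(1-3)] by blast
    have gi: "g integrable_on {c..d}" and rgi: "(\<lambda>x. r x * g x) integrable_on {c..d}"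
      using abs_int_sub(2)[OF g] abs_int_sub(2)[OF rg] cd by auto
    have rgi': "(\<lambda>x. r \<xi> * g x) integrable_on {c..d}"
      using gi by (rule integrable_cmult_real)
    have "\<Phi> d - \<Phi> c - integral {c..d} (\<lambda>x. r x * g x) = integral {c..d} (\<lambda>x. r \<xi> * g x - r x * g x)"
      using rgi' rgi \<xi> by (subst integral_diff) auto
    also have "norm \<dots> \<le> integral {c..d} (\<lambda>x. \<epsilon> * \<bar>g x\<bar>)"
    proof (rule integral_norm_bound_integral)
      show "(\<lambda>x. r \<xi> * g x - r x * g x) integrable_on {c..d}"
        using rgi' rgi by (intro integrable_diff) auto
      show "(\<lambda>x. \<epsilon> * \<bar>g x\<bar>) integrable_on {c..d}"
        using integrable_subinterval_real[OF ag, of c d] cd by (auto intro: integrable_cmult_real)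
      fix x assume x: "x \<in> {c..d}"
      have "\<bar>r \<xi> - r x\<bar> \<le> \<epsilon>"
        using \<eta>[of x \<xi>] x \<xi>(1) cd by (force simp: dist_real_def)
      then show "norm (r \<xi> * g x - r x * g x) \<le> \<epsilon> * \<bar>g x\<bar>"
        by (simp add: left_diff_distrib[symmetric] abs_mult mult_right_mono)
    qed
    finally show "\<bar>\<Phi> d - \<Phi> c - integral {c..d} (\<lambda>x. r x * g x)\<bar> \<le> \<epsilon> * integral {c..d} (\<lambda>x. \<bar>g x\<bar>)"
      by simp
  qed
qed

text \<open>The continuous representative of an \<open>H\<^sup>1\<close> function is exactly a primitive, in this
  sense, of its weak derivative.\<close>

definition is_primitive :: "(real \<Rightarrow> real) \<Rightarrow> (real \<Rightarrow> real) \<Rightarrow> bool" where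
  "is_primitive u g \<longleftrightarrow> g absolutely_integrable_on {0..1} \<and>
     (\<forall>x\<in>{0..1}. u x - u 0 = integral {0..x} g)"

lemma primitiveI:
  assumes "g absolutely_integrable_on {0..1}"
    and "\<And>x. 0 \<le> x \<Longrightarrow> x \<le> 1 \<Longrightarrow> u x - u 0 = integral {0..x} g"
  shows "is_primitive u g"
  unfolding is_primitive_def using assms by auto

lemma primitive_abs_int: "is_primitive u g \<Longrightarrow> g absolutely_integrable_on {0..1}"
  by (simp add: is_primitive_def)

lemma primitive_eq:
  assumes "is_primitive u g" "0 \<le> x" "x \<le> 1"
  shows "u x - u 0 = integral {0..x} g"
  using assms unfolding is_primitive_def by auto

lemma primitive_diff:
  assumes "is_primitive u g" "0 \<le> a" "a \<le> b" "b \<le> 1"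
  shows "u b - u a = integral {a..b} g"
proof -
  have "integral {0..a} g + integral {a..b} g = integral {0..b} g"
    using assms(2-4) primitive_abs_int[OF assms(1)]
    by (intro Henstock_Kurzweil_Integration.integral_combine abs_int_sub(2)[where a = 0 and b = 1]) auto
  with primitive_eq[OF assms(1), of a] primitive_eq[OF assms(1), of b] assms(2-4)
  show ?thesis by linarith
qed

lemma primitive_continuous:
  assumes "is_primitive u g"
  shows "continuous_on {0..1} u"
proof -
  have "continuous_on {0..1} (\<lambda>x. u 0 + integral {0..x} g)"
    using primitive_abs_int[OF assms]
    by (intro continuous_intros indefinite_integral_continuous_1 abs_int_sub(2)[where a = 0 and b = 1]) auto
  then show ?thesis
    by (rule continuous_on_eq) (use primitive_eq[OF assms, symmetric] in auto)
qed

lemma primitive_lincomb: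
  assumes "is_primitive u f" "is_primitive v g"
  shows "is_primitive (\<lambda>x. \<alpha> * u x + \<beta> * v x) (\<lambda>x. \<alpha> * f x + \<beta> * g x)"
proof -
  have f: "f absolutely_integrable_on {0..1}" and g: "g absolutely_integrable_on {0..1}"
    using assms by (auto intro: primitive_abs_int)
  have "integral {0..x} (\<lambda>x. \<alpha> * f x + \<beta> * g x) = \<alpha> * integral {0..x} f + \<beta> * integral {0..x} g"
    if "x \<in> {0..1}" for x
    using abs_int_sub(2)[OF f, of 0 x] abs_int_sub(2)[OF g, of 0 x] that
    by (subst integral_add) (auto intro: integrable_cmult_real)
  moreover have "(\<lambda>x. \<alpha> * f x + \<beta> * g x) absolutely_integrable_on {0..1}"
    using f g by (intro set_integral_add(1)) auto
  moreover have "\<alpha> * u x + \<beta> * v x - (\<alpha> * u 0 + \<beta> * v 0) =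
      \<alpha> * integral {0..x} f + \<beta> * integral {0..x} g" if "x \<in> {0..1}" for x
  proof -
    have "\<alpha> * u x + \<beta> * v x - (\<alpha> * u 0 + \<beta> * v 0) = \<alpha> * (u x - u 0) + \<beta> * (v x - v 0)"
      by (simp add: algebra_simps)
    then show ?thesis using primitive_eq[OF assms(1)] primitive_eq[OF assms(2)] that by simp
  qed
  ultimately show ?thesis
    by (intro primitiveI) auto
qed

lemma primitive_cong:
  assumes "is_primitive u g" "\<And>x. x \<in> {0..1} \<Longrightarrow> u x = v x" "AE x in unit_meas. g x = h x"
  shows "is_primitive v h"
proof -
  have "h absolutely_integrable_on {0..1}"
    using abs_int_cong_AE(1)[OF assms(3), of 0 1] primitive_abs_int[OF assms(1)] by auto
  moreover have "integral {0..x} g = integral {0..x} h" if "x \<in> {0..1}" for x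
    using abs_int_cong_AE(2)[OF assms(3), of 0 x] that by auto
  ultimately show ?thesis
    using primitive_eq[OF assms(1)] assms(2)[symmetric] by (intro primitiveI) auto
qed

lemma mean_value_segment:
  fixes F F' :: "real \<Rightarrow> real"
  assumes "\<And>t. t \<in> closed_segment a b \<Longrightarrow> (F has_real_derivative F' t) (at t)"
  shows "\<exists>\<xi>\<in>closed_segment a b. F b - F a = F' \<xi> * (b - a)"
proof (cases a b rule: linorder_cases)
  case less
  obtain z where "a < z" "z < b" "F b - F a = (b - a) * F' z"
    using MVT2[OF less, of F F'] assms less by (auto simp: closed_segment_eq_real_ivl)
  then show ?thesis using less by (intro bexI[of _ z]) (auto simp: closed_segment_eq_real_ivl)
next
  case greater
  obtain z where "b < z" "z < a" "F a - F b = (a - b) * F' z"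
    using MVT2[OF greater, of F F'] assms greater by (auto simp: closed_segment_eq_real_ivl)
  then show ?thesis
    using greater by (intro bexI[of _ z]) (auto simp: closed_segment_eq_real_ivl algebra_simps)
qed auto

lemma closed_segment_in_image:
  fixes p :: "real \<Rightarrow> real"
  assumes "continuous_on {c..d} p" "c \<le> d"
  shows "closed_segment (p c) (p d) \<subseteq> p ` {c..d}"
proof -
  have "connected (p ` {c..d})"
    using assms(1) by (rule connected_continuous_image) auto
  then have "convex (p ` {c..d})"
    using is_interval_connected_1 is_interval_convex_1 by blast
  then show ?thesis using assms(2) by (intro closed_segment_subset) auto
qed

text \<open>The mean value theorem gives the increment \<open>F' \<xi> * (p d - p c)\<close> with
  \<open>\<xi>\<close> between \<open>p c\<close> and \<open>p d\<close>, and continuity of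
  \<open>p\<close> gives \<open>\<xi> = p y\<close> with \<open>y\<close> between \<open>c\<close> and
  \<open>d\<close>.\<close>

lemma chain_rule_primitive:
  assumes p: "is_primitive p q"
    and F: "\<And>t. (F has_real_derivative F' t) (at t)" and F': "continuous_on UNIV F'"
  shows "is_primitive (\<lambda>x. F (p x)) (\<lambda>x. F' (p x) * q x)"
proof -
  have q: "q absolutely_integrable_on {0..1}" using p by (simp add: is_primitive_def)
  have pc: "continuous_on {0..1} p" using p by (rule primitive_continuous)
  have F'p: "continuous_on {0..1} (\<lambda>x. F' (p x))"
    by (rule continuous_on_compose2[OF F' pc]) auto
  have "F (p b) - F (p 0) = integral {0..b} (\<lambda>x. F' (p x) * q x)" if b: "b \<in> {0..1}" for b
  proof (rule integral_of_mean_value)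
    show "continuous_on {0..b} (\<lambda>x. F' (p x))" "q absolutely_integrable_on {0..b}"
      using b abs_int_sub(1)[OF q] by (auto intro: continuous_on_subset[OF F'p])
    fix c d assume cd: "0 \<le> c" "c \<le> d" "d \<le> b"
    obtain \<xi> where \<xi>: "\<xi> \<in> closed_segment (p c) (p d)" "F (p d) - F (p c) = F' \<xi> * (p d - p c)"
      using mean_value_segment[of "p c" "p d" F F'] F by auto
    have "closed_segment (p c) (p d) \<subseteq> p ` {c..d}"
      using cd b by (intro closed_segment_in_image continuous_on_subset[OF pc]) auto
    then obtain y where "y \<in> {c..d}" "\<xi> = p y" using \<xi>(1) by blast
    moreover have "p d - p c = integral {c..d} q"
      using primitive_diff[OF p, of c d] cd b by auto
    ultimately show "\<exists>\<xi>\<in>{c..d}. F (p d) - F (p c) = F' (p \<xi>) * integral {c..d} q"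
      using \<xi>(2) by auto
  qed (use b in auto)
  moreover have "(\<lambda>x. F' (p x) * q x) absolutely_integrable_on {0..1}"
    using F'p q by (rule abs_int_mult_continuous)
  ultimately show ?thesis by (intro primitiveI) auto
qed

text \<open>The mean value identity of the chain rule, solved for the increment of \<open>p\<close>. It transfers
  regularity from \<open>F \<circ> p\<close> to \<open>p\<close>.\<close>

lemma inverse_chain_rule_primitive:
  assumes Fp: "is_primitive (\<lambda>x. F (p x)) g" and pc: "continuous_on {0..1} p"
    and F: "\<And>t. (F has_real_derivative F' t) (at t)" and F': "continuous_on UNIV F'"
    and pos: "\<And>t. F' t > 0"
  shows "is_primitive p (\<lambda>x. g x / F' (p x))"
proof -
  have g: "g absolutely_integrable_on {0..1}" using Fp by (simp add: is_primitive_def)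
  have F'p: "continuous_on {0..1} (\<lambda>x. 1 / F' (p x))"
    by (intro continuous_intros continuous_on_compose2[OF F' pc]) (use pos in \<open>auto simp: less_le\<close>)
  have "p b - p 0 = integral {0..b} (\<lambda>x. 1 / F' (p x) * g x)" if b: "b \<in> {0..1}" for b
  proof (rule integral_of_mean_value)
    show "continuous_on {0..b} (\<lambda>x. 1 / F' (p x))" "g absolutely_integrable_on {0..b}"
      using b abs_int_sub(1)[OF g] by (auto intro: continuous_on_subset[OF F'p])
    fix c d assume cd: "0 \<le> c" "c \<le> d" "d \<le> b"
    obtain \<xi> where \<xi>: "\<xi> \<in> closed_segment (p c) (p d)" "F (p d) - F (p c) = F' \<xi> * (p d - p c)"
      using mean_value_segment[of "p c" "p d" F F'] F by auto
    have "closed_segment (p c) (p d) \<subseteq> p ` {c..d}"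
      using cd b by (intro closed_segment_in_image continuous_on_subset[OF pc]) auto
    then obtain y where "y \<in> {c..d}" "\<xi> = p y" using \<xi>(1) by blast
    moreover have "F (p d) - F (p c) = integral {c..d} g"
      using primitive_diff[OF Fp, of c d] cd b by auto
    ultimately show "\<exists>\<xi>\<in>{c..d}. p d - p c = 1 / F' (p \<xi>) * integral {c..d} g"
      using \<xi>(2) pos[of \<xi>] by (intro bexI[of _ y]) (auto simp: field_simps)
  qed (use b in auto)
  moreover have "(\<lambda>x. 1 / F' (p x) * g x) absolutely_integrable_on {0..1}"
    using F'p g by (rule abs_int_mult_continuous)
  ultimately show ?thesis by (intro primitiveI) auto
qed

text \<open>By polarization, the product rule is the chain rule for the square.\<close>

lemma primitive_mult:
  assumes u: "is_primitive u f" and v: "is_primitive v g"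
  shows "is_primitive (\<lambda>x. u x * v x) (\<lambda>x. u x * g x + f x * v x)"
proof -
  have sq: "is_primitive (\<lambda>x. (w x)\<^sup>2) (\<lambda>x. 2 * w x * h x)" if "is_primitive w h" for w h
    by (rule chain_rule_primitive[OF that, where F = "\<lambda>t. t\<^sup>2" and F' = "\<lambda>t. 2 * t"])
       (auto intro!: derivative_eq_intros continuous_intros)
  have 1: "is_primitive (\<lambda>x. 1 * u x + 1 * v x) (\<lambda>x. 1 * f x + 1 * g x)"
    by (rule primitive_lincomb[OF u v])
  have 2: "is_primitive (\<lambda>x. 1 * u x + (-1) * v x) (\<lambda>x. 1 * f x + (-1) * g x)"
    by (rule primitive_lincomb[OF u v])
  show ?thesis
  proof (rule primitive_cong[OF primitive_lincomb[OF sq[OF 1] sq[OF 2], of "1/4" "-1/4"]])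
    show "1/4 * (1 * u x + 1 * v x)\<^sup>2 + -1/4 * (1 * u x + - 1 * v x)\<^sup>2 = u x * v x" for x
      by (simp add: power2_eq_square algebra_simps)
    have "1/4 * (2 * (1 * u x + 1 * v x) * (1 * f x + 1 * g x)) +
        -1/4 * (2 * (1 * u x + - 1 * v x) * (1 * f x + - 1 * g x)) = u x * g x + f x * v x" for x
      by (simp add: algebra_simps)
    then show "AE x in unit_meas. 1/4 * (2 * (1 * u x + 1 * v x) * (1 * f x + 1 * g x)) +
        -1/4 * (2 * (1 * u x + - 1 * v x) * (1 * f x + - 1 * g x)) = u x * g x + f x * v x"
      by (intro AE_I2)
  qed
qed

lemma integration_by_parts_primitive:
  assumes u: "is_primitive u f" and v: "is_primitive v g"
  shows "integral {0..1} (\<lambda>x. u x * g x) = u 1 * v 1 - u 0 * v 0 - integral {0..1} (\<lambda>x. f x * v x)"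
proof -
  from primitive_diff[OF primitive_mult[OF u v], of 0 1]
  have "u 1 * v 1 - u 0 * v 0 = integral {0..1} (\<lambda>x. u x * g x + f x * v x)" by simp
  also have "\<dots> = integral {0..1} (\<lambda>x. u x * g x) + integral {0..1} (\<lambda>x. f x * v x)"
  proof (rule integral_add)
    have f: "f absolutely_integrable_on {0..1}" and g: "g absolutely_integrable_on {0..1}"
      using u v by (auto intro: primitive_abs_int)
    show "(\<lambda>x. u x * g x) integrable_on {0..1}"
      using abs_int_mult_continuous[OF primitive_continuous[OF u] g] by (rule abs_intD)
    show "(\<lambda>x. f x * v x) integrable_on {0..1}"
      using abs_intD(1)[OF abs_int_mult_continuous[OF primitive_continuous[OF v] f]]
      by (simp add: mult.commute)
  qed
  finally show ?thesis by simp
qed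

section \<open>Weak derivatives\<close>

text \<open>The sign of \<open>f\<close> is an almost everywhere limit of continuous functions with values in
  \<open>[-1, 1]\<close>, and \<open>f\<close> integrates to zero against each of them; in the limit, the
  integral of \<open>|f|\<close> is zero.\<close>

lemma AE_zero_if_interval_integrals_zero:
  fixes f :: "real \<Rightarrow> real"
  assumes f: "f absolutely_integrable_on {0..1}"
    and zero: "\<And>a b. \<lbrakk>0 \<le> a; a \<le> b; b \<le> 1\<rbrakk> \<Longrightarrow> integral {a..b} f = 0"
  shows "AE x in unit_meas. f x = 0"
proof -
  define h where "h = (\<lambda>x. sgn (indicat_real {0..1} x *\<^sub>R f x))"
  have "(\<lambda>x. indicat_real {0..1} x *\<^sub>R f x) \<in> borel_measurable lebesgue"
    using f unfolding set_integrable_def by (rule borel_measurable_integrable)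
  then have "h \<in> borel_measurable lebesgue"
    unfolding h_def by measurable
  then have "h measurable_on UNIV"
    by (rule lebesgue_measurable_imp_measurable_on) auto
  then obtain N g where N: "negligible N" and g: "\<And>n. continuous_on UNIV (g n)"
    and lim: "\<And>x. x \<notin> N \<Longrightarrow> (\<lambda>n. g n x) \<longlonglongrightarrow> h x"
    unfolding measurable_on_def by auto
  define r where "r = (\<lambda>n x. max (-1) (min 1 (g n x :: real)))"
  have r: "continuous_on S (r n)" for S n
    unfolding r_def by (intro continuous_intros continuous_on_subset[OF g]) auto
  have 0: "integral {0..1} (\<lambda>x. r n x * f x) = 0" for n
    using integral_of_mean_value[of 0 1 "r n" f "\<lambda>_. 0"] r f zero by auto
  have rf: "(\<lambda>x. r n x * f x) absolutely_integrable_on {0..1}" for n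
    using r f by (rule abs_int_mult_continuous)
  have fi: "integrable unit_meas f" using f by (simp add: integrable_unit_iff)
  have "(\<lambda>n. LINT x|unit_meas. r n x * f x) \<longlonglongrightarrow> (LINT x|unit_meas. \<bar>f x\<bar>)"
  proof (rule integral_dominated_convergence[where w = "\<lambda>x. \<bar>f x\<bar>"])
    show "(\<lambda>x. \<bar>f x\<bar>) \<in> borel_measurable unit_meas" using fi by simp
    show "integrable unit_meas (\<lambda>x. \<bar>f x\<bar>)" using fi by simp
    show "(\<lambda>x. r n x * f x) \<in> borel_measurable unit_meas" for n
      using rf[of n] by (simp add: integrable_unit_iff[symmetric] borel_measurable_integrable)
    show "AE x in unit_meas. norm (r n x * f x) \<le> \<bar>f x\<bar>" for n
      by (intro AE_I2) (auto simp: abs_mult r_def intro!: mult_left_le_one_le)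
    show "AE x in unit_meas. (\<lambda>n. r n x * f x) \<longlonglongrightarrow> \<bar>f x\<bar>"
      unfolding AE_unit_iff
    proof (rule negligible_subset[OF N], clarsimp, rule ccontr)
      fix x :: real assume x: "0 < x" "x < 1" and no: "\<not> (\<lambda>n. r n x * f x) \<longlonglongrightarrow> \<bar>f x\<bar>" and "x \<notin> N"
      have "(\<lambda>n. r n x * f x) \<longlonglongrightarrow> max (-1) (min 1 (h x)) * f x"
        unfolding r_def by (intro tendsto_intros lim \<open>x \<notin> N\<close>)
      also have "max (-1) (min 1 (h x)) * f x = \<bar>f x\<bar>"
        using x by (auto simp: h_def sgn_if)
      finally show False using no by simp
    qed
  qed
  then have "(LINT x|unit_meas. \<bar>f x\<bar>) = 0"
    by (simp add: integral_unit[OF rf] 0 LIMSEQ_const_iff)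
  then show ?thesis
    using integral_nonneg_eq_0_iff_AE[of unit_meas "\<lambda>x. \<bar>f x\<bar>"] fi by auto
qed

lemma C1_deriv:
  fixes \<phi> :: "real \<Rightarrow> real"
  assumes "\<phi> C1_differentiable_on UNIV"
  shows "(\<phi> has_real_derivative deriv \<phi> x) (at x)" "continuous_on UNIV (deriv \<phi>)"
proof -
  obtain D where D: "\<And>x. (\<phi> has_vector_derivative D x) (at x)" "continuous_on UNIV D"
    using assms unfolding C1_differentiable_on_def by auto
  have D1: "(\<phi> has_real_derivative D x) (at x)" for x
    using D(1) by (simp add: has_real_derivative_iff_has_vector_derivative)
  then have "deriv \<phi> = D" by (intro ext DERIV_imp_deriv)
  then show "(\<phi> has_real_derivative deriv \<phi> x) (at x)" "continuous_on UNIV (deriv \<phi>)"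
    using D1 D(2) by auto
qed

lemma primitive_C1:
  fixes \<phi> \<phi>' :: "real \<Rightarrow> real"
  assumes "\<And>x. (\<phi> has_real_derivative \<phi>' x) (at x)" "continuous_on UNIV \<phi>'"
  shows "is_primitive \<phi> \<phi>'"
proof (rule primitiveI)
  show "\<phi>' absolutely_integrable_on {0..1}"
    by (intro absolutely_integrable_continuous_real continuous_on_subset[OF assms(2)]) auto
  fix x :: real assume "0 \<le> x" "x \<le> 1"
  then have "(\<phi>' has_integral (\<phi> x - \<phi> 0)) {0..x}"
    using assms(1) by (intro fundamental_theorem_of_calculus)
      (auto simp: has_real_derivative_iff_has_vector_derivative[symmetric]
            intro: has_field_derivative_at_within)
  then show "\<phi> x - \<phi> 0 = integral {0..x} \<phi>'" by (simp add: integral_unique)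
qed

lemma test_functionD:
  assumes "test_function \<phi>"
  shows "is_primitive \<phi> (deriv \<phi>)" "continuous_on S (deriv \<phi>)" "continuous_on S \<phi>"
    "\<phi> 0 = 0" "\<phi> 1 = 0"
proof -
  have C1: "\<phi> C1_differentiable_on UNIV" and cl: "closure {x. \<phi> x \<noteq> 0} \<subseteq> {0<..<1}"
    using assms by (auto simp: test_function_def)
  show "is_primitive \<phi> (deriv \<phi>)" "continuous_on S (deriv \<phi>)" "continuous_on S \<phi>"
    using C1_deriv[OF C1] 
    by (auto intro: primitive_C1 continuous_on_subset DERIV_continuous_on has_field_derivative_at_within)
  show "\<phi> 0 = 0" "\<phi> 1 = 0"
    using cl closure_subset[of "{x. \<phi> x \<noteq> 0}"] by fastforce+
qed

lemma primitive_imp_weak_deriv: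
  assumes u: "is_primitive u g" and g: "square_integrable g"
  shows "has_weak_deriv u g"
  unfolding has_weak_deriv_def
proof (intro conjI allI impI g)
  fix \<phi> assume \<phi>: "test_function \<phi>"
  note T = test_functionD[OF \<phi>]
  have 1: "(\<lambda>x. u x * deriv \<phi> x) absolutely_integrable_on {0..1}"
    by (intro abs_int_mult_continuous primitive_continuous[OF u] primitive_abs_int[OF T(1)])
  have "(\<lambda>x. \<phi> x * g x) absolutely_integrable_on {0..1}"
    by (intro abs_int_mult_continuous T(3) primitive_abs_int[OF u])
  then have 2: "(\<lambda>x. g x * \<phi> x) absolutely_integrable_on {0..1}" by (simp add: mult.commute)
  show "(LINT x|unit_meas. u x * deriv \<phi> x) = - (LINT x|unit_meas. g x * \<phi> x)"
    unfolding integral_unit[OF 1] integral_unit[OF 2]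
    using integration_by_parts_primitive[OF u T(1)] T(4,5) by simp
qed

text \<open>The test function is a primitive of \<open>(v - c) * \<eta>\<close>, where \<open>\<eta>\<close> is a
  tent supported in \<open>[r, 1 - r]\<close> and \<open>c\<close> is the mean of \<open>v\<close> with
  weight \<open>\<eta>\<close>; this choice of \<open>c\<close> makes the primitive vanish at both ends.
  Orthogonality then says that the integral of \<open>(v - c)\<^sup>2 * \<eta>\<close> is zero.\<close>

lemma du_Bois_Reymond:
  fixes v :: "real \<Rightarrow> real"
  assumes v: "continuous_on {0..1} v"
    and orth: "\<And>\<phi>. test_function \<phi> \<Longrightarrow> integral {0..1} (\<lambda>x. v x * deriv \<phi> x) = 0"
    and x: "x \<in> {0..1}"
  shows "v x = v 0"
proof -
  have inner: "\<exists>c. \<forall>x\<in>{r<..<1 - r}. v x = c" if r: "0 < r" "r < 1/2" for r :: real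
  proof -
    define \<eta> where "\<eta> = (\<lambda>x. max 0 (min (x - r) (1 - r - x)))"
    \<comment> \<open>Values of \<open>v\<close> outside \<open>[0, 1]\<close> are arbitrary; with clamped arguments, the integrand is continuous on the whole line.\<close>
    define w0 where "w0 = (\<lambda>x. v (max 0 (min 1 x)))"
    have \<eta>: "continuous_on S \<eta>" for S
      unfolding \<eta>_def by (intro continuous_intros)
    have w0: "continuous_on S w0" for S
      unfolding w0_def by (rule continuous_on_compose2[OF v]) (auto intro!: continuous_intros)
    have w0_eq: "w0 x = v x" if "x \<in> {0..1}" for x using that by (simp add: w0_def)
    have "integral {0..1} \<eta> \<noteq> 0"
    proof
      assume "integral {0..1} \<eta> = 0"
      then have "\<forall>x\<in>{0..1}. \<eta> x = 0"
        by (subst (asm) integral_eq_0_iff) (auto simp: \<eta>_def intro!: continuous_intros)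
      then have "\<eta> (1/2) = 0" by auto
      then show False using r by (auto simp: \<eta>_def max_def min_def split: if_splits)
    qed
    define c where "c = integral {0..1} (\<lambda>x. w0 x * \<eta> x) / integral {0..1} \<eta>"
    define w where "w = (\<lambda>x. (w0 x - c) * \<eta> x)"
    have w: "continuous_on S w" for S unfolding w_def by (intro continuous_intros w0 \<eta>)
    have cint: "f integrable_on {0..1}" if "continuous_on {0..1} f" for f :: "real \<Rightarrow> real"
      using that by (rule integrable_continuous_real)
    have w_int0: "integral {0..1} w = 0"
    proof -
      have "integral {0..1} w = integral {0..1} (\<lambda>x. w0 x * \<eta> x - c * \<eta> x)"
        by (simp add: w_def left_diff_distrib)
      also have "\<dots> = integral {0..1} (\<lambda>x. w0 x * \<eta> x) - c * integral {0..1} \<eta>"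
        by (subst integral_diff) (auto intro!: cint continuous_intros w0 \<eta>)
      finally show ?thesis using \<open>integral {0..1} \<eta> \<noteq> 0\<close> by (simp add: c_def)
    qed
    have "\<exists>F. \<forall>x. -\<infinity> < ereal x \<longrightarrow> ereal x < \<infinity> \<longrightarrow> (F has_vector_derivative w x) (at x)"
      using w[of UNIV] by (intro einterval_antiderivative) (auto simp: continuous_on_eq_continuous_at)
    then obtain F where F: "(F has_vector_derivative w x) (at x)" for x by auto
    define \<phi> where "\<phi> = (\<lambda>x. F x - F 0)"
    have \<phi>: "(\<phi> has_real_derivative w x) (at x)" for x
      using F[of x] unfolding \<phi>_def
      by (auto simp: has_real_derivative_iff_has_vector_derivative[symmetric] intro!: derivative_eq_intros)
    have prim: "is_primitive \<phi> w" by (rule primitive_C1[OF \<phi> w])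
    have dphi: "deriv \<phi> = w" by (intro ext DERIV_imp_deriv \<phi>)
    have "\<phi> 1 = 0" using primitive_eq[OF prim, of 1] w_int0 by (simp add: \<phi>_def)
    have left: "\<phi> x = 0" if "x \<le> r" for x
    proof -
      have "\<exists>k. \<forall>x\<in>{..r}. \<phi> x = k"
      proof (rule has_field_derivative_zero_constant)
        show "convex {..r}" by (rule convex_real_interval)
        fix x assume "x \<in> {..r}"
        then have "w x = 0" by (auto simp: w_def \<eta>_def)
        with \<phi>[of x] show "(\<phi> has_field_derivative 0) (at x within {..r})"
          by (auto intro: has_field_derivative_at_within)
      qed
      then obtain k where "\<And>x. x \<le> r \<Longrightarrow> \<phi> x = k" by auto
      from this[OF that] this[of 0] r show ?thesis by (simp add: \<phi>_def)
    qed
    have right: "\<phi> x = 0" if "x \<ge> 1 - r" for x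
    proof -
      have "\<exists>k. \<forall>x\<in>{1-r..}. \<phi> x = k"
      proof (rule has_field_derivative_zero_constant)
        show "convex {1-r..}" by (rule convex_real_interval)
        fix x assume "x \<in> {1-r..}"
        then have "w x = 0" by (auto simp: w_def \<eta>_def)
        with \<phi>[of x] show "(\<phi> has_field_derivative 0) (at x within {1-r..})"
          by (auto intro: has_field_derivative_at_within)
      qed
      then obtain k where "\<And>x. 1 - r \<le> x \<Longrightarrow> \<phi> x = k" by auto
      from this[OF that] this[of 1] r show ?thesis using \<open>\<phi> 1 = 0\<close> by simp
    qed
    have "test_function \<phi>"
      unfolding test_function_def
    proof
      show "\<phi> C1_differentiable_on UNIV"
        unfolding C1_differentiable_on_def
        using \<phi> w by (auto simp: has_real_derivative_iff_has_vector_derivative)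
      have "\<phi> x = 0" if "x \<notin> {r..1-r}" for x
        using left[of x] right[of x] that by force
      then have "{x. \<phi> x \<noteq> 0} \<subseteq> {r..1-r}" by blast
      then have "closure {x. \<phi> x \<noteq> 0} \<subseteq> {r..1-r}" by (rule closure_minimal) auto
      then show "closure {x. \<phi> x \<noteq> 0} \<subseteq> {0<..<1}" using r by auto
    qed
    from orth[OF this] have "integral {0..1} (\<lambda>x. v x * w x) = 0" by (simp add: dphi)
    also have "integral {0..1} (\<lambda>x. v x * w x) = integral {0..1} (\<lambda>x. w0 x * w x)"
      by (intro integral_cong) (simp add: w0_eq)
    finally have "integral {0..1} (\<lambda>x. w0 x * w x) = 0" .
    have "integral {0..1} (\<lambda>x. (w0 x - c)\<^sup>2 * \<eta> x) = integral {0..1} (\<lambda>x. w0 x * w x - c * w x)"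
      by (simp add: w_def power2_eq_square algebra_simps)
    also have "\<dots> = integral {0..1} (\<lambda>x. w0 x * w x) - c * integral {0..1} w"
      by (subst integral_diff) (auto intro!: cint continuous_intros w0 w)
    also have "\<dots> = 0" using w_int0 \<open>integral {0..1} (\<lambda>x. w0 x * w x) = 0\<close> by simp
    finally have "\<forall>x\<in>{0..1}. (w0 x - c)\<^sup>2 * \<eta> x = 0"
      by (subst (asm) integral_eq_0_iff) (auto simp: \<eta>_def intro!: continuous_intros w0)
    then have "v x = c" if "x \<in> {r<..<1 - r}" for x
    proof -
      have "\<eta> x > 0" using that by (simp add: \<eta>_def)
      moreover have "x \<in> {0..1}" using that r by auto
      ultimately have "(w0 x - c)\<^sup>2 = 0"
        using \<open>\<forall>x\<in>{0..1}. (w0 x - c)\<^sup>2 * \<eta> x = 0\<close> by (metis less_irrefl mult_eq_0_iff)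
      then show ?thesis using w0_eq[OF \<open>x \<in> {0..1}\<close>] by simp
    qed
    then show ?thesis by blast
  qed
  have mid: "v x = v (1/2)" if x: "x \<in> {0<..<1}" for x
  proof -
    define r where "r = min x (1 - x) / 2"
    have r: "0 < r" "r < 1/2" "x \<in> {r<..<1 - r}" "1/2 \<in> {r<..<1-r}"
      using x by (auto simp: r_def min_def field_simps)
    then show ?thesis using inner[of r] by metis
  qed
  have cl: "closure {0<..<1::real} = {0..1}" by simp
  have "v x = v (1/2)" if "x \<in> {0..1}" for x
    by (rule continuous_constant_on_closure[of "{0<..<1}"]) (use v that in \<open>simp_all only: cl mid\<close>)
  from this[OF x] this[of 0] show ?thesis by simp
qed

lemma weak_deriv_imp_primitive:
  assumes u: "continuous_on {0..1} u" and ug: "has_weak_deriv u g"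
  shows "is_primitive u g"
proof -
  have g: "g absolutely_integrable_on {0..1}"
    using ug square_integrable_imp(1) by (auto simp: has_weak_deriv_def)
  define V where "V = (\<lambda>x. integral {0..x} g)"
  have V: "is_primitive V g" by (rule primitiveI[OF g]) (simp add: V_def)
  define v where "v = (\<lambda>x. u x - V x)"
  have v: "continuous_on {0..1} v"
    unfolding v_def by (intro continuous_intros u primitive_continuous[OF V])
  have const: "v x = v 0" if "x \<in> {0..1}" for x
  proof (rule du_Bois_Reymond[OF v _ that])
    fix \<phi> assume \<phi>: "test_function \<phi>"
    note T = test_functionD[OF \<phi>]
    have 1: "(\<lambda>x. u x * deriv \<phi> x) absolutely_integrable_on {0..1}"
      by (intro abs_int_mult_continuous u primitive_abs_int[OF T(1)])
    have 3: "(\<lambda>x. V x * deriv \<phi> x) absolutely_integrable_on {0..1}"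
      by (intro abs_int_mult_continuous primitive_continuous[OF V] primitive_abs_int[OF T(1)])
    have "(\<lambda>x. \<phi> x * g x) absolutely_integrable_on {0..1}"
      by (intro abs_int_mult_continuous T(3) g)
    then have 2: "(\<lambda>x. g x * \<phi> x) absolutely_integrable_on {0..1}" by (simp add: mult.commute)
    have "integral {0..1} (\<lambda>x. u x * deriv \<phi> x) = - integral {0..1} (\<lambda>x. g x * \<phi> x)"
      using ug \<phi> integral_unit[OF 1] integral_unit[OF 2] by (simp add: has_weak_deriv_def)
    moreover have "integral {0..1} (\<lambda>x. V x * deriv \<phi> x) = - integral {0..1} (\<lambda>x. g x * \<phi> x)"
      using integration_by_parts_primitive[OF V T(1)] T(4,5) by simp
    ultimately show "integral {0..1} (\<lambda>x. v x * deriv \<phi> x) = 0"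
      unfolding v_def left_diff_distrib
      using integral_diff[OF abs_intD(1)[OF 1] abs_intD(1)[OF 3]] by simp
  qed
  show ?thesis
  proof (rule primitiveI[OF g])
    fix x :: real assume "0 \<le> x" "x \<le> 1"
    then show "u x - u 0 = integral {0..x} g" using const[of x] by (simp add: v_def V_def)
  qed
qed

lemma primitive_unique_AE:
  assumes "is_primitive u f" "is_primitive u g"
  shows "AE x in unit_meas. f x = g x"
proof -
  have fg: "f absolutely_integrable_on {0..1}" "g absolutely_integrable_on {0..1}"
    using assms by (auto intro: primitive_abs_int)
  have "AE x in unit_meas. f x - g x = 0"
  proof (rule AE_zero_if_interval_integrals_zero)
    show "(\<lambda>x. f x - g x) absolutely_integrable_on {0..1}"
      using fg by (rule set_integral_diff)
    fix a b :: real assume ab: "0 \<le> a" "a \<le> b" "b \<le> 1"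
    show "integral {a..b} (\<lambda>x. f x - g x) = 0"
      using primitive_diff[OF assms(1) ab] primitive_diff[OF assms(2) ab]
        integral_diff[OF abs_int_sub(2)[OF fg(1)] abs_int_sub(2)[OF fg(2)], of a b] ab by simp
  qed
  then show ?thesis by simp
qed

lemma wderiv_primitive:
  assumes "is_primitive u g" "square_integrable g"
  shows "is_primitive u (wderiv u)" "square_integrable (wderiv u)" "AE x in unit_meas. wderiv u x = g x"
proof -
  have w: "has_weak_deriv u (wderiv u)"
    unfolding wderiv_def by (rule someI[of _ g]) (rule primitive_imp_weak_deriv[OF assms])
  then show 1: "is_primitive u (wderiv u)"
    by (rule weak_deriv_imp_primitive[OF primitive_continuous[OF assms(1)]])
  show "square_integrable (wderiv u)" using w by (simp add: has_weak_deriv_def)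
  show "AE x in unit_meas. wderiv u x = g x" by (rule primitive_unique_AE[OF 1 assms(1)])
qed

lemma has_weak_deriv_cong_AE:
  assumes "u \<in> borel_measurable unit_meas" "v \<in> borel_measurable unit_meas"
    and "AE x in unit_meas. u x = v x"
  shows "has_weak_deriv u g \<longleftrightarrow> has_weak_deriv v g"
proof -
  have "(LINT x|unit_meas. u x * deriv \<phi> x) = (LINT x|unit_meas. v x * deriv \<phi> x)"
    if "test_function \<phi>" for \<phi>
  proof (rule integral_cong_AE)
    have "deriv \<phi> \<in> borel_measurable unit_meas"
      unfolding unit_meas_def
      by (rule continuous_imp_measurable_on_sets_lebesgue[OF test_functionD(2)[OF that]]) auto
    then show "(\<lambda>x. u x * deriv \<phi> x) \<in> borel_measurable unit_meas"
      "(\<lambda>x. v x * deriv \<phi> x) \<in> borel_measurable unit_meas"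
      using assms by auto
  qed (use assms in auto)
  then show ?thesis by (auto simp: has_weak_deriv_def)
qed

lemma continuous_square_integrable:
  assumes "continuous_on {0..1} p"
  shows "square_integrable p"
  by (rule square_integrableI)
     (use assms in \<open>auto intro!: absolutely_integrable_continuous_real integrable_continuous_real continuous_intros\<close>)

text \<open>The chosen derivative of \<open>u\<close> agrees with \<open>p\<close> only almost everywhere. Since the
  definition of a weak derivative does not distinguish the two, they have the same weak derivatives, and
  the choice operator picks the same one for both.\<close>

lemma wderiv_wderiv:
  assumes u: "is_primitive u p" and p: "is_primitive p q" and q: "square_integrable q"
  shows "AE x in unit_meas. wderiv (wderiv u) x = q x"
proof -
  have ps: "square_integrable p"
    by (rule continuous_square_integrable[OF primitive_continuous[OF p]])
  note W = wderiv_primitive[OF u ps]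
  have "has_weak_deriv (wderiv u) = has_weak_deriv p"
    by (intro ext has_weak_deriv_cong_AE W)
       (use W ps in \<open>auto simp: square_integrable_def\<close>)
  then have "wderiv (wderiv u) = wderiv p" by (simp add: wderiv_def)
  then show ?thesis using wderiv_primitive(3)[OF p q] by simp
qed

lemma H1_perI:
  assumes "is_primitive u g" "square_integrable g" "u 0 = u 1"
  shows "u \<in> H1_per"
  using assms primitive_continuous[OF assms(1)] primitive_imp_weak_deriv[OF assms(1,2)]
  by (auto simp: H1_per_def H1_def intro: continuous_square_integrable)

lemma H1_perD:
  assumes "u \<in> H1_per"
  shows "is_primitive u (wderiv u)" "square_integrable (wderiv u)" "u 0 = u 1" "continuous_on {0..1} u"
proof -
  obtain g where "continuous_on {0..1} u" "has_weak_deriv u g" and u: "u 0 = u 1"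
    using assms by (auto simp: H1_per_def H1_def)
  then have "is_primitive u g" "square_integrable g"
    by (auto intro: weak_deriv_imp_primitive simp: has_weak_deriv_def)
  from wderiv_primitive[OF this] u primitive_continuous[OF this(1)]
  show "is_primitive u (wderiv u)" "square_integrable (wderiv u)" "u 0 = u 1" "continuous_on {0..1} u"
    by auto
qed

lemma H2_perI:
  assumes "is_primitive u p" "is_primitive p q" "square_integrable q" "u 0 = u 1" "p 0 = p 1"
  shows "u \<in> H2_per"
proof -
  have "square_integrable p"
    by (rule continuous_square_integrable[OF primitive_continuous[OF assms(2)]])
  then show ?thesis
    using assms H1_perI primitive_imp_weak_deriv unfolding H2_per_def by blast
qed

lemma H2_perD:
  assumes "u \<in> H2_per"
  obtains p q where "is_primitive u p" "is_primitive p q" "square_integrable q" "u 0 = u 1" "p 0 = p 1"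
proof -
  obtain p where u: "u \<in> H1_per" and p: "p \<in> H1_per" "has_weak_deriv u p"
    using assms by (auto simp: H2_per_def)
  have "is_primitive u p"
    by (rule weak_deriv_imp_primitive[OF H1_perD(4)[OF u] p(2)])
  then show ?thesis using H1_perD[OF u] H1_perD[OF p(1)] that by blast
qed

section \<open>Primitives of square-integrable functions\<close>

text \<open>The integral of \<open>(f - m)\<^sup>2\<close> is nonnegative, where \<open>m\<close> is the mean of
  \<open>f\<close>.\<close>

lemma cauchy_schwarz_integral:
  fixes f :: "real \<Rightarrow> real"
  assumes "a \<le> b" and f: "f integrable_on {a..b}" and f2: "(\<lambda>x. (f x)\<^sup>2) integrable_on {a..b}"
  shows "(integral {a..b} f)\<^sup>2 \<le> (b - a) * integral {a..b} (\<lambda>x. (f x)\<^sup>2)"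
proof (cases "a = b")
  case False
  then have "b - a > 0" using assms(1) by simp
  define m where "m = integral {a..b} f / (b - a)"
  have eq: "(f x - m)\<^sup>2 = (f x)\<^sup>2 - 2 * m * f x + m\<^sup>2" for x
    by (simp add: power2_diff)
  have i1: "(\<lambda>x. 2 * m * f x) integrable_on {a..b}" using f by (rule integrable_cmult_real)
  have i2: "(\<lambda>x. (f x)\<^sup>2 - 2 * m * f x) integrable_on {a..b}" by (rule integrable_diff[OF f2 i1])
  have i3: "(\<lambda>x. m\<^sup>2) integrable_on {a..b}" by auto
  have "(\<lambda>x. (f x - m)\<^sup>2) integrable_on {a..b}"
    using integrable_add[OF i2 i3] by (simp add: eq)
  then have "0 \<le> integral {a..b} (\<lambda>x. (f x - m)\<^sup>2)"
    by (rule integral_nonneg) auto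
  also have "\<dots> = integral {a..b} (\<lambda>x. (f x)\<^sup>2) - 2 * m * integral {a..b} f + m\<^sup>2 * (b - a)"
    unfolding eq integral_add[OF i2 i3] integral_diff[OF f2 i1] using assms(1) by simp
  also have "\<dots> = integral {a..b} (\<lambda>x. (f x)\<^sup>2) - (integral {a..b} f)\<^sup>2 / (b - a)"
  proof -
    have "m * (b - a) = integral {a..b} f" using \<open>b - a > 0\<close> by (simp add: m_def)
    then have "m\<^sup>2 * (b - a) = m * integral {a..b} f" by (simp add: power2_eq_square)
    moreover have "(integral {a..b} f)\<^sup>2 / (b - a) = m * integral {a..b} f"
      by (simp add: m_def power2_eq_square)
    ultimately show ?thesis by simp
  qed
  finally show ?thesis using \<open>b - a > 0\<close> by (simp add: field_simps)
qed auto

lemma primitive_holder: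
  assumes p: "is_primitive p q" and q: "square_integrable q" and ab: "0 \<le> a" "a \<le> b" "b \<le> 1"
  shows "(p b - p a)\<^sup>2 \<le> (b - a) * integral {a..b} (\<lambda>x. (q x)\<^sup>2)"
    and "integral {a..b} (\<lambda>x. (q x)\<^sup>2) \<le> integral {0..1} (\<lambda>x. (q x)\<^sup>2)"
proof -
  have i: "q integrable_on {a..b}" "(\<lambda>x. (q x)\<^sup>2) integrable_on {a..b}"
    using square_integrable_imp[OF q] ab by (auto intro: abs_int_sub(2))
  show "(p b - p a)\<^sup>2 \<le> (b - a) * integral {a..b} (\<lambda>x. (q x)\<^sup>2)"
    using cauchy_schwarz_integral[OF ab(2) i] primitive_diff[OF p ab] by simp
  show "integral {a..b} (\<lambda>x. (q x)\<^sup>2) \<le> integral {0..1} (\<lambda>x. (q x)\<^sup>2)"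
    using i(2) abs_intD(1)[OF square_integrable_imp(2)[OF q]] ab
    by (intro integral_subset_le) auto
qed

text \<open>The functions \<open>arctan (k * p) / k\<close> have increments of at most \<open>\<pi> / k\<close>,
  whereas their derivatives \<open>q / (1 + (k * p)\<^sup>2)\<close> converge to \<open>q\<close> where
  \<open>p = 0\<close> and to zero elsewhere. Hence \<open>q\<close>, restricted to the zero set of
  \<open>p\<close>, has integral zero over every interval.\<close>

lemma AE_zero_deriv_on_zero_set:
  assumes p: "is_primitive p q"
  shows "AE x in unit_meas. p x = 0 \<longrightarrow> q x = 0"
proof -
  have q: "q absolutely_integrable_on {0..1}" using p by (rule primitive_abs_int)
  define g where "g = (\<lambda>x. if p x = 0 then q x else 0)"
  define F where "F = (\<lambda>(k::nat) t. arctan (real (Suc k) * t) / real (Suc k))"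
  define F' where "F' = (\<lambda>(k::nat) t. 1 / (1 + (real (Suc k) * t)\<^sup>2))"
  have prim: "is_primitive (\<lambda>x. F k (p x)) (\<lambda>x. F' k (p x) * q x)" for k
  proof (rule chain_rule_primitive[OF p])
    show "(F k has_real_derivative F' k t) (at t)" for t
    proof -
      have "(F k has_real_derivative
          (inverse (1 + (real (Suc k) * t)\<^sup>2) * real (Suc k)) / real (Suc k)) (at t)"
        unfolding F_def by (auto intro!: derivative_eq_intros simp del: of_nat_Suc)
      then show ?thesis by (simp add: F'_def inverse_eq_divide del: of_nat_Suc)
    qed
    have "1 + (real (Suc k) * t)\<^sup>2 \<noteq> 0" for t
      by (metis add_pos_nonneg less_irrefl zero_le_power2 zero_less_one)
    then show "continuous_on UNIV (F' k)"
      unfolding F'_def by (intro continuous_intros) auto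
  qed
  have F'_bound: "\<bar>F' k t * s\<bar> \<le> \<bar>s\<bar>" for k t s
  proof -
    have "\<bar>F' k t\<bar> \<le> 1" by (simp add: F'_def divide_le_eq_1 add_pos_nonneg)
    then show ?thesis by (simp add: abs_mult mult_left_le_one_le)
  qed
  have F'_lim: "(\<lambda>k. F' k t) \<longlonglongrightarrow> (if t = 0 then 1 else 0)" for t
  proof (cases "t = 0")
    case False
    have "(\<lambda>k. 1 / (1 + (real (Suc k) * t)\<^sup>2)) \<longlonglongrightarrow> 0"
    proof (rule tendsto_sandwich[OF _ _ tendsto_const])
      show "\<forall>\<^sub>F k in sequentially. 0 \<le> 1 / (1 + (real (Suc k) * t)\<^sup>2)" by simp
      show "\<forall>\<^sub>F k in sequentially. 1 / (1 + (real (Suc k) * t)\<^sup>2) \<le> inverse (real (Suc k)) * (1 / t\<^sup>2)"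
      proof (intro always_eventually allI)
        fix k
        have "real (Suc k) * t\<^sup>2 \<le> (real (Suc k))\<^sup>2 * t\<^sup>2"
          by (intro mult_right_mono) (auto simp: power2_eq_square)
        also have "\<dots> \<le> 1 + (real (Suc k) * t)\<^sup>2" by (simp add: power_mult_distrib)
        finally have "real (Suc k) * t\<^sup>2 \<le> 1 + (real (Suc k) * t)\<^sup>2" .
        moreover have "0 < real (Suc k) * t\<^sup>2" using False by simp
        ultimately have "1 / (1 + (real (Suc k) * t)\<^sup>2) \<le> 1 / (real (Suc k) * t\<^sup>2)"
          by (intro divide_left_mono) (auto intro!: mult_pos_pos)
        then show "1 / (1 + (real (Suc k) * t)\<^sup>2) \<le> inverse (real (Suc k)) * (1 / t\<^sup>2)"
          by (simp add: field_simps)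
      qed
      have "(\<lambda>k. inverse (real (Suc k)) * (1 / t\<^sup>2)) \<longlonglongrightarrow> 0 * (1 / t\<^sup>2)"
        by (intro tendsto_mult LIMSEQ_inverse_real_of_nat tendsto_const)
      then show "(\<lambda>k. inverse (real (Suc k)) * (1 / t\<^sup>2)) \<longlonglongrightarrow> 0" by simp
    qed
    then show ?thesis using False by (simp add: F'_def)
  qed (simp add: F'_def)
  have conv: "g integrable_on {a..b}" "(\<lambda>k. integral {a..b} (\<lambda>x. F' k (p x) * q x)) \<longlonglongrightarrow> integral {a..b} g"
    if ab: "0 \<le> a" "b \<le> 1" for a b
  proof -
    have 1: "(\<lambda>x. F' k (p x) * q x) integrable_on {a..b}" for k
      using ab by (intro abs_int_sub(2)[OF primitive_abs_int[OF prim]])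
    have 2: "(\<lambda>x. \<bar>q x\<bar>) integrable_on {a..b}"
      using ab by (intro abs_intD(2) abs_int_sub(1)[OF q])
    have 3: "(\<lambda>k. F' k (p x) * q x) \<longlonglongrightarrow> g x" for x
      using tendsto_mult[OF F'_lim[of "p x"] tendsto_const[of "q x"]]
      by (simp add: g_def if_distrib[of "\<lambda>t. t * q x"] cong: if_cong)
    show "g integrable_on {a..b}" "(\<lambda>k. integral {a..b} (\<lambda>x. F' k (p x) * q x)) \<longlonglongrightarrow> integral {a..b} g"
      using dominated_convergence[OF 1 2 _ 3] F'_bound by auto
  qed
  have "AE x in unit_meas. g x = 0"
  proof (rule AE_zero_if_interval_integrals_zero)
    show "g absolutely_integrable_on {0..1}"
      by (rule absolutely_integrable_integrable_bound[where g = "\<lambda>x. \<bar>q x\<bar>"])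
         (use conv(1)[of 0 1] abs_intD(2)[OF q] in \<open>auto simp: g_def\<close>)
    fix a b :: real assume ab: "0 \<le> a" "a \<le> b" "b \<le> 1"
    have "(\<lambda>k. integral {a..b} (\<lambda>x. F' k (p x) * q x)) \<longlonglongrightarrow> 0"
    proof (rule Lim_null_comparison)
      show "\<forall>\<^sub>F k in sequentially. norm (integral {a..b} (\<lambda>x. F' k (p x) * q x)) \<le> pi * inverse (real (Suc k))"
      proof (intro always_eventually allI)
        fix k
        have "integral {a..b} (\<lambda>x. F' k (p x) * q x) = F k (p b) - F k (p a)"
          using primitive_diff[OF prim ab] by simp
        also have "\<dots> = (arctan (real (Suc k) * p b) - arctan (real (Suc k) * p a)) / real (Suc k)"
          by (simp add: F_def diff_divide_distrib)
        finally have "norm (integral {a..b} (\<lambda>x. F' k (p x) * q x)) =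
            \<bar>arctan (real (Suc k) * p b) - arctan (real (Suc k) * p a)\<bar> / real (Suc k)"
          by (simp del: of_nat_Suc)
        also have "\<dots> \<le> pi / real (Suc k)"
          using arctan_bounded[of "real (Suc k) * p b"] arctan_bounded[of "real (Suc k) * p a"]
          by (intro divide_right_mono) (auto simp del: of_nat_Suc)
        finally show "norm (integral {a..b} (\<lambda>x. F' k (p x) * q x)) \<le> pi * inverse (real (Suc k))"
          by (simp add: field_simps)
      qed
      show "(\<lambda>k. pi * inverse (real (Suc k))) \<longlonglongrightarrow> 0"
        using tendsto_mult[OF tendsto_const[of pi] LIMSEQ_inverse_real_of_nat] by simp
    qed
    then show "integral {a..b} g = 0"
      using conv(2)[of a b] ab LIMSEQ_unique by auto
  qed
  then show ?thesis by (rule eventually_mono) (auto simp: g_def split: if_splits)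
qed

section \<open>Step functions and piecewise affine interpolation\<close>

text \<open>The cells \<open>[(j - 1) / N, j / N)\<close> are numbered from 1, like the segments of the discrete
  energy.\<close>

definition step :: "nat \<Rightarrow> (nat \<Rightarrow> real) \<Rightarrow> real \<Rightarrow> real" where
  "step N c x = c (nat \<lfloor>x * real N\<rfloor> + 1)"

definition cell :: "nat \<Rightarrow> nat \<Rightarrow> real set" where
  "cell N j = {(real j - 1) / real N .. real j / real N}"

lemma step_eq:
  assumes "N \<ge> 1" "1 \<le> j" "(real j - 1) / real N \<le> x" "x < real j / real N"
  shows "step N c x = c j"
proof -
  have "\<lfloor>x * real N\<rfloor> = int (j - 1)"
    using assms by (intro floor_unique) (auto simp: field_simps of_nat_diff)
  then have "nat \<lfloor>x * real N\<rfloor> + 1 = j" using assms by simp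
  then show ?thesis by (simp only: step_def)
qed

lemma step_cases:
  assumes "N \<ge> 1" "0 \<le> x" "x < 1"
  obtains j where "1 \<le> j" "j \<le> N" "(real j - 1) / real N \<le> x" "x < real j / real N"
    "x \<in> cell N j" "\<And>c. step N c x = c j"
proof -
  define j where "j = nat \<lfloor>x * real N\<rfloor> + 1"
  have "0 \<le> x * real N" using assms by simp
  moreover have xN: "x * real N < real N" using assms by simp
  ultimately have "\<lfloor>x * real N\<rfloor> \<ge> 0" "\<lfloor>x * real N\<rfloor> < int N" by (auto simp: floor_less_iff)
  then have jr: "real j - 1 = of_int \<lfloor>x * real N\<rfloor>" "j \<le> N"
    unfolding j_def by (simp, linarith)
  have 1: "real j - 1 \<le> x * real N" "x * real N < real j" using jr(1) by linarith+
  then have "(real j - 1) / real N \<le> x" "x < real j / real N"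
    using assms by (auto simp: field_simps)
  then show ?thesis
    using that[of j] jr by (auto simp: j_def step_def cell_def)
qed

lemma has_integral_cells:
  fixes f :: "real \<Rightarrow> real"
  assumes "N \<ge> 1" "\<And>j. \<lbrakk>1 \<le> j; j \<le> k\<rbrakk> \<Longrightarrow> (f has_integral s j) (cell N j)"
  shows "(f has_integral (\<Sum>j=1..k. s j)) {0..real k / real N}"
  using assms(2)
proof (induction k)
  case 0
  then show ?case using has_integral_refl(2)[of f 0] by simp
next
  case (Suc k)
  have "(f has_integral s (Suc k)) {real k / real N..real (Suc k) / real N}"
    using Suc.prems[of "Suc k"] by (simp add: cell_def)
  from has_integral_combine[OF _ _ Suc.IH this] Suc.prems assms(1)
  show ?case by (auto simp: divide_right_mono)
qed

lemma integral_cells: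
  fixes f :: "real \<Rightarrow> real"
  assumes "N \<ge> 1" "f integrable_on {0..1}"
  shows "integral {0..1} f = (\<Sum>j=1..N. integral (cell N j) f)"
proof -
  have "(f has_integral (\<Sum>j=1..N. integral (cell N j) f)) {0..real N / real N}"
  proof (rule has_integral_cells[OF assms(1)])
    fix j assume j: "1 \<le> j" "j \<le> N"
    then have "cell N j \<subseteq> {0..1}" using assms(1) by (auto simp: cell_def field_simps)
    then have "f integrable_on cell N j"
      using integrable_subinterval_real[OF assms(2)] by (auto simp: cell_def)
    then show "(f has_integral integral (cell N j) f) (cell N j)" by (rule integrable_integral)
  qed
  then show ?thesis using assms(1) by (simp add: integral_unique)
qed

lemma cell_subset: "N \<ge> 1 \<Longrightarrow> 1 \<le> j \<Longrightarrow> j \<le> N \<Longrightarrow> cell N j \<subseteq> {0..1}"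
  by (auto simp: cell_def field_simps)

lemma step_mult_has_integral_cell:
  fixes f :: "real \<Rightarrow> real"
  assumes "N \<ge> 1" "1 \<le> j" "(f has_integral y) (cell N j)"
  shows "((\<lambda>x. step N c x * f x) has_integral c j * y) (cell N j)"
proof (rule has_integral_spike_finite[where S = "{real j / real N}" and f = "\<lambda>x. c j * f x"])
  show "((\<lambda>x. c j * f x) has_integral c j * y) (cell N j)"
    using assms(3) by (rule has_integral_mult_right)
  fix x assume "x \<in> cell N j - {real j / real N}"
  then show "step N c x * f x = c j * f x"
    using step_eq[OF assms(1,2), of x c] by (auto simp: cell_def)
qed auto

lemma step_has_integral_cell:
  assumes "N \<ge> 1" "1 \<le> j"
  shows "(step N c has_integral c j / real N) (cell N j)"
proof -
  have "((\<lambda>x. 1::real) has_integral 1 / real N) (cell N j)"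
    using has_integral_const_real[of "1::real" "(real j - 1) / real N" "real j / real N"] assms
    by (simp add: cell_def divide_right_mono diff_divide_distrib)
  from step_mult_has_integral_cell[OF assms this, of c] show ?thesis by simp
qed

lemma step_has_integral:
  assumes "N \<ge> 1"
  shows "(step N c has_integral (\<Sum>j=1..k. c j) / real N) {0..real k / real N}"
proof -
  have "(step N c has_integral (\<Sum>j=1..k. c j / real N)) {0..real k / real N}"
    using assms by (intro has_integral_cells step_has_integral_cell) auto
  then show ?thesis by (simp add: sum_divide_distrib)
qed

lemma step_integral:
  assumes "N \<ge> 1"
  shows "integral {0..1} (step N c) = (\<Sum>j=1..N. c j) / real N"
  using step_has_integral[OF assms, of c N] assms by (simp add: integral_unique)

lemma step_abs_int:
  assumes "N \<ge> 1"
  shows "step N c absolutely_integrable_on {0..1}"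
proof -
  have "step N c integrable_on {0..1}" for c
    using step_has_integral[OF assms, of c N] assms by auto
  from this[of c] this[of "\<lambda>j. \<bar>c j\<bar>"] show ?thesis
    by (auto simp: absolutely_integrable_on_def step_def[abs_def])
qed

lemma step_square_integrable:
  assumes "N \<ge> 1"
  shows "square_integrable (step N c)"
proof (rule square_integrableI)
  show "step N c absolutely_integrable_on {0..1}" using assms by (rule step_abs_int)
  show "(\<lambda>x. (step N c x)\<^sup>2) integrable_on {0..1}"
    using abs_intD(1)[OF step_abs_int[OF assms, of "\<lambda>j. (c j)\<^sup>2"]] by (simp add: step_def[abs_def])
qed

text \<open>The affine interpolant of the values \<open>c j\<close> at \<open>j / N\<close>, written as an
  indefinite integral so that its derivative is known.\<close>

definition interp :: "nat \<Rightarrow> (nat \<Rightarrow> real) \<Rightarrow> real \<Rightarrow> real" where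
  "interp N c x = c 0 + integral {0..x} (step N (\<lambda>j. (c j - c (j - 1)) * real N))"

lemma interp_primitive:
  assumes "N \<ge> 1"
  shows "is_primitive (interp N c) (step N (\<lambda>j. (c j - c (j - 1)) * real N))"
  by (rule primitiveI) (auto simp: interp_def step_abs_int[OF assms])

lemma interp_node:
  assumes "N \<ge> 1"
  shows "interp N c (real k / real N) = c k"
proof -
  have "integral {0..real k / real N} (step N (\<lambda>j. (c j - c (j - 1)) * real N)) =
      (\<Sum>j=1..k. (c j - c (j - 1)) * real N) / real N"
    using step_has_integral[OF assms] by (rule integral_unique)
  also have "\<dots> = (\<Sum>j=1..k. c j - c (j - 1))"
    using assms by (simp add: sum_distrib_right[symmetric])
  also have "\<dots> = c k - c 0" by (induction k) auto
  finally show ?thesis by (simp add: interp_def)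
qed

lemma interp_cell:
  assumes "N \<ge> 1" "1 \<le> j" "j \<le> N" "x \<in> cell N j"
  shows "interp N c x = c (j - 1) + (c j - c (j - 1)) * (real N * x - (real j - 1))"
proof -
  let ?a = "(real j - 1) / real N" and ?s = "step N (\<lambda>j. (c j - c (j - 1)) * real N)"
  have x: "?a \<le> x" "x \<le> real j / real N" using assms(4) by (auto simp: cell_def)
  have a: "0 \<le> ?a" "?a = real (j - 1) / real N" using assms by (auto simp: of_nat_diff)
  have "x \<le> 1" using assms(4) cell_subset[OF assms(1-3)] by auto
  have "interp N c x - interp N c ?a = integral {?a..x} ?s"
    by (rule primitive_diff[OF interp_primitive[OF assms(1)] a(1) x(1) \<open>x \<le> 1\<close>])
  also have "\<dots> = integral {?a..x} (\<lambda>y. (c j - c (j - 1)) * real N)"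
  proof (rule integral_spike[of "{x}"])
    fix y assume "y \<in> {?a..x} - {x}"
    then show "(c j - c (j - 1)) * real N = ?s y"
      using step_eq[OF assms(1,2), of y] x by auto
  qed auto
  also have "\<dots> = (c j - c (j - 1)) * real N * (x - ?a)" using x by simp
  also have "\<dots> = (c j - c (j - 1)) * (real N * x - (real j - 1))"
    using assms(1) by (simp add: field_simps)
  finally show ?thesis using interp_node[OF assms(1), of c "j - 1"] a by simp
qed

lemma cell_param:
  assumes "N \<ge> 1" "x \<in> cell N j"
  shows "0 \<le> real N * x - (real j - 1)" "real N * x - (real j - 1) \<le> 1"
  using assms by (auto simp: cell_def field_simps)

lemma interp_close:
  assumes "N \<ge> 1" "1 \<le> j" "j \<le> N" "x \<in> cell N j"
  shows "\<bar>interp N c x - c (j - 1)\<bar> \<le> \<bar>c j - c (j - 1)\<bar>"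
  unfolding interp_cell[OF assms] using cell_param[OF assms(1,4)]
  by (simp add: abs_mult mult_left_le)

lemma interp_bounded:
  assumes "N \<ge> 1" "x \<in> {0..1}" "\<And>j. j \<le> N \<Longrightarrow> \<bar>c j\<bar> \<le> m"
  shows "\<bar>interp N c x\<bar> \<le> m"
proof (cases "x < 1")
  case True
  then obtain j where j: "1 \<le> j" "j \<le> N" "x \<in> cell N j"
    using step_cases[OF assms(1), of x] assms(2) by auto
  define t where "t = real N * x - (real j - 1)"
  have t: "0 \<le> t" "t \<le> 1" unfolding t_def using cell_param[OF assms(1) j(3)] by auto
  have "interp N c x = (1 - t) * c (j - 1) + t * c j"
    unfolding interp_cell[OF assms(1) j] t_def[symmetric] by (simp add: algebra_simps)
  also have "\<bar>\<dots>\<bar> \<le> (1 - t) * \<bar>c (j - 1)\<bar> + t * \<bar>c j\<bar>"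
    using t abs_triangle_ineq[of "(1 - t) * c (j - 1)" "t * c j"] by (simp add: abs_mult)
  also have "\<dots> \<le> (1 - t) * m + t * m"
    using t j by (intro add_mono mult_left_mono assms(3)) auto
  finally show ?thesis by (simp add: algebra_simps)
next
  case False
  then have "x = real N / real N" using assms by auto
  then show ?thesis using interp_node[OF assms(1), of c N] assms(3)[of N] by simp
qed

section \<open>Lower semicontinuity of the Dirichlet energy\<close>

lemma abs_int_unit: "integrable unit_meas f \<Longrightarrow> (LINT x|unit_meas. f x) = integral {0..1} (f :: real \<Rightarrow> real)"
  by (simp add: integrable_unit_iff integral_unit)

text \<open>The differences of successive functions have \<open>L\<^sup>1\<close> norm at most
  \<open>2\<^sup>-\<^sup>i\<close>, so they are absolutely summable almost everywhere, and the sum of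
  their absolute values serves as the dominating function.\<close>

lemma L2_cauchy_AE_limit:
  fixes g :: "nat \<Rightarrow> real \<Rightarrow> real"
  assumes g: "\<And>i. square_integrable (g i)"
    and cauchy: "\<And>i. integral {0..1} (\<lambda>x. (g (Suc i) x - g i x)\<^sup>2) \<le> (1/4) ^ i"
  obtains h w where "h \<in> borel_measurable unit_meas" "AE x in unit_meas. (\<lambda>i. g i x) \<longlonglongrightarrow> h x"
    "integrable unit_meas w" "\<And>i. AE x in unit_meas. \<bar>g i x\<bar> \<le> w x"
proof -
  define D where "D = (\<lambda>i x. g (Suc i) x - g i x)"
  note G = square_integrable_imp[OF g]
  have D1: "D i absolutely_integrable_on {0..1}" for i
    unfolding D_def by (intro set_integral_diff(1) G(1))
  have "(\<lambda>x. (D i x)\<^sup>2) absolutely_integrable_on {0..1}" for i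
  proof (rule measurable_bounded_by_integrable_imp_absolutely_integrable)
    show "(\<lambda>x. (D i x)\<^sup>2) \<in> borel_measurable (lebesgue_on {0..1})"
      using absolutely_integrable_measurable[of "{0..1}" "D i"] D1[of i] by auto
    show "(\<lambda>x. 2 * (g (Suc i) x)\<^sup>2 + 2 * (g i x)\<^sup>2) integrable_on {0..1}"
      by (intro integrable_add integrable_cmult_real abs_intD(1) G(2))
    show "norm ((D i x)\<^sup>2) \<le> 2 * (g (Suc i) x)\<^sup>2 + 2 * (g i x)\<^sup>2" for x
    proof -
      have "0 \<le> (g (Suc i) x + g i x)\<^sup>2" by simp
      then have "(D i x)\<^sup>2 \<le> 2 * (g (Suc i) x)\<^sup>2 + 2 * (g i x)\<^sup>2"
        by (simp add: D_def power2_sum power2_diff)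
      then show ?thesis by simp
    qed
  qed auto
  then have D2: "(\<lambda>x. (D i x)\<^sup>2) integrable_on {0..1}" for i by (rule abs_intD(1))
  have Dint: "integrable unit_meas (D i)" for i using D1 by (simp add: integrable_unit_iff)
  have Dbound: "(LINT x|unit_meas. norm (D i x)) \<le> (1/2) ^ i" for i
  proof -
    have "(integral {0..1} (\<lambda>x. \<bar>D i x\<bar>))\<^sup>2 \<le> (1 - 0) * integral {0..1} (\<lambda>x. \<bar>D i x\<bar>\<^sup>2)"
      by (rule cauchy_schwarz_integral) (use abs_intD(2)[OF D1] D2 in auto)
    also have "\<dots> \<le> ((1/2) ^ i)\<^sup>2"
      using cauchy[of i] by (simp add: D_def power2_eq_square power_mult_distrib[symmetric])
    finally have "integral {0..1} (\<lambda>x. \<bar>D i x\<bar>) \<le> (1/2) ^ i"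
      by (rule power2_le_imp_le) simp
    then show ?thesis using abs_int_unit[of "\<lambda>x. \<bar>D i x\<bar>"] Dint by simp
  qed
  have Dsum: "summable (\<lambda>i. LINT x|unit_meas. norm (D i x))"
    by (rule summable_comparison_test'[OF summable_geometric[of "1/2::real"], of 0]) (use Dbound in auto)
  have AEsum: "AE x in unit_meas. summable (\<lambda>i. norm (D i x))"
  proof -
    have [measurable]: "D i \<in> borel_measurable unit_meas" for i using Dint by auto
    have "(\<integral>\<^sup>+x. (\<Sum>i. ennreal (norm (D i x))) \<partial>unit_meas) = (\<Sum>i. \<integral>\<^sup>+x. ennreal (norm (D i x)) \<partial>unit_meas)"
      by (rule nn_integral_suminf) auto
    also have "\<dots> = (\<Sum>i. ennreal (LINT x|unit_meas. norm (D i x)))"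
      using Dint by (subst nn_integral_eq_integral) auto
    also have "\<dots> = ennreal (\<Sum>i. LINT x|unit_meas. norm (D i x))"
      using Dsum by (intro suminf_ennreal2) auto
    finally have "AE x in unit_meas. (\<Sum>i. ennreal (norm (D i x))) \<noteq> \<infinity>"
      by (intro nn_integral_PInf_AE) auto
    then show ?thesis
      by (rule eventually_mono) (auto intro!: summable_suminf_not_top)
  qed
  define w where "w = (\<lambda>x. \<bar>g 0 x\<bar> + (\<Sum>i. norm (D i x)))"
  have tele: "g n x = g 0 x + (\<Sum>i<n. D i x)" for n x
    unfolding D_def using sum_lessThan_telescope[of "\<lambda>i. g i x" n] by simp
  have g0: "integrable unit_meas (g i)" for i using G(1) by (simp add: integrable_unit_iff)
  show ?thesis
  proof (rule that[of "\<lambda>x. lim (\<lambda>i. g i x)" w])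
    show "(\<lambda>x. lim (\<lambda>i. g i x)) \<in> borel_measurable unit_meas"
      using g0 by (intro borel_measurable_lim_metric) auto
    show "AE x in unit_meas. (\<lambda>i. g i x) \<longlonglongrightarrow> lim (\<lambda>i. g i x)"
      using AEsum
    proof eventually_elim
      case (elim x)
      then have "summable (\<lambda>i. D i x)" by (rule summable_norm_cancel)
      then have "convergent (\<lambda>n. g 0 x + (\<Sum>i<n. D i x))"
        by (intro convergent_add convergent_const) (simp add: summable_iff_convergent)
      then show ?case unfolding tele[symmetric] by (simp add: convergent_LIMSEQ_iff)
    qed
    have "integrable unit_meas (\<lambda>x. \<Sum>i. norm (D i x))"
      using Dint AEsum Dsum by (intro integrable_suminf) auto
    then show "integrable unit_meas w"
      unfolding w_def using g0[of 0] by auto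
    show "AE x in unit_meas. \<bar>g n x\<bar> \<le> w x" for n
      using AEsum
    proof eventually_elim
      case (elim x)
      have "\<bar>g n x\<bar> \<le> \<bar>g 0 x\<bar> + (\<Sum>i<n. norm (D i x))"
        using sum_abs[of "\<lambda>i. D i x" "{..<n}"] abs_triangle_ineq[of "g 0 x" "\<Sum>i<n. D i x"]
        unfolding tele[of n] real_norm_def by linarith
      also have "\<dots> \<le> w x"
        unfolding w_def using elim by (intro add_left_mono sum_le_suminf) auto
      finally show ?case .
    qed
  qed
qed

lemma L2_fatou:
  fixes g :: "nat \<Rightarrow> real \<Rightarrow> real"
  assumes g: "\<And>i. square_integrable (g i)" and bound: "\<And>i. integral {0..1} (\<lambda>x. (g i x)\<^sup>2) \<le> k"
    and h: "h \<in> borel_measurable unit_meas" and lim: "AE x in unit_meas. (\<lambda>i. g i x) \<longlonglongrightarrow> h x"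
  shows "square_integrable h" "integral {0..1} (\<lambda>x. (h x)\<^sup>2) \<le> k"
proof -
  note G = square_integrable_imp[OF g]
  have G2: "integrable unit_meas (\<lambda>x. (g i x)\<^sup>2)" for i using G(2) by (simp add: integrable_unit_iff)
  have k: "0 \<le> k" using bound[of 0] integral_nonneg[OF abs_intD(1)[OF G(2)[of 0]]] by auto
  have "(\<integral>\<^sup>+x. ennreal ((h x)\<^sup>2) \<partial>unit_meas) = (\<integral>\<^sup>+x. liminf (\<lambda>i. ennreal ((g i x)\<^sup>2)) \<partial>unit_meas)"
  proof (rule nn_integral_cong_AE, use lim in eventually_elim)
    case (elim x)
    then have "(\<lambda>i. ennreal ((g i x)\<^sup>2)) \<longlonglongrightarrow> ennreal ((h x)\<^sup>2)"
      by (intro tendsto_intros)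
    then show ?case by (metis lim_imp_Liminf sequentially_bot)
  qed
  also have "\<dots> \<le> liminf (\<lambda>i. \<integral>\<^sup>+x. ennreal ((g i x)\<^sup>2) \<partial>unit_meas)"
    using g by (intro nn_integral_liminf) (auto simp: square_integrable_def)
  also have "\<dots> \<le> liminf (\<lambda>i. ennreal k)"
  proof (intro Liminf_mono always_eventually allI)
    fix i
    have "(\<integral>\<^sup>+x. ennreal ((g i x)\<^sup>2) \<partial>unit_meas) = ennreal (integral {0..1} (\<lambda>x. (g i x)\<^sup>2))"
      using G2[of i] by (subst nn_integral_eq_integral) (auto simp: abs_int_unit)
    then show "(\<integral>\<^sup>+x. ennreal ((g i x)\<^sup>2) \<partial>unit_meas) \<le> ennreal k"
      using bound[of i] by (simp add: ennreal_leI)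
  qed
  also have "\<dots> = ennreal k" by (simp add: Liminf_const)
  finally have le: "(\<integral>\<^sup>+x. ennreal ((h x)\<^sup>2) \<partial>unit_meas) \<le> ennreal k" .
  have h2: "integrable unit_meas (\<lambda>x. (h x)\<^sup>2)"
    using h le by (intro integrableI_nonneg) (auto simp: le_less_trans[OF _ ennreal_less_top])
  then show "square_integrable h" using h by (simp add: square_integrable_def)
  have "ennreal (LINT x|unit_meas. (h x)\<^sup>2) \<le> ennreal k"
    using le h2 by (subst (asm) nn_integral_eq_integral) auto
  then show "integral {0..1} (\<lambda>x. (h x)\<^sup>2) \<le> k"
    using k h2 by (simp add: abs_int_unit ennreal_le_iff)
qed

text \<open>The difference quotients \<open>g m\<close> of \<open>f\<close> on dyadic cells of length
  \<open>2\<^sup>-\<^sup>m\<close> satisfy \<open>\<parallel>g m\<parallel>\<^sup>2 \<le> k\<close>,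
  because those of \<open>F n\<close> are bounded by the Dirichlet energy of \<open>F n\<close>. On a
  coarse cell, \<open>g m\<close> is the mean of \<open>g l\<close> for \<open>l \<ge> m\<close>; hence
  \<open>\<parallel>g l - g m\<parallel>\<^sup>2 = \<parallel>g l\<parallel>\<^sup>2 - \<parallel>g
  m\<parallel>\<^sup>2\<close>, the norms increase, and the sequence is Cauchy. Its limit is the
  derivative of \<open>f\<close>.\<close>

lemma weak_limit_primitive:
  fixes f :: "real \<Rightarrow> real"
  assumes prim: "\<And>n. is_primitive (F n) (s n)" and s: "\<And>n. square_integrable (s n)"
    and bound: "\<And>n. integral {0..1} (\<lambda>x. (s n x)\<^sup>2) \<le> K n" and K: "K \<longlonglongrightarrow> k"
    and lim: "\<And>x. x \<in> {0..1} \<Longrightarrow> (\<lambda>n. F n x) \<longlonglongrightarrow> f x"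
  obtains g where "is_primitive f g" "square_integrable g" "integral {0..1} (\<lambda>x. (g x)\<^sup>2) \<le> k"
proof -
  have holder: "(f b - f a)\<^sup>2 \<le> (b - a) * k" if ab: "0 \<le> a" "a \<le> b" "b \<le> 1" for a b
  proof (rule LIMSEQ_le)
    show "(\<lambda>n. (F n b - F n a)\<^sup>2) \<longlonglongrightarrow> (f b - f a)\<^sup>2"
      using ab by (intro tendsto_intros lim) auto
    show "(\<lambda>n. (b - a) * K n) \<longlonglongrightarrow> (b - a) * k" by (intro tendsto_intros K)
    have "(F n b - F n a)\<^sup>2 \<le> (b - a) * K n" for n
    proof -
      note primitive_holder[OF prim[of n] s ab]
      then show ?thesis
        using bound[of n] ab mult_left_mono[of _ "K n" "b - a"] by (meson diff_ge_0_iff_ge order_trans)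
    qed
    then show "\<exists>N. \<forall>n\<ge>N. (F n b - F n a)\<^sup>2 \<le> (b - a) * K n" by blast
  qed
  have k: "0 \<le> k" using holder[of 0 1] order_trans[OF zero_le_power2[of "f 1 - f 0"]] by simp
  have modulus: "\<bar>f b - f a\<bar> \<le> sqrt (\<bar>b - a\<bar> * k)" if "a \<in> {0..1}" "b \<in> {0..1}" for a b
  proof (cases "a \<le> b")
    case True
    then show ?thesis using holder[of a b] that by (intro real_le_rsqrt) auto
  next
    case False
    then show ?thesis using holder[of b a] that by (intro real_le_rsqrt) (auto simp: power2_commute)
  qed
  define G where "G = (\<lambda>m. interp (2 ^ m) (\<lambda>j. f (real j / 2 ^ m)))"
  define \<gamma> where "\<gamma> = (\<lambda>m j. (f (real j / 2 ^ m) - f (real (j - 1) / 2 ^ m)) * real (2 ^ m))"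
  define g where "g = (\<lambda>m. step (2 ^ m) (\<gamma> m))"
  have N1: "(1::nat) \<le> 2 ^ m" for m by simp
  have Gg: "is_primitive (G m) (g m)" for m
    unfolding G_def g_def \<gamma>_def by (rule interp_primitive[OF N1])
  have gs: "square_integrable (g m)" for m unfolding g_def by (rule step_square_integrable[OF N1])
  define a where "a = (\<lambda>m. integral {0..1} (\<lambda>x. (g m x)\<^sup>2))"
  have inner: "integral {0..1} (\<lambda>x. g m x * g l x) = a m" "(\<lambda>x. g m x * g l x) integrable_on {0..1}"
    if "m \<le> l" for m l
  proof -
    have "((\<lambda>x. g m x * g l x) has_integral (\<gamma> m j * (\<gamma> m j / 2 ^ m))) (cell (2 ^ m) j)"
      if j: "1 \<le> j" "j \<le> 2 ^ m" for j
      unfolding g_def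
    proof (rule step_mult_has_integral_cell[OF N1 j(1)])
      have node: "G l (real i / 2 ^ m) = f (real i / 2 ^ m)" for i
      proof -
        have "(2::real) ^ l = 2 ^ m * 2 ^ (l - m)" using \<open>m \<le> l\<close> by (simp add: power_add[symmetric])
        then have eq: "real i / 2 ^ m = real (i * 2 ^ (l - m)) / real (2 ^ l)" by simp
        have "G l (real i / 2 ^ m) = f (real (i * 2 ^ (l - m)) / 2 ^ l)"
          unfolding G_def eq by (rule interp_node[OF N1])
        then show ?thesis by (simp only: eq of_nat_power of_nat_numeral)
      qed
      define \<alpha> \<beta> where "\<alpha> = real (j - 1) / 2 ^ m" and "\<beta> = real j / 2 ^ m"
      have \<alpha>\<beta>: "0 \<le> \<alpha>" "\<alpha> \<le> \<beta>" "\<beta> \<le> 1" "cell (2 ^ m) j = {\<alpha>..\<beta>}"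
        using j by (auto simp: \<alpha>_def \<beta>_def cell_def divide_right_mono of_nat_diff)
      have "integral {\<alpha>..\<beta>} (g l) = G l \<beta> - G l \<alpha>"
        using primitive_diff[OF Gg \<alpha>\<beta>(1-3)] by simp
      also have "\<dots> = \<gamma> m j / 2 ^ m"
        by (simp add: \<alpha>_def \<beta>_def node \<gamma>_def)
      finally have "integral {\<alpha>..\<beta>} (g l) = \<gamma> m j / 2 ^ m" .
      moreover have "g l integrable_on {\<alpha>..\<beta>}"
        using \<alpha>\<beta> by (intro abs_int_sub(2)[OF square_integrable_imp(1)[OF gs]]) auto
      ultimately show "(step (2 ^ l) (\<gamma> l) has_integral \<gamma> m j / 2 ^ m) (cell (2 ^ m) j)"
        unfolding \<alpha>\<beta>(4) g_def by (metis integrable_integral)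
    qed
    then have "((\<lambda>x. g m x * g l x) has_integral (\<Sum>j=1..2^m. \<gamma> m j * (\<gamma> m j / 2 ^ m))) {0..real (2^m) / real (2^m)}"
      by (intro has_integral_cells[OF N1])
    then have I: "((\<lambda>x. g m x * g l x) has_integral (\<Sum>j=1..2^m. \<gamma> m j * (\<gamma> m j / 2 ^ m))) {0..1}"
      by simp
    have "a m = (\<Sum>j=1..2^m. (\<gamma> m j)\<^sup>2) / real (2 ^ m)"
      using step_integral[OF N1, of m "\<lambda>j. (\<gamma> m j)\<^sup>2"]
      by (simp add: a_def g_def step_def[abs_def])
    then have "a m = (\<Sum>j=1..2^m. \<gamma> m j * (\<gamma> m j / 2 ^ m))"
      by (simp add: sum_divide_distrib power2_eq_square)
    with I show "integral {0..1} (\<lambda>x. g m x * g l x) = a m" "(\<lambda>x. g m x * g l x) integrable_on {0..1}"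
      by (auto simp: integral_unique)
  qed
  have dist: "integral {0..1} (\<lambda>x. (g l x - g m x)\<^sup>2) = a l - a m" if "m \<le> l" for m l
  proof -
    have i: "(\<lambda>x. (g m x)\<^sup>2) integrable_on {0..1}" "(\<lambda>x. (g l x)\<^sup>2) integrable_on {0..1}"
      using abs_intD(1)[OF square_integrable_imp(2)[OF gs]] by auto
    have "integral {0..1} (\<lambda>x. (g l x - g m x)\<^sup>2) =
        integral {0..1} (\<lambda>x. ((g l x)\<^sup>2 + (g m x)\<^sup>2) - 2 * (g m x * g l x))"
      by (simp add: power2_eq_square algebra_simps)
    also have "\<dots> = (a l + a m) - 2 * a m"
      using i inner[OF that]
      by (subst integral_diff) (auto intro!: integrable_add integrable_cmult_real simp: integral_add a_def)
    finally show ?thesis by simp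
  qed
  have a_mono: "a m \<le> a l" if "m \<le> l" for m l
  proof -
    have "0 \<le> (LINT x|unit_meas. (g l x - g m x)\<^sup>2)" by simp
    also have "\<dots> = integral {0..1} (\<lambda>x. (g l x - g m x)\<^sup>2)"
    proof (rule integral_unit, rule nonnegative_absolutely_integrable_1)
      have "(\<lambda>x. ((g l x)\<^sup>2 + (g m x)\<^sup>2) - 2 * (g m x * g l x)) integrable_on {0..1}"
        using abs_intD(1)[OF square_integrable_imp(2)[OF gs]] inner[OF that]
        by (intro integrable_diff integrable_add integrable_cmult_real) auto
      then show "(\<lambda>x. (g l x - g m x)\<^sup>2) integrable_on {0..1}"
        by (simp add: power2_eq_square algebra_simps)
    qed auto
    finally show ?thesis using dist[OF that] by simp
  qed
  have a_le: "a m \<le> k" for m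
  proof (rule LIMSEQ_le[OF _ K])
    define c where "c = (\<lambda>n j. (F n (real j / 2 ^ m) - F n (real (j - 1) / 2 ^ m)) * real (2 ^ m))"
    have node: "real i / 2 ^ m \<in> {0..1}" if "i \<le> 2 ^ m" for i
      using that by (simp add: divide_le_eq_1 of_nat_le_numeral_power_cancel_iff)
    have "(\<lambda>n. (\<Sum>j=1..2^m. (c n j)\<^sup>2) / real (2 ^ m)) \<longlonglongrightarrow> (\<Sum>j=1..2^m. (\<gamma> m j)\<^sup>2) / real (2 ^ m)"
      unfolding c_def \<gamma>_def by (intro tendsto_intros lim node) auto
    also have "(\<Sum>j=1..2^m. (\<gamma> m j)\<^sup>2) / real (2 ^ m) = a m"
      using step_integral[OF N1, of m "\<lambda>j. (\<gamma> m j)\<^sup>2"]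
      by (simp add: a_def g_def step_def[abs_def])
    finally show "(\<lambda>n. (\<Sum>j=1..2^m. (c n j)\<^sup>2) / real (2 ^ m)) \<longlonglongrightarrow> a m" .
    have "(\<Sum>j=1..2^m. (c n j)\<^sup>2) / real (2 ^ m) \<le> K n" for n
    proof -
      have "(c n j)\<^sup>2 / real (2 ^ m) \<le> integral (cell (2 ^ m) j) (\<lambda>x. (s n x)\<^sup>2)"
        if j: "1 \<le> j" "j \<le> 2 ^ m" for j
      proof -
        have 0: "(real j - 1) / real (2 ^ m) = real (j - 1) / 2 ^ m" using j by (simp add: of_nat_diff)
        have "(F n (real j / 2 ^ m) - F n (real (j - 1) / 2 ^ m))\<^sup>2
            \<le> (real j / 2 ^ m - real (j - 1) / 2 ^ m) * integral (cell (2 ^ m) j) (\<lambda>x. (s n x)\<^sup>2)"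
          unfolding cell_def 0 using node[of "j - 1"] node[of j] j
          by (intro order_trans[OF primitive_holder(1)[OF prim s]]) (auto simp: divide_right_mono)
        also have "real j / 2 ^ m - real (j - 1) / 2 ^ m = 1 / (2::real) ^ m"
          using j by (simp add: diff_divide_distrib[symmetric] of_nat_diff)
        finally have "(F n (real j / 2 ^ m) - F n (real (j - 1) / 2 ^ m))\<^sup>2 * 2 ^ m
            \<le> integral (cell (2 ^ m) j) (\<lambda>x. (s n x)\<^sup>2)" by (simp add: field_simps)
        moreover have "(c n j)\<^sup>2 / real (2 ^ m) = (F n (real j / 2 ^ m) - F n (real (j - 1) / 2 ^ m))\<^sup>2 * 2 ^ m"
          by (simp add: c_def power_mult_distrib power2_eq_square)
        ultimately show ?thesis by simp
      qed
      then have "(\<Sum>j=1..2^m. (c n j)\<^sup>2 / real (2 ^ m)) \<le> (\<Sum>j=1..2^m. integral (cell (2 ^ m) j) (\<lambda>x. (s n x)\<^sup>2))"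
        by (intro sum_mono) auto
      also have "\<dots> = integral {0..1} (\<lambda>x. (s n x)\<^sup>2)"
        using integral_cells[OF N1 abs_intD(1)[OF square_integrable_imp(2)[OF s]]] by simp
      also have "\<dots> \<le> K n" by (rule bound)
      finally show ?thesis by (simp add: sum_divide_distrib)
    qed
    then show "\<exists>N. \<forall>n\<ge>N. (\<Sum>j=1..2^m. (c n j)\<^sup>2) / real (2 ^ m) \<le> K n" by blast
  qed
  have "convergent a"
    using incseq_convergent[of a k] a_mono a_le unfolding incseq_def convergent_def by metis
  then have "Cauchy a" by (simp add: Cauchy_convergent_iff)
  then have "\<forall>i. \<exists>M. \<forall>m\<ge>M. \<forall>l\<ge>M. \<bar>a m - a l\<bar> < (1/4) ^ i"
    unfolding Cauchy_def dist_real_def by auto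
  then obtain M where M: "\<And>i m l. \<lbrakk>M i \<le> m; M i \<le> l\<rbrakk> \<Longrightarrow> \<bar>a m - a l\<bar> < (1/4) ^ i" by metis
  \<comment> \<open>\<open>R\<close> is increasing and dominates \<open>M\<close>, so the estimate for \<open>M i\<close> applies to \<open>R i\<close> and \<open>R (Suc i)\<close>.\<close>
  define R where "R = (\<lambda>i. (\<Sum>l\<le>i. M l) + i)"
  have R: "M i \<le> R i" "R i \<le> R (Suc i)" "i \<le> R i" for i
    unfolding R_def using member_le_sum[of i "{..i}" M] by auto
  obtain h w where h: "h \<in> borel_measurable unit_meas"
    and hlim: "AE x in unit_meas. (\<lambda>i. g (R i) x) \<longlonglongrightarrow> h x"
    and w: "integrable unit_meas w" "\<And>i. AE x in unit_meas. \<bar>g (R i) x\<bar> \<le> w x"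
  proof (rule L2_cauchy_AE_limit[of "\<lambda>i. g (R i)"])
    show "integral {0..1} (\<lambda>x. (g (R (Suc i)) x - g (R i) x)\<^sup>2) \<le> (1/4) ^ i" for i
      using M[of i "R (Suc i)" "R i"] R[of i] dist[OF R(2)[of i]] by simp
  qed (use gs in auto)
  have hs: "square_integrable h" "integral {0..1} (\<lambda>x. (h x)\<^sup>2) \<le> k"
    using L2_fatou[of "\<lambda>i. g (R i)" k h] gs a_le h hlim by (auto simp: a_def)
  have hint: "h absolutely_integrable_on {0..1}" using square_integrable_imp(1)[OF hs(1)] .
  have "is_primitive f h"
  proof (rule primitiveI[OF hint])
    fix x :: real assume x: "0 \<le> x" "x \<le> 1"
    have ind: "(LINT y|unit_meas. indicat_real {0..x} y * q y) = integral {0..x} q"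
      if q: "q absolutely_integrable_on {0..1}" for q
    proof -
      have "{0..x} \<inter> {0..1} = {0..x}" using x by auto
      then have "integral {0..1} (\<lambda>y. if y \<in> {0..x} then q y else 0) = integral {0..x} q"
        using integral_restrict_Int[of "{0..1}" "{0..x}" q] by (simp only: Int_commute)
      moreover have "(\<lambda>y. if y \<in> {0..x} then q y else 0) = (\<lambda>y. indicat_real {0..x} y * q y)"
        by (auto simp: indicator_def)
      moreover have "(\<lambda>y. indicat_real {0..x} y * q y) absolutely_integrable_on {0..1}"
      proof (rule absolutely_integrable_bounded_measurable_product_real[OF _ _ _ q])
        show "indicat_real {0..x} \<in> borel_measurable (lebesgue_on {0..1})"
          by (rule measurable_restrict_space1) (auto intro: borel_measurable_indicator)
        show "bounded (indicat_real {0..x} ` {0..1})"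
          by (rule boundedI[of _ 1]) (auto simp: indicator_def)
      qed auto
      ultimately show ?thesis by (simp add: integral_unit)
    qed
    have "(\<lambda>i. LINT y|unit_meas. indicat_real {0..x} y * g (R i) y) \<longlonglongrightarrow> (LINT y|unit_meas. indicat_real {0..x} y * h y)"
    proof (rule integral_dominated_convergence[where w = w])
      have [measurable]: "indicat_real {0..x} \<in> borel_measurable unit_meas"
        unfolding unit_meas_def by (rule measurable_restrict_space1) (auto intro: borel_measurable_indicator)
      have [measurable]: "g (R i) \<in> borel_measurable unit_meas" for i
        using gs[of "R i"] by (simp add: square_integrable_def)
      show "(\<lambda>y. indicat_real {0..x} y * h y) \<in> borel_measurable unit_meas" using h by measurable
      show "(\<lambda>y. indicat_real {0..x} y * g (R i) y) \<in> borel_measurable unit_meas" for i by measurable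
      show "AE y in unit_meas. norm (indicat_real {0..x} y * g (R i) y) \<le> w y" for i
        using w(2)[of i] by eventually_elim (auto simp: indicator_def)
      show "AE y in unit_meas. (\<lambda>i. indicat_real {0..x} y * g (R i) y) \<longlonglongrightarrow> indicat_real {0..x} y * h y"
        using hlim by eventually_elim (intro tendsto_intros)
    qed (rule w(1))
    then have "(\<lambda>i. integral {0..x} (g (R i))) \<longlonglongrightarrow> integral {0..x} h"
      using ind[OF hint] ind[OF square_integrable_imp(1)[OF gs]] by simp
    moreover have "(\<lambda>i. G (R i) x - G (R i) 0) \<longlonglongrightarrow> f x - f 0"
    proof -
      have close: "\<bar>G m x - f x\<bar> \<le> 2 * sqrt ((1/2) ^ m * k)" for m
      proof (cases "x < 1")
        case True
        then obtain j where j: "1 \<le> j" "j \<le> 2 ^ m" "x \<in> cell (2 ^ m) j"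
          using step_cases[OF N1, of x m] x by metis
        define \<alpha> \<beta> where "\<alpha> = real (j - 1) / 2 ^ m" and "\<beta> = real j / 2 ^ m"
        have \<alpha>\<beta>: "cell (2 ^ m) j = {\<alpha>..\<beta>}" "\<beta> - \<alpha> = (1/2) ^ m"
          using j by (auto simp: \<alpha>_def \<beta>_def cell_def of_nat_diff power_one_over field_simps)
        have in01: "\<alpha> \<in> {0..1}" "\<beta> \<in> {0..1}"
          using cell_subset[OF N1 j(1,2)] j(3) \<alpha>\<beta>(1) by auto
        have "\<bar>G m x - f \<alpha>\<bar> \<le> \<bar>f \<beta> - f \<alpha>\<bar>"
          using interp_close[OF N1 j, of "\<lambda>j. f (real j / 2 ^ m)"] by (simp add: G_def \<alpha>_def \<beta>_def)
        also have "\<dots> \<le> sqrt ((1/2) ^ m * k)"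
          using modulus[OF in01] \<alpha>\<beta>(2) by simp
        finally have 1: "\<bar>G m x - f \<alpha>\<bar> \<le> sqrt ((1/2) ^ m * k)" .
        have "\<bar>x - \<alpha>\<bar> \<le> (1/2) ^ m" using j(3) \<alpha>\<beta> by auto
        then have "\<bar>x - \<alpha>\<bar> * k \<le> (1/2) ^ m * k" using k by (rule mult_right_mono)
        then have "\<bar>f x - f \<alpha>\<bar> \<le> sqrt ((1/2) ^ m * k)"
          using modulus[OF in01(1), of x] x by (meson atLeastAtMost_iff order_trans real_sqrt_le_mono)
        with 1 show ?thesis by linarith
      next
        case False
        then have "x = real (2 ^ m) / real (2 ^ m)" using x by simp
        then have "G m x = f x"
          unfolding G_def using interp_node[OF N1, of m _ "2 ^ m"] by simp
        then show ?thesis using k by simp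
      qed
      have "(\<lambda>m. G m x - f x) \<longlonglongrightarrow> 0"
      proof (rule Lim_null_comparison)
        show "\<forall>\<^sub>F m in sequentially. norm (G m x - f x) \<le> 2 * sqrt ((1/2) ^ m * k)"
          using close by simp
        have "(\<lambda>m. 2 * sqrt ((1/2) ^ m * k)) \<longlonglongrightarrow> 2 * sqrt (0 * k)"
          by (intro tendsto_intros LIMSEQ_power_zero) auto
        then show "(\<lambda>m. 2 * sqrt ((1/2) ^ m * k)) \<longlonglongrightarrow> 0" by simp
      qed
      moreover have "filterlim R sequentially sequentially"
        using R(3) by (intro filterlim_at_top_mono[OF filterlim_ident]) auto
      ultimately have "(\<lambda>i. G (R i) x - f x) \<longlonglongrightarrow> 0" by (rule filterlim_compose)
      moreover have "G m 0 = f 0" for m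
        unfolding G_def using interp_node[OF N1, of m _ 0] by simp
      ultimately show ?thesis using LIM_zero_iff[of "\<lambda>i. G (R i) x"] by (auto intro: tendsto_diff)
    qed
    moreover have "G (R i) x - G (R i) 0 = integral {0..x} (g (R i))" for i
      by (rule primitive_eq[OF Gg x])
    ultimately show "f x - f 0 = integral {0..x} h" by (simp add: LIMSEQ_unique)
  qed
  then show ?thesis using hs that by blast
qed

section \<open>The discrete bending density\<close>

text \<open>The argument of \<open>arccos\<close> is the cosine of the difference of the inclination angles
  \<open>arctan d\<close> and \<open>arctan e\<close>.\<close>

lemma arccos_eq_arctan_diff:
  "arccos ((1 + d * e) / (sqrt (1 + d\<^sup>2) * sqrt (1 + e\<^sup>2))) = \<bar>arctan e - arctan d\<bar>"
proof -
  have "cos \<bar>arctan e - arctan d\<bar> = cos (arctan e) * cos (arctan d) + sin (arctan e) * sin (arctan d)"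
    by (simp add: cos_diff)
  also have "\<dots> = (1 + d * e) / (sqrt (1 + d\<^sup>2) * sqrt (1 + e\<^sup>2))"
    unfolding cos_arctan sin_arctan by (simp add: add_divide_distrib mult.commute)
  finally have "(1 + d * e) / (sqrt (1 + d\<^sup>2) * sqrt (1 + e\<^sup>2)) = cos \<bar>arctan e - arctan d\<bar>" ..
  moreover have "\<bar>arctan e - arctan d\<bar> \<le> pi"
    using arctan_bounded[of e] arctan_bounded[of d] by auto
  then have "arccos (cos \<bar>arctan e - arctan d\<bar>) = \<bar>arctan e - arctan d\<bar>"
    by (intro arccos_cos) auto
  ultimately show ?thesis by (simp only:)
qed

lemma abs_le_tan:
  assumes "\<bar>arctan t\<bar> \<le> \<phi>" "0 \<le> \<phi>" "\<phi> < pi / 2"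
  shows "\<bar>t\<bar> \<le> tan \<phi>"
proof -
  have a: "arctan \<bar>t\<bar> \<le> \<phi>"
    using assms(1) by (cases "t \<ge> 0") (auto simp: arctan_minus abs_if split: if_splits)
  have "\<bar>t\<bar> = tan (arctan \<bar>t\<bar>)" by (simp add: tan_arctan)
  also have "\<dots> \<le> tan \<phi>" using a assms arctan_lbound[of "\<bar>t\<bar>"] by (intro tan_mono_le) auto
  finally show ?thesis .
qed

lemma sqrt_sq_diff: "\<bar>sqrt (1 + x\<^sup>2) - sqrt (1 + y\<^sup>2)\<bar> \<le> \<bar>x - y\<bar>" for x y :: real
proof -
  have le: "sqrt (1 + x\<^sup>2) \<le> sqrt (1 + y\<^sup>2) + \<bar>x - y\<bar>" for x y :: real
    using real_sqrt_sum_squares_triangle_ineq[of 1 0 y "x - y"] by (simp add: power2_eq_square)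
  from le[of x y] le[of y x] show ?thesis by auto
qed

text \<open>The multiplicative form of the Lipschitz bound survives the fifth powers in the bending density.\<close>

lemma sqrt_sq_ratio:
  fixes x y \<tau> :: real
  assumes "\<bar>x - y\<bar> \<le> \<tau>"
  shows "sqrt (1 + x\<^sup>2) \<le> (1 + \<tau>) * sqrt (1 + y\<^sup>2)"
proof -
  have "sqrt (1 + x\<^sup>2) \<le> sqrt (1 + y\<^sup>2) + \<tau> * 1" using sqrt_sq_diff[of x y] assms by auto
  also have "\<dots> \<le> sqrt (1 + y\<^sup>2) + \<tau> * sqrt (1 + y\<^sup>2)"
    using assms by (intro add_left_mono mult_left_mono) auto
  finally show ?thesis by (simp add: algebra_simps)
qed

lemma sqrt_sq_pow: "sqrt (1 + x\<^sup>2) ^ 4 = (1 + x\<^sup>2)\<^sup>2" for x :: real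
proof -
  have "t ^ 4 = (t\<^sup>2)\<^sup>2" for t :: real by (simp flip: power_mult)
  from this[of "sqrt (1 + x\<^sup>2)"] show ?thesis by simp
qed

lemma powr_5_2: "(1 + x\<^sup>2) powr (5 / 2) = sqrt (1 + x\<^sup>2) ^ 5" for x :: real
proof -
  have "1 + x\<^sup>2 > 0" by (simp add: add_pos_nonneg)
  then have s: "sqrt (1 + x\<^sup>2) > 0" by simp
  have "(1 + x\<^sup>2) powr (5 / 2) = ((1 + x\<^sup>2) powr (1 / 2)) powr 5"
    by (simp only: powr_powr) simp
  also have "\<dots> = sqrt (1 + x\<^sup>2) powr 5"
    using \<open>1 + x\<^sup>2 > 0\<close> by (subst powr_half_sqrt) auto
  also have "\<dots> = sqrt (1 + x\<^sup>2) ^ 5" using powr_realpow[OF s, of 5] by simp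
  finally show ?thesis .
qed

text \<open>The weight of a squared turning angle in the discrete bending energy.\<close>

definition bend_coeff :: "real \<Rightarrow> real \<Rightarrow> real" where
  "bend_coeff l m = (l ^ 3 + m ^ 3) / (l * m * (l + m)\<^sup>2)"

text \<open>Over the common denominator \<open>l * m * (l + m)\<^sup>2\<close>, the numerators differ by \<open>(l +
  m) * (l - m)\<^sup>2\<close>.\<close>

lemma bend_coeff_ge:
  assumes "l > 0" "m > 0"
  shows "bend_coeff l m \<ge> 1 / (l + m)"
proof -
  have "l ^ 3 + m ^ 3 - l * m * (l + m) = (l + m) * (l - m)\<^sup>2"
    by (simp add: power2_eq_square power3_eq_cube algebra_simps)
  moreover have "(l + m) * (l - m)\<^sup>2 \<ge> 0" using assms by simp
  ultimately have "l * m * (l + m) \<le> l ^ 3 + m ^ 3" by linarith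
  then have "l * m * (l + m) / (l * m * (l + m)\<^sup>2) \<le> bend_coeff l m"
    unfolding bend_coeff_def using assms by (intro divide_right_mono) auto
  then show ?thesis using assms by (simp add: power2_eq_square)
qed

lemma bend_coeff_nonneg: "l > 0 \<Longrightarrow> m > 0 \<Longrightarrow> bend_coeff l m \<ge> 0"
  by (simp add: bend_coeff_def)

text \<open>Up to a factor that tends to 1 with \<open>e - d\<close>, this is \<open>(e - d)\<^sup>2 / (h * (1 +
  d\<^sup>2)\<^sup>5\<^sup>/\<^sup>2)\<close>, the bending density integrated over a cell.\<close>

definition bend_term :: "real \<Rightarrow> real \<Rightarrow> real \<Rightarrow> real" where
  "bend_term h d e = (arctan e - arctan d)\<^sup>2 *
     bend_coeff (h / 2 * sqrt (1 + d\<^sup>2)) (h / 2 * sqrt (1 + e\<^sup>2))"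

lemma arctan_mean_value:
  "\<exists>\<xi>\<in>closed_segment d e. arctan e - arctan d = inverse (1 + \<xi>\<^sup>2) * (e - d)"
  by (rule mean_value_segment) (auto intro!: derivative_eq_intros)

lemma segment_dist:
  fixes d e :: real
  assumes "x \<in> closed_segment d e" "y \<in> closed_segment d e"
  shows "\<bar>x - y\<bar> \<le> \<bar>e - d\<bar>"
  using assms by (auto simp: closed_segment_eq_real_ivl split: if_splits)

text \<open>With \<open>G' = (1 + t\<^sup>2)\<^sup>-\<^sup>5\<^sup>/\<^sup>4\<close>, bending is the Dirichlet
  energy of \<open>G\<close> applied to the slope. The derivatives of \<open>arctan\<close> and
  \<open>G\<close> are taken at two points between \<open>d\<close> and \<open>e\<close>, which
  \<open>sqrt_sq_ratio\<close> compares.\<close>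

lemma bend_term_lower:
  fixes G :: "real \<Rightarrow> real"
  assumes h: "h > 0" and \<tau>: "\<bar>e - d\<bar> \<le> \<tau>"
    and G: "\<And>t. (G has_real_derivative G' t) (at t)" and G': "\<And>t. (G' t)\<^sup>2 = 1 / sqrt (1 + t\<^sup>2) ^ 5"
  shows "bend_term h d e
      \<ge> (G e - G d)\<^sup>2 / h / (1 + \<tau>) ^ 5"
proof -
  obtain \<xi> where \<xi>: "\<xi> \<in> closed_segment d e" "arctan e - arctan d = inverse (1 + \<xi>\<^sup>2) * (e - d)"
    using arctan_mean_value by blast
  obtain \<eta> where \<eta>: "\<eta> \<in> closed_segment d e" "G e - G d = G' \<eta> * (e - d)"
    using mean_value_segment[of d e G G'] G by blast
  define r A B where "r = sqrt (1 + \<eta>\<^sup>2)" and "A = sqrt (1 + d\<^sup>2)" and "B = sqrt (1 + e\<^sup>2)"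
  have \<tau>0: "0 \<le> \<tau>" using \<tau> by linarith
  have pos: "r > 0" "A > 0" "B > 0" by (auto simp: r_def A_def B_def add_pos_nonneg)
  have ratio: "sqrt (1 + x\<^sup>2) \<le> (1 + \<tau>) * r" if "x \<in> closed_segment d e" for x
    unfolding r_def using segment_dist[OF that \<eta>(1)] \<tau> by (intro sqrt_sq_ratio) auto
  have AB: "A \<le> (1 + \<tau>) * r" "B \<le> (1 + \<tau>) * r" using ratio by (auto simp: A_def B_def)
  have c: "bend_coeff (h / 2 * A) (h / 2 * B) \<ge> 1 / (h * ((1 + \<tau>) * r))"
  proof -
    have "h / 2 * A + h / 2 * B \<le> h * ((1 + \<tau>) * r)"
      using mult_left_mono[OF AB(1), of "h/2"] mult_left_mono[OF AB(2), of "h/2"] h by linarith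
    then have "1 / (h * ((1 + \<tau>) * r)) \<le> 1 / (h / 2 * A + h / 2 * B)"
      using pos h by (intro divide_left_mono) (auto intro!: mult_pos_pos add_pos_pos simp: \<tau>0 add_pos_nonneg)
    also have "\<dots> \<le> bend_coeff (h / 2 * A) (h / 2 * B)"
      using pos h by (intro bend_coeff_ge) auto
    finally show ?thesis .
  qed
  have a: "(arctan e - arctan d)\<^sup>2 \<ge> (e - d)\<^sup>2 / ((1 + \<tau>) * r) ^ 4"
  proof -
    have "(1 + \<xi>\<^sup>2)\<^sup>2 \<le> ((1 + \<tau>) * r) ^ 4"
      unfolding sqrt_sq_pow[symmetric] by (intro power_mono ratio \<xi>) auto
    moreover have "(1 + \<xi>\<^sup>2)\<^sup>2 > 0" by (intro zero_less_power add_pos_nonneg) auto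
    ultimately have "(e - d)\<^sup>2 / ((1 + \<tau>) * r) ^ 4 \<le> (e - d)\<^sup>2 / (1 + \<xi>\<^sup>2)\<^sup>2"
      using pos \<tau>0 by (intro divide_left_mono mult_pos_pos) auto
    also have "\<dots> = (arctan e - arctan d)\<^sup>2"
      unfolding \<xi>(2) by (simp add: power_mult_distrib divide_inverse power_inverse mult.commute)
    finally show ?thesis .
  qed
  have "(G e - G d)\<^sup>2 / h / (1 + \<tau>) ^ 5 = (e - d)\<^sup>2 / ((1 + \<tau>) * r) ^ 4 * (1 / (h * ((1 + \<tau>) * r)))"
  proof -
    have p: "r ^ 5 = r ^ 4 * r" "(1 + \<tau>) ^ 5 = (1 + \<tau>) ^ 4 * (1 + \<tau>)"
      using power_add[of r 4 1] power_add[of "1 + \<tau>" 4 1] by simp_all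
    show ?thesis unfolding \<eta>(2) power_mult_distrib G' r_def[symmetric] p by simp
  qed
  also have "\<dots> \<le> (arctan e - arctan d)\<^sup>2 * bend_coeff (h / 2 * A) (h / 2 * B)"
    using a c h pos \<tau>0 by (intro mult_mono) auto
  finally show ?thesis by (simp add: bend_term_def A_def B_def)
qed

text \<open>Here the density is frozen at \<open>d\<close>, to be compared with the density of the limit function at
  nearby points.\<close>

lemma bend_term_upper:
  assumes h: "h > 0" and \<tau>: "\<bar>e - d\<bar> \<le> \<tau>"
  shows "bend_term h d e
      \<le> (1 + \<tau>) ^ 10 * ((e - d)\<^sup>2 / (h * sqrt (1 + d\<^sup>2) ^ 5))"
proof -
  obtain \<xi> where \<xi>: "\<xi> \<in> closed_segment d e" "arctan e - arctan d = inverse (1 + \<xi>\<^sup>2) * (e - d)"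
    using arctan_mean_value by blast
  define T A B where "T = 1 + \<tau>" and "A = sqrt (1 + d\<^sup>2)" and "B = sqrt (1 + e\<^sup>2)"
  have T: "T \<ge> 1" using \<tau> by (auto simp: T_def)
  have pos: "A > 0" "B > 0" by (auto simp: A_def B_def add_pos_nonneg)
  have "A \<le> T * sqrt (1 + \<xi>\<^sup>2)"
    unfolding A_def T_def using segment_dist[OF _ \<xi>(1), of d] \<tau> by (intro sqrt_sq_ratio) auto
  then have "A ^ 4 \<le> (T * sqrt (1 + \<xi>\<^sup>2)) ^ 4" using pos by (intro power_mono) auto
  then have A4: "A ^ 4 \<le> T ^ 4 * (1 + \<xi>\<^sup>2)\<^sup>2" by (simp add: power_mult_distrib sqrt_sq_pow)
  have \<xi>pos: "(1 + \<xi>\<^sup>2)\<^sup>2 > 0" by (intro zero_less_power add_pos_nonneg) auto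
  have a: "(arctan e - arctan d)\<^sup>2 \<le> T ^ 4 * (e - d)\<^sup>2 / A ^ 4"
  proof -
    have "(arctan e - arctan d)\<^sup>2 = (e - d)\<^sup>2 / (1 + \<xi>\<^sup>2)\<^sup>2"
      unfolding \<xi>(2) by (simp add: power_mult_distrib divide_inverse power_inverse mult.commute)
    also have "\<dots> \<le> T ^ 4 * (e - d)\<^sup>2 / A ^ 4"
    proof -
      have "(e - d)\<^sup>2 / (1 + \<xi>\<^sup>2)\<^sup>2 = T ^ 4 * (e - d)\<^sup>2 / (T ^ 4 * (1 + \<xi>\<^sup>2)\<^sup>2)"
        using T by simp
      also have "\<dots> \<le> T ^ 4 * (e - d)\<^sup>2 / A ^ 4"
        using A4 \<xi>pos pos T by (intro divide_left_mono mult_pos_pos) auto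
      finally show ?thesis .
    qed
    finally show ?thesis .
  qed
  have BA: "B \<le> T * A" "A \<le> T * B"
    unfolding A_def B_def T_def using \<tau> by (auto intro!: sqrt_sq_ratio)
  have c: "bend_coeff (h / 2 * A) (h / 2 * B) \<le> T ^ 6 / (h * A)"
  proof -
    have "bend_coeff (h / 2 * A) (h / 2 * B) = (2 / h) * ((A ^ 3 + B ^ 3) / (A * B * (A + B)\<^sup>2))"
    proof -
      have "(h / 2 * A) ^ 3 + (h / 2 * B) ^ 3 = (h / 2) ^ 3 * (A ^ 3 + B ^ 3)"
        by (simp add: power_mult_distrib algebra_simps power_divide)
      moreover have "(h / 2 * A) * (h / 2 * B) * (h / 2 * A + h / 2 * B)\<^sup>2 = (h / 2) ^ 4 * (A * B * (A + B)\<^sup>2)"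
        by (simp add: power2_eq_square power4_eq_xxxx algebra_simps)
      ultimately have "bend_coeff (h / 2 * A) (h / 2 * B) =
          ((h / 2) ^ 3 * (A ^ 3 + B ^ 3)) / ((h / 2) ^ 4 * (A * B * (A + B)\<^sup>2))"
        unfolding bend_coeff_def by (simp only:)
      also have "(h / 2) ^ 4 = (h / 2) ^ 3 * (h / 2)" by (simp add: power_eq_if)
      also have "((h / 2) ^ 3 * (A ^ 3 + B ^ 3)) / ((h / 2) ^ 3 * (h / 2) * (A * B * (A + B)\<^sup>2)) =
          (2 / h) * ((A ^ 3 + B ^ 3) / (A * B * (A + B)\<^sup>2))"
      proof -
        have aux: "(a * x) / (a * b * y) = (1 / b) * (x / y)" if "a \<noteq> 0" for a b x y :: real
          using that by simp
        show ?thesis using aux[of "(h / 2) ^ 3" "A ^ 3 + B ^ 3" "h / 2" "A * B * (A + B)\<^sup>2"] h by simp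
      qed
      finally show ?thesis .
    qed
    also have "\<dots> \<le> (2 / h) * (2 * A ^ 3 * T ^ 3 / (4 * A ^ 4 / T ^ 3))"
    proof (intro mult_left_mono frac_le)
      have "B ^ 3 \<le> (T * A) ^ 3" using pos BA by (intro power_mono) auto
      moreover have "A ^ 3 \<le> (T * A) ^ 3" using pos T by (intro power_mono) auto
      ultimately show "A ^ 3 + B ^ 3 \<le> 2 * A ^ 3 * T ^ 3" by (simp add: power_mult_distrib ac_simps)
      have BT: "A / T \<le> B" using BA T by (simp add: divide_le_eq mult.commute)
      have AT: "A / T \<le> A" using pos T by (simp add: divide_le_eq)
      have AT0: "0 \<le> A / T" using pos T by simp
      have "4 * A ^ 4 / T ^ 3 = A * (A / T) * (A / T + A / T)\<^sup>2"
        using T by (simp add: power2_eq_square power3_eq_cube power4_eq_xxxx ac_simps)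
      also have "\<dots> \<le> A * B * (A + B)\<^sup>2"
        using pos AT0 AT BT by (intro mult_mono power_mono add_mono) auto
      finally show "4 * A ^ 4 / T ^ 3 \<le> A * B * (A + B)\<^sup>2" .
    qed (use pos h T in auto)
    also have "\<dots> = T ^ 6 / (h * A)"
    proof -
      have p: "A ^ 4 = A ^ 3 * A" "T ^ 6 = T ^ 3 * T ^ 3"
        using power_add[of A 3 1] power_add[of T 3 3] by simp_all
      show ?thesis unfolding p using pos h T by simp
    qed
    finally show ?thesis .
  qed
  have "(arctan e - arctan d)\<^sup>2 * bend_coeff (h / 2 * A) (h / 2 * B)
      \<le> (T ^ 4 * (e - d)\<^sup>2 / A ^ 4) * (T ^ 6 / (h * A))"
    using a c pos h T by (intro mult_mono bend_coeff_nonneg) auto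
  also have "\<dots> = T ^ 10 * ((e - d)\<^sup>2 / (h * A ^ 5))"
  proof -
    have p: "A ^ 5 = A ^ 4 * A" "T ^ 10 = T ^ 4 * T ^ 6"
      using power_add[of A 4 1] power_add[of T 4 6] by simp_all
    have "(t * x / a) * (u / (h * A)) = t * u * (x / (h * (a * A)))" for t x a u :: real
      by (simp add: ac_simps)
    then show ?thesis unfolding p by this
  qed
  finally show ?thesis by (simp add: bend_term_def A_def B_def T_def)
qed

text \<open>For bounded slopes, a bound for the bending energy is a bound for the squared slope jumps.\<close>

lemma bend_term_lower_bounded:
  assumes h: "h > 0" and M: "\<bar>d\<bar> \<le> M" "\<bar>e\<bar> \<le> M"
  shows "(e - d)\<^sup>2 / h \<le> (1 + M\<^sup>2) ^ 3 *
      bend_term h d e"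
proof -
  obtain \<xi> where \<xi>: "\<xi> \<in> closed_segment d e" "arctan e - arctan d = inverse (1 + \<xi>\<^sup>2) * (e - d)"
    using arctan_mean_value by blast
  define Q A B where "Q = 1 + M\<^sup>2" and "A = sqrt (1 + d\<^sup>2)" and "B = sqrt (1 + e\<^sup>2)"
  have Q: "Q \<ge> 1" by (simp add: Q_def)
  have pos: "A > 0" "B > 0" by (auto simp: A_def B_def add_pos_nonneg)
  have sq: "x\<^sup>2 \<le> M\<^sup>2" if "\<bar>x\<bar> \<le> M" for x
    using that by (metis abs_ge_zero power2_abs power_mono)
  have sqQ: "sqrt (1 + x\<^sup>2) \<le> Q" if "\<bar>x\<bar> \<le> M" for x
  proof (rule real_le_lsqrt)
    have "1 + x\<^sup>2 \<le> Q * 1" using sq[OF that] by (simp add: Q_def)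
    also have "\<dots> \<le> Q * Q" using Q by (intro mult_left_mono) auto
    finally show "1 + x\<^sup>2 \<le> Q\<^sup>2" by (simp add: power2_eq_square)
  qed (use Q in auto)
  have AB: "A \<le> Q" "B \<le> Q" using sqQ M by (auto simp: A_def B_def)
  have "\<bar>\<xi>\<bar> \<le> M" using \<xi>(1) M by (auto simp: closed_segment_eq_real_ivl split: if_splits)
  then have "1 + \<xi>\<^sup>2 \<le> Q" using sq by (simp add: Q_def)
  then have "(1 + \<xi>\<^sup>2)\<^sup>2 \<le> Q\<^sup>2" by (intro power_mono) auto
  moreover have "(1 + \<xi>\<^sup>2)\<^sup>2 > 0" by (intro zero_less_power add_pos_nonneg) auto
  ultimately have "(e - d)\<^sup>2 / Q\<^sup>2 \<le> (e - d)\<^sup>2 / (1 + \<xi>\<^sup>2)\<^sup>2"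
    using Q by (intro divide_left_mono) (auto intro!: mult_pos_pos)
  also have "\<dots> = (arctan e - arctan d)\<^sup>2"
    unfolding \<xi>(2) by (simp add: power_mult_distrib divide_inverse power_inverse mult.commute)
  finally have a: "(e - d)\<^sup>2 / Q\<^sup>2 \<le> (arctan e - arctan d)\<^sup>2" .
  have "h / 2 * A + h / 2 * B \<le> h * Q"
    using mult_left_mono[OF AB(1), of "h/2"] mult_left_mono[OF AB(2), of "h/2"] h by linarith
  then have "1 / (h * Q) \<le> 1 / (h / 2 * A + h / 2 * B)"
    using pos h Q by (intro divide_left_mono) (auto intro!: mult_pos_pos add_pos_pos)
  also have "\<dots> \<le> bend_coeff (h / 2 * A) (h / 2 * B)"
    using pos h by (intro bend_coeff_ge) auto
  finally have c: "1 / (h * Q) \<le> bend_coeff (h / 2 * A) (h / 2 * B)" .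
  have "(e - d)\<^sup>2 / h = Q ^ 3 * ((e - d)\<^sup>2 / Q\<^sup>2 * (1 / (h * Q)))"
    using Q h by (simp add: power3_eq_cube power2_eq_square)
  also have "\<dots> \<le> Q ^ 3 * ((arctan e - arctan d)\<^sup>2 * bend_coeff (h / 2 * A) (h / 2 * B))"
    using a c Q h by (intro mult_left_mono mult_mono) auto
  finally show ?thesis by (simp add: bend_term_def A_def B_def Q_def)
qed

text \<open>The arithmetic-geometric mean inequality; note that \<open>sqrt (2 * C * \<sigma>) = 2 * sqrt (C / 2) *
  sqrt \<sigma>\<close>.\<close>

lemma turning_le_energy:
  fixes C \<sigma> L \<theta> :: real
  assumes "C > 0" "\<sigma> > 0" "L > 0"
  shows "sqrt (2 * C * \<sigma>) * \<theta> \<le> C / 2 * (\<theta>\<^sup>2 * (1 / L)) + \<sigma> * L"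
proof -
  have "0 \<le> (sqrt (C / 2) * \<theta> / sqrt L - sqrt \<sigma> * sqrt L)\<^sup>2" by simp
  also have "\<dots> = (sqrt (C / 2) * \<theta> / sqrt L)\<^sup>2 - 2 * (sqrt (C / 2) * \<theta> / sqrt L) * (sqrt \<sigma> * sqrt L) + (sqrt \<sigma> * sqrt L)\<^sup>2"
    by (simp add: power2_diff)
  also have "2 * (sqrt (C / 2) * \<theta> / sqrt L) * (sqrt \<sigma> * sqrt L) = 2 * (sqrt (C / 2) * sqrt \<sigma>) * \<theta>"
    using assms by (simp add: field_simps)
  also have "2 * (sqrt (C / 2) * sqrt \<sigma>) = sqrt (2 * C * \<sigma>)"
  proof -
    have "2 * (sqrt (C / 2) * sqrt \<sigma>) = sqrt 4 * sqrt (C / 2 * \<sigma>)"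
      by (simp add: real_sqrt_mult[symmetric])
    also have "\<dots> = sqrt (4 * (C / 2 * \<sigma>))" by (simp only: real_sqrt_mult)
    finally show ?thesis by simp
  qed
  also have "(sqrt (C / 2) * \<theta> / sqrt L)\<^sup>2 = C / 2 * (\<theta>\<^sup>2 * (1 / L))"
    using assms by (simp add: power_mult_distrib power_divide)
  also have "(sqrt \<sigma> * sqrt L)\<^sup>2 = \<sigma> * L"
    using assms by (simp add: power_mult_distrib)
  finally show ?thesis by simp
qed

section \<open>Norms and energies in terms of primitives\<close>

lemma AE_unit_exists:
  assumes "AE x in unit_meas. P x"
  shows "\<exists>x\<in>{0<..<1}. P x"
proof (rule ccontr)
  assume "\<not> ?thesis"
  then have "{x \<in> {0<..<1}. \<not> P x} = {0<..<1::real}" by auto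
  then have "negligible {0<..<1::real}" using assms by (simp add: AE_unit_iff)
  then show False using open_not_negligible[of "{0<..<1::real}"] by auto
qed

lemma LINT_cong_unit:
  fixes f g :: "real \<Rightarrow> real"
  assumes "AE x in unit_meas. f x = g x" "g absolutely_integrable_on {0..1}"
  shows "(LINT x|unit_meas. f x) = integral {0..1} g"
proof -
  have "f absolutely_integrable_on {0..1}" "integral {0..1} f = integral {0..1} g"
    using abs_int_cong_AE[OF assms(1), of 0 1] assms(2) by auto
  then show ?thesis by (simp add: integral_unit)
qed

lemma Linf_norm_le:
  assumes "g \<in> borel_measurable unit_meas" "AE x in unit_meas. \<bar>g x\<bar> \<le> m"
  shows "Linf_norm g \<le> ereal m"
  unfolding Linf_norm_def using assms by (intro esssup_I) auto

lemma Linf_norm_AE: "AE x in unit_meas. ereal \<bar>g x\<bar> \<le> Linf_norm g"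
  unfolding Linf_norm_def by (rule esssup_AE)

lemma Linf_norm_nonneg: "0 \<le> Linf_norm g"
proof -
  obtain x where "ereal \<bar>g x\<bar> \<le> Linf_norm g"
    using AE_unit_exists[OF Linf_norm_AE[of g]] by blast
  then show ?thesis by (metis abs_ge_zero ereal_less_eq(5) order_trans)
qed

text \<open>A continuous function that exceeds its essential supremum does so on a nonempty open set, which is not
  negligible.\<close>

lemma Linf_norm_ge:
  assumes v: "continuous_on {0..1} v" and x: "x \<in> {0..1}"
  shows "ereal \<bar>v x\<bar> \<le> Linf_norm v"
proof (cases "Linf_norm v")
  case (real L)
  have "{y \<in> {0<..<1}. \<bar>v y\<bar> > L} = {}"
  proof (rule ccontr)
    assume ne: "{y \<in> {0<..<1}. \<bar>v y\<bar> > L} \<noteq> {}"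
    have "continuous_on {0<..<1} (\<lambda>y. \<bar>v y\<bar>)"
      by (intro continuous_intros continuous_on_subset[OF v]) auto
    then have "open {y \<in> {0<..<1}. \<bar>v y\<bar> \<in> {L<..}}"
      by (rule continuous_open_preimage[unfolded vimage_def Int_def mem_Collect_eq]) auto
    then have "\<not> negligible {y \<in> {0<..<1}. \<bar>v y\<bar> > L}" using ne open_not_negligible by auto
    moreover have "negligible {y \<in> {0<..<1}. \<bar>v y\<bar> > L}"
      using Linf_norm_AE[of v] unfolding AE_unit_iff real by (simp add: not_le)
    ultimately show False by simp
  qed
  then have "\<bar>v y\<bar> \<le> L" if "y \<in> {0<..<1}" for y using that by force
  moreover have "continuous_on (closure {0<..<1}) (\<lambda>y. \<bar>v y\<bar>)"
    using v by (simp add: continuous_on_rabs)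
  ultimately have "\<bar>v x\<bar> \<le> L"
    using continuous_le_on_closure[of "{0<..<1}" "\<lambda>y. \<bar>v y\<bar>" x L] x by simp
  then show ?thesis using real by simp
qed (use Linf_norm_nonneg[of v] in auto)

lemma Linf_norm_continuous_le:
  assumes "continuous_on {0..1} v" "\<And>x. x \<in> {0..1} \<Longrightarrow> \<bar>v x\<bar> \<le> m"
  shows "Linf_norm v \<le> ereal m"
proof (rule Linf_norm_le)
  show "v \<in> borel_measurable unit_meas"
    using continuous_square_integrable[OF assms(1)] by (simp add: square_integrable_def)
  show "AE x in unit_meas. \<bar>v x\<bar> \<le> m"
    unfolding AE_unit_iff by (rule negligible_subset[OF negligible_empty]) (use assms(2) in force)
qed

lemma W1inf_seminorm_le:
  assumes "is_primitive v g" "square_integrable g" "AE x in unit_meas. \<bar>g x\<bar> \<le> m"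
  shows "W1inf_seminorm v \<le> ereal m"
  unfolding W1inf_seminorm_def
proof (rule Linf_norm_le)
  note W = wderiv_primitive[OF assms(1,2)]
  show "wderiv v \<in> borel_measurable unit_meas" using W(2) by (simp add: square_integrable_def)
  show "AE x in unit_meas. \<bar>wderiv v x\<bar> \<le> m" using W(3) assms(3) by eventually_elim auto
qed

lemma X_ball_bound:
  assumes "v \<in> X_ball S" "x \<in> {0..1}"
  shows "\<bar>v x\<bar> \<le> S"
proof -
  have v: "v \<in> H1_per" and S: "Linf_norm v + W1inf_seminorm v \<le> ereal S"
    using assms by (auto simp: X_ball_def W1inf_norm_def)
  have "ereal \<bar>v x\<bar> \<le> Linf_norm v" by (rule Linf_norm_ge[OF H1_perD(4)[OF v] assms(2)])
  also have "\<dots> = Linf_norm v + 0" by simp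
  also have "\<dots> \<le> Linf_norm v + W1inf_seminorm v"
    by (intro add_left_mono) (simp add: W1inf_seminorm_def Linf_norm_nonneg)
  finally show ?thesis using S by (metis ereal_less_eq(3) order_trans)
qed

lemma X_ballI:
  assumes "v \<in> H1_per" "Linf_norm v \<le> ereal m" "W1inf_seminorm v \<le> ereal m'" "m + m' \<le> S"
  shows "v \<in> X_ball S"
proof -
  have "Linf_norm v + W1inf_seminorm v \<le> ereal m + ereal m'" using assms by (intro add_mono)
  also have "\<dots> \<le> ereal S" using assms by simp
  finally show ?thesis using assms(1) by (simp add: X_ball_def W1inf_norm_def)
qed

lemma sqrt_abs_int:
  assumes "square_integrable g"
  shows "(\<lambda>x. sqrt (1 + (g x)\<^sup>2)) absolutely_integrable_on {0..1}"
proof (rule measurable_bounded_by_integrable_imp_absolutely_integrable)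
  note g = square_integrable_imp[OF assms]
  have "g \<in> borel_measurable (lebesgue_on {0..1})"
    using absolutely_integrable_measurable[of "{0..1}" g] g(1) by auto
  then show "(\<lambda>x. sqrt (1 + (g x)\<^sup>2)) \<in> borel_measurable (lebesgue_on {0..1})" by measurable
  show "(\<lambda>x. 1 + (g x)\<^sup>2) integrable_on {0..1}"
    using abs_intD(1)[OF g(2)] by (intro integrable_add) auto
  fix x
  have "(1 + (g x)\<^sup>2) * 1 \<le> (1 + (g x)\<^sup>2) * (1 + (g x)\<^sup>2)"
    by (intro mult_left_mono) auto
  then have "sqrt (1 + (g x)\<^sup>2) \<le> sqrt ((1 + (g x)\<^sup>2)\<^sup>2)"
    by (intro real_sqrt_le_mono) (simp add: power2_eq_square)
  then show "norm (sqrt (1 + (g x)\<^sup>2)) \<le> 1 + (g x)\<^sup>2" by simp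
qed auto

lemma tension_primitive:
  assumes "is_primitive u g" "square_integrable g"
  shows "tension \<sigma> u = \<sigma> * integral {0..1} (\<lambda>x. sqrt (1 + (g x)\<^sup>2))"
proof -
  have "AE x in unit_meas. sqrt (1 + (wderiv u x)\<^sup>2) = sqrt (1 + (g x)\<^sup>2)"
    using wderiv_primitive(3)[OF assms] by eventually_elim simp
  from LINT_cong_unit[OF this sqrt_abs_int[OF assms(2)]] show ?thesis by (simp add: tension_def)
qed

lemma bend_density_abs_int:
  assumes p: "continuous_on {0..1} p" and q: "square_integrable q"
  shows "(\<lambda>x. (q x)\<^sup>2 / sqrt (1 + (p x)\<^sup>2) ^ 5) absolutely_integrable_on {0..1}"
proof -
  have "(\<lambda>x. 1 / sqrt (1 + (p x)\<^sup>2) ^ 5 * (q x)\<^sup>2) absolutely_integrable_on {0..1}"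
  proof (rule abs_int_mult_continuous[OF _ square_integrable_imp(2)[OF q]])
    have "sqrt (1 + (p x)\<^sup>2) ^ 5 \<noteq> 0" for x
      by (metis add_pos_nonneg less_irrefl power_not_zero real_sqrt_gt_0_iff zero_le_power2 zero_less_one)
    then show "continuous_on {0..1} (\<lambda>x. 1 / sqrt (1 + (p x)\<^sup>2) ^ 5)"
      by (intro continuous_intros p) auto
  qed
  then show ?thesis by simp
qed

lemma bending_primitive:
  assumes u: "is_primitive u p" and p: "is_primitive p q" and q: "square_integrable q"
  shows "bending C u = C / 2 * integral {0..1} (\<lambda>x. (q x)\<^sup>2 / sqrt (1 + (p x)\<^sup>2) ^ 5)"
proof -
  have pc: "continuous_on {0..1} p" by (rule primitive_continuous[OF p])
  have "AE x in unit_meas. (wderiv (wderiv u) x)\<^sup>2 / (1 + (wderiv u x)\<^sup>2) powr (5 / 2) =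
      (q x)\<^sup>2 / sqrt (1 + (p x)\<^sup>2) ^ 5"
    using wderiv_wderiv[OF assms] wderiv_primitive(3)[OF u continuous_square_integrable[OF pc]]
    by eventually_elim (simp add: powr_5_2)
  from LINT_cong_unit[OF this bend_density_abs_int[OF pc q]] show ?thesis by (simp add: bending_def)
qed

text \<open>The end points are included, which makes the set compact and changes no integral.\<close>

definition contact_set :: "(real \<Rightarrow> real) \<Rightarrow> (real \<Rightarrow> real) \<Rightarrow> real set" where
  "contact_set \<psi> u = {x \<in> {0..1}. u x = \<psi> x}"

lemma contact_set_compact:
  assumes "continuous_on {0..1} u" "continuous_on {0..1} \<psi>"
  shows "compact (contact_set \<psi> u)"
proof -
  have "closed {x \<in> {0..1}. u x - \<psi> x \<in> {0}}"
    using assms by (intro continuous_closed_preimage[unfolded vimage_def Int_def mem_Collect_eq] continuous_intros) auto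
  moreover have "{x \<in> {0..1}. u x - \<psi> x \<in> {0}} = contact_set \<psi> u" by (auto simp: contact_set_def)
  moreover have "bounded (contact_set \<psi> u)"
    by (rule bounded_subset[of "{0..1}"]) (auto simp: contact_set_def)
  ultimately show ?thesis by (simp add: compact_eq_bounded_closed)
qed

lemma indicator_mult_abs_int:
  fixes f :: "real \<Rightarrow> real"
  assumes "A \<in> sets lebesgue" "f absolutely_integrable_on {0..1}"
  shows "(\<lambda>x. indicat_real A x * f x) absolutely_integrable_on {0..1}"
proof (rule absolutely_integrable_bounded_measurable_product_real[OF _ _ _ assms(2)])
  show "indicat_real A \<in> borel_measurable (lebesgue_on {0..1})"
    by (rule measurable_restrict_space1) (use assms(1) in \<open>auto intro: borel_measurable_indicator\<close>)
  show "bounded (indicat_real A ` {0..1})"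
    by (rule boundedI[of _ 1]) (auto simp: indicator_def)
qed auto

lemma adhesion_primitive:
  assumes u: "is_primitive u g" and g: "square_integrable g" and \<psi>: "continuous_on {0..1} \<psi>"
  shows "adhesion \<gamma> \<psi> u = \<gamma> * integral {0..1} (\<lambda>x. indicat_real (contact_set \<psi> u) x * sqrt (1 + (g x)\<^sup>2))"
proof -
  \<comment> \<open>The adhesion energy integrates over the open interval; the contact set differs from \<open>A\<close> by at most two points.\<close>
  define A where "A = {x \<in> {0<..<1}. u x = \<psi> x}"
  note W = wderiv_primitive[OF assms(1,2)]
  have K: "contact_set \<psi> u \<in> sets lebesgue"
    using contact_set_compact[OF primitive_continuous[OF u] \<psi>]
    by (intro fmeasurableD lmeasurable_compact)
  have A: "A = contact_set \<psi> u \<inter> {0<..<1}" by (auto simp: A_def contact_set_def)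
  then have Al: "A \<in> sets lebesgue" using K by auto
  have eq: "lebesgue_on A = restrict_space unit_meas A"
    unfolding unit_meas_def by (subst restrict_restrict_space) (use A Al in \<open>auto simp: Int_absorb1\<close>)
  have "(LINT x|lebesgue_on A. sqrt (1 + (wderiv u x)\<^sup>2)) =
      (LINT x|unit_meas. indicat_real A x * sqrt (1 + (wderiv u x)\<^sup>2))"
    unfolding eq
    by (subst integral_restrict_space) (use Al A in \<open>auto simp: unit_meas_def sets_restrict_space\<close>)
  also have "\<dots> = integral {0..1} (\<lambda>x. indicat_real (contact_set \<psi> u) x * sqrt (1 + (g x)\<^sup>2))"
  proof (rule LINT_cong_unit)
    show "(\<lambda>x. indicat_real (contact_set \<psi> u) x * sqrt (1 + (g x)\<^sup>2)) absolutely_integrable_on {0..1}"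
      by (rule indicator_mult_abs_int[OF K sqrt_abs_int[OF g]])
    have "AE x in unit_meas. x \<in> {0<..<1}"
      unfolding AE_unit_iff by (rule negligible_subset[OF negligible_empty]) auto
    then show "AE x in unit_meas. indicat_real A x * sqrt (1 + (wderiv u x)\<^sup>2) =
        indicat_real (contact_set \<psi> u) x * sqrt (1 + (g x)\<^sup>2)"
      using W(3) by eventually_elim (auto simp: A indicator_def)
  qed
  finally show ?thesis by (simp add: adhesion_def A_def)
qed

section \<open>Finite element functions\<close>

lemma nodal_eq:
  assumes "v 0 = v 1" "j \<le> N" "N \<ge> 1"
  shows "nodal N v j = v (real j / real N)"
proof (cases "j = N")
  case True
  then show ?thesis using assms by (simp add: nodal_def)
next
  case False
  then show ?thesis using assms by (simp add: nodal_def)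
qed

lemma slope_eq: "slope N v j = (nodal N v j - nodal N v (j - 1)) * real N"
  by (simp add: slope_def)

lemma nodal_wrap: "nodal N v (N + 1) = nodal N v 1" "nodal N v 0 = nodal N v N"
proof -
  have "(N + 1) mod N = 1 mod N" by (rule mod_add_self1)
  then show "nodal N v (N + 1) = nodal N v 1" by (simp only: nodal_def)
  show "nodal N v 0 = nodal N v N" by (simp add: nodal_def)
qed

lemma slope_wrap: "slope N v (N + 1) = slope N v 1"
proof -
  have "N + 1 - 1 = N" "1 - 1 = (0::nat)" by simp_all
  then show ?thesis unfolding slope_def using nodal_wrap[of N v] by simp
qed

text \<open>In the periodic numbering, the cell after the last one is the first.\<close>

definition wrap_index :: "nat \<Rightarrow> nat \<Rightarrow> nat" where "wrap_index N j = (if j = N + 1 then 1 else j)"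

lemma wrap_index_simps: "wrap_index N (N + 1) = 1" "j \<le> N \<Longrightarrow> wrap_index N j = j"
  by (auto simp: wrap_index_def)

lemma wrap_index_range: "N \<ge> 1 \<Longrightarrow> 1 \<le> j \<Longrightarrow> j \<le> N + 1 \<Longrightarrow> 1 \<le> wrap_index N j \<and> wrap_index N j \<le> N"
  by (auto simp: wrap_index_def)

lemma slope_wrap_index: "slope N v (j + 1) = slope N v (wrap_index N (j + 1))"
  using slope_wrap[of N v] by (simp add: wrap_index_def)

lemma node_in_cell:
  "N \<ge> 1 \<Longrightarrow> real j / real N \<in> cell N j" 
  by (simp add: cell_def divide_right_mono)

lemma left_node_in_cell:
  "N \<ge> 1 \<Longrightarrow> 1 \<le> j \<Longrightarrow> real (j - 1) / real N \<in> cell N j"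
  by (simp add: cell_def divide_right_mono of_nat_diff)

lemma V_h_interp:
  assumes v: "v \<in> V_h N" and N: "N \<ge> 1" and x: "x \<in> {0..1}"
  shows "v x = interp N (nodal N v) x"
proof -
  have per: "v 0 = v 1" and cont: "continuous_on {0..1} v" using v by (auto simp: V_h_def)
  have main: "v x = interp N (nodal N v) x" if x: "x \<in> cell N j" and j: "1 \<le> j" "j \<le> N" for x j
  proof -
    obtain a b where ab: "\<And>x. x \<in> {(real j - 1) / real N<..<real j / real N} \<Longrightarrow> v x = a + b * x"
      using v j by (fastforce simp: V_h_def)
    have lt: "(real j - 1) / real N < real j / real N" using N by (simp add: divide_strict_right_mono)
    then have cl: "closure {(real j - 1) / real N<..<real j / real N} = cell N j"
      by (simp add: cell_def)
    have all: "v y - (a + b * y) = 0" if "y \<in> cell N j" for y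
    proof (rule continuous_constant_on_closure[of "{(real j - 1) / real N<..<real j / real N}" "\<lambda>y. v y - (a + b * y)"])
      show "continuous_on (closure {(real j - 1) / real N<..<real j / real N}) (\<lambda>y. v y - (a + b * y))"
        unfolding cl by (intro continuous_intros continuous_on_subset[OF cont] cell_subset N j)
      show "y \<in> closure {(real j - 1) / real N<..<real j / real N}" using that cl by simp
    qed (simp add: ab)
    have n1: "nodal N v j = a + b * (real j / real N)"
      using all[of "real j / real N"] nodal_eq[OF per j(2) N] lt by (simp add: cell_def)
    have n0: "nodal N v (j - 1) = a + b * ((real j - 1) / real N)"
      using all[of "(real j - 1) / real N"] nodal_eq[OF per _ N, of "j - 1"] lt j
      by (simp add: cell_def of_nat_diff)
    have "interp N (nodal N v) x = a + b * x"
      unfolding interp_cell[OF N j x] n0 n1 using N by (simp add: field_simps)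
    then show ?thesis using all[OF x] by simp
  qed
  show ?thesis
  proof (cases "x < 1")
    case True
    then show ?thesis using step_cases[OF N, of x] x main by (metis atLeastAtMost_iff)
  next
    case False
    then have "x = 1" using x by simp
    moreover have "1 \<in> cell N N" using N by (simp add: cell_def divide_le_eq_1)
    ultimately show ?thesis using main N by blast
  qed
qed

lemma V_h_primitive:
  assumes "v \<in> V_h N" "N \<ge> 1"
  shows "is_primitive v (step N (slope N v))"
proof (rule primitive_cong[OF interp_primitive[OF assms(2), of "nodal N v"]])
  show "interp N (nodal N v) x = v x" if "x \<in> {0..1}" for x using V_h_interp[OF assms that] by simp
qed (simp add: slope_eq[abs_def])

lemma interp_V_h:
  assumes "N \<ge> 1" "c N = c 0"
  shows "interp N c \<in> V_h N"
proof -
  have "interp N c 0 = interp N c 1"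
    using interp_node[OF assms(1), of c 0] interp_node[OF assms(1), of c N] assms by simp
  moreover have "continuous_on {0..1} (interp N c)"
    by (rule primitive_continuous[OF interp_primitive[OF assms(1)]])
  moreover have "\<exists>a b. \<forall>x\<in>{(real j - 1) / real N<..<real j / real N}. interp N c x = a + b * x"
    if j: "j \<in> {1..N}" for j
  proof (intro exI ballI)
    fix x assume "x \<in> {(real j - 1) / real N<..<real j / real N}"
    then have "x \<in> cell N j" by (simp add: cell_def)
    with interp_cell[OF assms(1) _ _ this, of c] j
    show "interp N c x = (c (j - 1) - (c j - c (j - 1)) * (real j - 1)) + ((c j - c (j - 1)) * real N) * x"
      by (simp add: algebra_simps)
  qed
  ultimately show ?thesis by (auto simp: V_h_def)
qed

lemma nodal_interp:
  assumes "N \<ge> 1" "c N = c 0" "j \<le> N"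
  shows "nodal N (interp N c) j = c j"
  using nodal_eq[of "interp N c" j N] interp_node[OF assms(1)] interp_V_h[OF assms(1,2)] assms
  by (simp add: V_h_def)

lemma tension_V_h:
  assumes "v \<in> V_h N" "N \<ge> 1"
  shows "tension \<sigma> v = \<sigma> * ((\<Sum>j=1..N. sqrt (1 + (slope N v j)\<^sup>2)) / real N)"
    "tension \<sigma> v = \<sigma> * integral {0..1} (\<lambda>x. sqrt (1 + (step N (slope N v) x)\<^sup>2))"
proof -
  show 2: "tension \<sigma> v = \<sigma> * integral {0..1} (\<lambda>x. sqrt (1 + (step N (slope N v) x)\<^sup>2))"
    by (rule tension_primitive[OF V_h_primitive[OF assms] step_square_integrable[OF assms(2)]])
  show "tension \<sigma> v = \<sigma> * ((\<Sum>j=1..N. sqrt (1 + (slope N v j)\<^sup>2)) / real N)"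
    unfolding 2 using step_integral[OF assms(2), of "\<lambda>j. sqrt (1 + (slope N v j)\<^sup>2)"]
    by (simp add: step_def[abs_def])
qed

lemma step_AE_bound:
  assumes "N \<ge> 1" "\<And>j. 1 \<le> j \<Longrightarrow> j \<le> N \<Longrightarrow> \<bar>c j\<bar> \<le> m"
  shows "AE x in unit_meas. \<bar>step N c x\<bar> \<le> m"
  unfolding AE_unit_iff
proof (rule negligible_subset[OF negligible_empty])
  have "\<bar>step N c x\<bar> \<le> m" if "x \<in> {0<..<1}" for x
    using step_cases[OF assms(1), of x] assms(2) that by (metis greaterThanLessThan_iff less_eq_real_def)
  then show "{x \<in> {0<..<1}. \<not> \<bar>step N c x\<bar> \<le> m} \<subseteq> {}" by blast
qed

lemma V_h_H1_per: "v \<in> V_h N \<Longrightarrow> N \<ge> 1 \<Longrightarrow> v \<in> H1_per"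
  by (rule H1_perI[OF V_h_primitive step_square_integrable]) (auto simp: V_h_def)

lemma V_h_seminorm_le:
  assumes "v \<in> V_h N" "N \<ge> 1" "\<And>j. 1 \<le> j \<Longrightarrow> j \<le> N \<Longrightarrow> \<bar>slope N v j\<bar> \<le> m"
  shows "W1inf_seminorm v \<le> ereal m"
  by (rule W1inf_seminorm_le[OF V_h_primitive[OF assms(1,2)] step_square_integrable[OF assms(2)]
        step_AE_bound[OF assms(2,3)]])

lemma bending_h_eq:
  "bending_h C N v = C / 2 * (\<Sum>j=1..N. bend_term (1 / real N) (slope N v j) (slope N v (j + 1)))"
  unfolding bending_h_def angle_def arccos_eq_arctan_diff bend_term_def bend_coeff_def seg_def by simp

lemma seg_pos: "N \<ge> 1 \<Longrightarrow> seg N v j > 0"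
  by (simp add: seg_def add_pos_nonneg)

lemma bending_h_nonneg: "C > 0 \<Longrightarrow> N \<ge> 1 \<Longrightarrow> bending_h C N v \<ge> 0"
  unfolding bending_h_eq bend_term_def
  by (intro mult_nonneg_nonneg sum_nonneg bend_coeff_nonneg) (auto intro!: mult_pos_pos simp: add_pos_nonneg)

lemma tension_ge: "v \<in> V_h N \<Longrightarrow> N \<ge> 1 \<Longrightarrow> \<sigma> > 0 \<Longrightarrow> tension \<sigma> v \<ge> \<sigma>"
proof -
  assume a: "v \<in> V_h N" "N \<ge> 1" "\<sigma> > 0"
  have "(\<Sum>j=1..N. 1::real) \<le> (\<Sum>j=1..N. sqrt (1 + (slope N v j)\<^sup>2))"
    by (intro sum_mono) simp
  then have "1 \<le> (\<Sum>j=1..N. sqrt (1 + (slope N v j)\<^sup>2)) / real N" using a by (simp add: field_simps)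
  then show ?thesis unfolding tension_V_h[OF a(1,2)] using a(3) mult_left_mono[of 1 _ \<sigma>] by fastforce
qed

lemma sum_cyclic_shift:
  fixes f :: "nat \<Rightarrow> real"
  assumes "f (N + 1) = f 1" "N \<ge> 1"
  shows "(\<Sum>j=1..N. f (j + 1)) = (\<Sum>j=1..N. f j)"
proof -
  have "(\<Sum>j=1..N. f (j + 1)) = (\<Sum>j=Suc 1..Suc N. f j)"
    unfolding sum.shift_bounds_cl_Suc_ivl by simp
  also have "\<dots> = (\<Sum>j=1..N. f j) + f (N + 1) - f 1"
    using assms(2) by (simp add: sum.atLeast_Suc_atMost)
  finally show ?thesis using assms(1) by simp
qed

lemma sum_cyclic_shift_down:
  fixes f :: "nat \<Rightarrow> real"
  assumes "f 0 = f N"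
  shows "(\<Sum>j=1..N. f (j - 1)) = (\<Sum>j=1..N. f j)"
proof (cases N)
  case (Suc n)
  have "(\<Sum>j=1..N. f (j - 1)) = (\<Sum>j=0..n. f j)"
    unfolding Suc One_nat_def sum.shift_bounds_cl_Suc_ivl by simp
  also have "\<dots> = f 0 + (\<Sum>j=1..n. f j)" by (simp add: sum.atLeast_Suc_atMost)
  finally show ?thesis using assms Suc by simp
qed simp

lemma sum_abs_diff_ge:
  fixes a :: "nat \<Rightarrow> real"
  assumes "1 \<le> i" "i \<le> k" "k \<le> N"
  shows "\<bar>a k - a i\<bar> \<le> (\<Sum>j=1..N. \<bar>a (j + 1) - a j\<bar>)"
proof -
  have "\<bar>a k - a i\<bar> \<le> (\<Sum>j=i..<k. \<bar>a (j + 1) - a j\<bar>)"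
    using assms(2)
  proof (induction k rule: dec_induct)
    case (step n)
    then show ?case by simp
  qed simp
  also have "\<dots> \<le> (\<Sum>j=1..N. \<bar>a (j + 1) - a j\<bar>)"
    using assms by (intro sum_mono2) auto
  finally show ?thesis .
qed

text \<open>The slopes sum to zero, so some slope does not have the sign of the given one. The inclination angle
  therefore varies by at least \<open>|arctan (slope N v j)|\<close> along the graph, and each change of
  angle is paid for by \<open>turning_le_energy\<close>.\<close>

lemma turning_bound:
  assumes v: "v \<in> V_h N" and N: "N \<ge> 1" and j: "1 \<le> j" "j \<le> N" and C: "C > 0" "\<sigma> > 0"
  shows "sqrt (2 * C * \<sigma>) * \<bar>arctan (slope N v j)\<bar> \<le> bending_h C N v + tension \<sigma> v"
proof -
  define d where "d = slope N v"
  define \<Theta> where "\<Theta> = (\<Sum>j=1..N. \<bar>arctan (d (j + 1)) - arctan (d j)\<bar>)"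
  have per: "v 0 = v 1" using v by (simp add: V_h_def)
  have sum0: "(\<Sum>j=1..N. d j) = 0"
  proof -
    have "(\<Sum>j=1..k. d j) = (nodal N v k - nodal N v 0) * real N" for k
      by (induction k) (auto simp: d_def slope_eq algebra_simps)
    from this[of N] show ?thesis using nodal_eq[OF per _ N, of N] nodal_eq[OF per _ N, of 0] per N by simp
  qed
  have diff: "\<bar>arctan (d i) - arctan (d k)\<bar> \<le> \<Theta>" if "1 \<le> i" "i \<le> N" "1 \<le> k" "k \<le> N" for i k
  proof (cases "i \<le> k")
    case True
    then show ?thesis unfolding \<Theta>_def
      using sum_abs_diff_ge[of i k N "\<lambda>j. arctan (d j)"] that by (simp add: abs_minus_commute)
  next
    case False
    then show ?thesis unfolding \<Theta>_def
      using sum_abs_diff_ge[of k i N "\<lambda>j. arctan (d j)"] that by simp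
  qed
  have "\<bar>arctan (d j)\<bar> \<le> \<Theta>"
  proof (cases "d j \<ge> 0")
    case True
    have "\<exists>i\<in>{1..N}. d i \<le> 0"
    proof (rule ccontr)
      assume "\<not> ?thesis"
      then have "0 < (\<Sum>j=1..N. d j)" using N by (intro sum_pos) (auto simp: not_le)
      then show False using sum0 by simp
    qed
    then obtain i where i: "1 \<le> i" "i \<le> N" "arctan (d i) \<le> 0" by auto
    have "arctan (d j) \<ge> 0" using True by simp
    then show ?thesis using diff[OF j i(1,2)] i(3) by linarith
  next
    case False
    have "\<exists>i\<in>{1..N}. d i \<ge> 0"
    proof (rule ccontr)
      assume "\<not> ?thesis"
      then have "(\<Sum>j=1..N. d j) < (\<Sum>j=1..N. 0)" using N by (intro sum_strict_mono) (auto simp: not_le)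
      then show False using sum0 by simp
    qed
    then obtain i where i: "1 \<le> i" "i \<le> N" "arctan (d i) \<ge> 0" by auto
    have "arctan (d j) < 0" using False by simp
    then show ?thesis using diff[OF j i(1,2)] i(3) by linarith
  qed
  then have "sqrt (2 * C * \<sigma>) * \<bar>arctan (d j)\<bar> \<le> sqrt (2 * C * \<sigma>) * \<Theta>"
    using C by (intro mult_left_mono) auto
  also have "\<dots> = (\<Sum>j=1..N. sqrt (2 * C * \<sigma>) * \<bar>arctan (d (j + 1)) - arctan (d j)\<bar>)"
    by (simp add: \<Theta>_def sum_distrib_left)
  also have "\<dots> \<le> (\<Sum>j=1..N. C / 2 * ((arctan (d (j + 1)) - arctan (d j))\<^sup>2 *
      bend_coeff (seg N v j) (seg N v (j + 1))) + \<sigma> * (seg N v j + seg N v (j + 1)))"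
  proof (intro sum_mono)
    fix j
    let ?\<theta> = "\<bar>arctan (d (j + 1)) - arctan (d j)\<bar>" and ?L = "seg N v j + seg N v (j + 1)"
    have L: "?L > 0" using seg_pos[OF N, of v j] seg_pos[OF N, of v "j + 1"] by simp
    have "sqrt (2 * C * \<sigma>) * ?\<theta> \<le> C / 2 * (?\<theta>\<^sup>2 * (1 / ?L)) + \<sigma> * ?L"
      by (rule turning_le_energy[OF C L])
    also have "\<dots> \<le> C / 2 * (?\<theta>\<^sup>2 * bend_coeff (seg N v j) (seg N v (j + 1))) + \<sigma> * ?L"
      using C by (intro add_right_mono mult_left_mono bend_coeff_ge seg_pos N) auto
    finally show "sqrt (2 * C * \<sigma>) * ?\<theta> \<le> C / 2 * ((arctan (d (j + 1)) - arctan (d j))\<^sup>2 *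
      bend_coeff (seg N v j) (seg N v (j + 1))) + \<sigma> * ?L" by simp
  qed
  also have "\<dots> = bending_h C N v + \<sigma> * ((\<Sum>j=1..N. seg N v j) + (\<Sum>j=1..N. seg N v (j + 1)))"
  proof -
    have lin: "(\<Sum>j=1..N. C / 2 * f j + \<sigma> * (a j + b j)) =
        C / 2 * (\<Sum>j=1..N. f j) + \<sigma> * ((\<Sum>j=1..N. a j) + (\<Sum>j=1..N. b j))" for f a b :: "nat \<Rightarrow> real"
      by (simp only: sum.distrib sum_distrib_left[symmetric])
    show ?thesis unfolding lin by (simp only: bending_h_eq bend_term_def d_def seg_def)
  qed
  also have "(\<Sum>j=1..N. seg N v (j + 1)) = (\<Sum>j=1..N. seg N v j)"
    using slope_wrap[of N v] N by (intro sum_cyclic_shift) (simp_all add: seg_def)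
  also have "\<sigma> * ((\<Sum>j=1..N. seg N v j) + (\<Sum>j=1..N. seg N v j)) = tension \<sigma> v"
    unfolding tension_V_h(1)[OF v N] seg_def by (simp add: sum_distrib_left[symmetric] sum_divide_distrib[symmetric])
  finally show ?thesis by (simp add: d_def)
qed

section \<open>The slope bound for discrete near-minimizers\<close>

lemma smooth_periodicD:
  assumes "smooth_periodic \<psi>"
  shows "is_primitive \<psi> (deriv \<psi>)" "is_primitive (deriv \<psi>) (deriv (deriv \<psi>))"
    "\<psi> 0 = \<psi> 1" "deriv \<psi> 0 = deriv \<psi> 1"
    "continuous_on S \<psi>" "continuous_on S (deriv \<psi>)" "continuous_on S (deriv (deriv \<psi>))"
proof -
  have d: "((deriv ^^ n) \<psi> has_real_derivative deriv ((deriv ^^ n) \<psi>) x) (at x)" for n x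
    using assms unfolding smooth_periodic_def
    by (metis DERIV_deriv_iff_real_differentiable UNIV_I differentiable_on_def)
  have c: "continuous_on S ((deriv ^^ n) \<psi>)" for n S
    using d by (meson DERIV_continuous_on has_field_derivative_at_within)
  show "continuous_on S \<psi>" "continuous_on S (deriv \<psi>)" "continuous_on S (deriv (deriv \<psi>))" for S
    using c[of S 0] c[of S 1] c[of S 2] by (simp_all add: numeral_2_eq_2)
  show "is_primitive \<psi> (deriv \<psi>)"
    using d[of 0] c[of UNIV 1] by (intro primitive_C1) auto
  show "is_primitive (deriv \<psi>) (deriv (deriv \<psi>))"
    using d[of 1] c[of UNIV 2] by (intro primitive_C1) (auto simp: numeral_2_eq_2)
  have per: "\<psi> (x + 1) = \<psi> x" for x using assms by (simp add: smooth_periodic_def)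
  show "\<psi> 0 = \<psi> 1" using per[of 0] by simp
  have "(\<psi> has_real_derivative deriv \<psi> (0 + 1)) (at (0 + 1))" using d[of 0 "0 + 1"] by simp
  then have "((\<lambda>x. \<psi> (x + 1)) has_real_derivative deriv \<psi> (0 + 1)) (at 0)"
    by (subst (asm) DERIV_shift)
  then have "(\<psi> has_real_derivative deriv \<psi> (0 + 1)) (at 0)" by (simp add: per)
  then show "deriv \<psi> 0 = deriv \<psi> 1" by (simp add: DERIV_imp_deriv)
qed

text \<open>Let \<open>d\<close> be the slope of the chord. The inequality \<open>1 + d * y \<le> sqrt (1 +
  d\<^sup>2) * sqrt (1 + y\<^sup>2)\<close> is integrated with \<open>y = g x\<close>.\<close>

lemma chord_le_arc:
  assumes u: "is_primitive u g" and g: "square_integrable g" and N: "N \<ge> 1" and j: "1 \<le> j" "j \<le> N"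
  shows "1 / real N * sqrt (1 + ((u (real j / real N) - u (real (j - 1) / real N)) * real N)\<^sup>2)
      \<le> integral (cell N j) (\<lambda>x. sqrt (1 + (g x)\<^sup>2))"
proof -
  define a b d where "a = real (j - 1) / real N" and "b = real j / real N" and "d = (u b - u a) * real N"
  have ab: "0 \<le> a" "a \<le> b" "b \<le> 1" "cell N j = {a..b}" "b - a = 1 / real N"
    using N j by (auto simp: a_def b_def cell_def of_nat_diff field_simps)
  have s: "sqrt (1 + d\<^sup>2) > 0" by (simp add: add_pos_nonneg)
  have gi: "g integrable_on {a..b}" "(\<lambda>x. sqrt (1 + (g x)\<^sup>2)) integrable_on {a..b}"
    using ab by (auto intro!: abs_int_sub(2)[OF square_integrable_imp(1)[OF g]] abs_int_sub(2)[OF sqrt_abs_int[OF g]])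
  have di: "(\<lambda>x. 1 + d * g x) integrable_on {a..b}"
    using gi by (intro integrable_add integrable_cmult_real) auto
  have "sqrt (1 + d\<^sup>2) * (1 / real N * sqrt (1 + d\<^sup>2)) = 1 / real N * (1 + d\<^sup>2)"
    by simp
  also have "\<dots> = integral {a..b} (\<lambda>x. 1 + d * g x)"
  proof -
    have "integral {a..b} (\<lambda>x. 1 + d * g x) = (b - a) + d * integral {a..b} g"
      using gi ab(2) by (subst integral_add) (auto intro: integrable_cmult_real)
    also have "integral {a..b} g = d / real N"
      using primitive_diff[OF u ab(1-3)] N by (simp add: d_def)
    finally show ?thesis using ab(5) by (simp add: power2_eq_square add_divide_distrib)
  qed
  also have "\<dots> \<le> integral {a..b} (\<lambda>x. sqrt (1 + d\<^sup>2) * sqrt (1 + (g x)\<^sup>2))"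
  proof (rule integral_le[OF di])
    show "(\<lambda>x. sqrt (1 + d\<^sup>2) * sqrt (1 + (g x)\<^sup>2)) integrable_on {a..b}"
      using gi by (intro integrable_cmult_real)
    fix x
    have "(1 + d * g x)\<^sup>2 \<le> (1 + d\<^sup>2) * (1 + (g x)\<^sup>2)"
      using zero_le_power2[of "d - g x"] by (simp add: power2_eq_square algebra_simps)
    then show "1 + d * g x \<le> sqrt (1 + d\<^sup>2) * sqrt (1 + (g x)\<^sup>2)"
      unfolding real_sqrt_mult[symmetric] by (rule real_le_rsqrt)
  qed
  also have "\<dots> = sqrt (1 + d\<^sup>2) * integral {a..b} (\<lambda>x. sqrt (1 + (g x)\<^sup>2))" by simp
  finally have "1 / real N * sqrt (1 + d\<^sup>2) \<le> integral {a..b} (\<lambda>x. sqrt (1 + (g x)\<^sup>2))"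
    using s by (rule mult_left_le_imp_le)
  then show ?thesis unfolding ab(4) unfolding d_def a_def b_def .
qed

lemma inscribed_polygon_length:
  assumes u: "is_primitive u g" and g: "square_integrable g" and N: "N \<ge> 1" and per: "u 0 = u 1"
  shows "(\<Sum>j=1..N. 1 / real N * sqrt (1 + (slope N u j)\<^sup>2)) \<le> integral {0..1} (\<lambda>x. sqrt (1 + (g x)\<^sup>2))"
proof -
  have "(\<Sum>j=1..N. 1 / real N * sqrt (1 + (slope N u j)\<^sup>2))
      \<le> (\<Sum>j=1..N. integral (cell N j) (\<lambda>x. sqrt (1 + (g x)\<^sup>2)))"
  proof (intro sum_mono)
    fix j assume j: "j \<in> {1..N}"
    have "slope N u j = (u (real j / real N) - u (real (j - 1) / real N)) * real N"
    proof -
      have "j \<le> N" "j - 1 \<le> N" using j by auto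
      then show ?thesis unfolding slope_eq by (simp only: nodal_eq[OF per _ N])
    qed
    then show "1 / real N * sqrt (1 + (slope N u j)\<^sup>2) \<le> integral (cell N j) (\<lambda>x. sqrt (1 + (g x)\<^sup>2))"
      using chord_le_arc[OF u g N] j by simp
  qed
  also have "\<dots> = integral {0..1} (\<lambda>x. sqrt (1 + (g x)\<^sup>2))"
    using integral_cells[OF N abs_intD(1)[OF sqrt_abs_int[OF g]]] by simp
  finally show ?thesis .
qed

lemma cutoffD:
  assumes "cutoff \<zeta>"
  shows "0 \<le> \<zeta> t" "\<zeta> t \<le> 1" "\<zeta> 0 = 1" "\<bar>t\<bar> > 1 \<Longrightarrow> \<zeta> t = 0"
proof -
  show "0 \<le> \<zeta> t" "\<zeta> t \<le> 1" "\<zeta> 0 = 1" using assms by (auto simp: cutoff_def)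
  assume "\<bar>t\<bar> > 1"
  moreover have "\<zeta> \<bar>t\<bar> = \<zeta> t" using assms by (cases "t \<ge> 0") (auto simp: cutoff_def)
  ultimately show "\<zeta> t = 0" using assms by (metis cutoff_def)
qed

lemma cutoff_node_close:
  assumes "cutoff \<zeta>" "\<delta> > 0" "cutoff_node \<zeta> \<psi> N \<delta> v j \<noteq> 0"
  shows "\<bar>nodal N v j - nodal N \<psi> j\<bar> \<le> \<delta>"
proof (rule ccontr)
  assume "\<not> ?thesis"
  then have "\<bar>(nodal N v j - nodal N \<psi> j) / \<delta>\<bar> > 1" using assms(2) by simp
  then show False using cutoffD(4)[OF assms(1)] assms(3) unfolding cutoff_node_def by blast
qed

lemma cutoff_product:
  assumes "cutoff \<zeta>"
  shows "0 \<le> cutoff_node \<zeta> \<psi> N \<delta> v i * cutoff_node \<zeta> \<psi> N \<delta> v j"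
    "cutoff_node \<zeta> \<psi> N \<delta> v i * cutoff_node \<zeta> \<psi> N \<delta> v j \<le> 1"
  using cutoffD(1,2)[OF assms] unfolding cutoff_node_def
  by (auto intro!: mult_nonneg_nonneg mult_le_one)

lemma adhesion_h_nonneg:
  assumes "cutoff \<zeta>" "\<gamma> > 0" "N \<ge> 1"
  shows "adhesion_h \<gamma> \<zeta> \<psi> N \<delta> v \<ge> 0"
  unfolding adhesion_h_def using assms(2) less_imp_le[OF seg_pos[OF assms(3)]]
  by (intro mult_nonneg_nonneg sum_nonneg cutoff_product(1)[OF assms(1)]) auto

text \<open>A segment contributes only if both of its nodes are within \<open>\<delta>\<close> of the obstacle. Its
  slope then differs from the slope of the corresponding chord of \<open>\<psi>\<close> by at most
  \<open>2 * \<delta> * N\<close>, and the chords are not longer than the graph of \<open>\<psi>\<close>.\<close>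

lemma adhesion_h_le:
  assumes \<zeta>: "cutoff \<zeta>" and \<gamma>: "\<gamma> > 0" and \<sigma>: "\<sigma> > 0" and \<psi>: "smooth_periodic \<psi>"
    and N: "N \<ge> 1" and \<delta>: "\<delta> > 0"
  shows "adhesion_h \<gamma> \<zeta> \<psi> N \<delta> v \<le> \<gamma> * (tension \<sigma> \<psi> / \<sigma> + 2 * \<delta> * real N)"
proof -
  note P = smooth_periodicD[OF \<psi>]
  have sq: "square_integrable (deriv \<psi>)" by (rule continuous_square_integrable[OF P(6)])
  have "(\<Sum>j=1..N. cutoff_node \<zeta> \<psi> N \<delta> v (j - 1) * cutoff_node \<zeta> \<psi> N \<delta> v j * (2 * seg N v j))
      \<le> (\<Sum>j=1..N. 1 / real N * sqrt (1 + (slope N \<psi> j)\<^sup>2) + 2 * \<delta>)"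
  proof (intro sum_mono)
    fix j
    let ?c = "cutoff_node \<zeta> \<psi> N \<delta> v (j - 1) * cutoff_node \<zeta> \<psi> N \<delta> v j"
    let ?R = "1 / real N * sqrt (1 + (slope N \<psi> j)\<^sup>2) + 2 * \<delta>"
    have R: "?R \<ge> 0" using \<delta> by (auto intro!: add_nonneg_nonneg)
    show "?c * (2 * seg N v j) \<le> ?R"
    proof (cases "?c = 0")
      case False
      then have c: "\<bar>nodal N v j - nodal N \<psi> j\<bar> \<le> \<delta>" "\<bar>nodal N v (j - 1) - nodal N \<psi> (j - 1)\<bar> \<le> \<delta>"
        using cutoff_node_close[OF \<zeta> \<delta>] by auto
      have "slope N v j - slope N \<psi> j =
          ((nodal N v j - nodal N \<psi> j) - (nodal N v (j - 1) - nodal N \<psi> (j - 1))) * real N"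
        by (simp add: slope_eq algebra_simps)
      moreover have "\<bar>(nodal N v j - nodal N \<psi> j) - (nodal N v (j - 1) - nodal N \<psi> (j - 1))\<bar> \<le> 2 * \<delta>"
        using c by linarith
      ultimately have "\<bar>slope N v j - slope N \<psi> j\<bar> \<le> 2 * \<delta> * real N"
        by (simp add: abs_mult mult_right_mono)
      then have "sqrt (1 + (slope N v j)\<^sup>2) \<le> sqrt (1 + (slope N \<psi> j)\<^sup>2) + 2 * \<delta> * real N"
        using sqrt_sq_diff[of "slope N v j" "slope N \<psi> j"] by linarith
      then have "2 * seg N v j \<le> 1 / real N * (sqrt (1 + (slope N \<psi> j)\<^sup>2) + 2 * \<delta> * real N)"
        unfolding seg_def by (simp add: divide_right_mono)
      also have "\<dots> = ?R" using N by (simp add: field_simps)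
      finally have "2 * seg N v j \<le> ?R" .
      moreover have "?c * (2 * seg N v j) \<le> 1 * (2 * seg N v j)"
        using cutoff_product(2)[OF \<zeta>] seg_pos[OF N, of v j] by (intro mult_right_mono) auto
      ultimately show ?thesis by simp
    next
      case True
      then show ?thesis using R by (simp only: mult_zero_left)
    qed
  qed
  also have "\<dots> = (\<Sum>j=1..N. 1 / real N * sqrt (1 + (slope N \<psi> j)\<^sup>2)) + 2 * \<delta> * real N"
    by (simp add: sum.distrib)
  also have "\<dots> \<le> integral {0..1} (\<lambda>x. sqrt (1 + (deriv \<psi> x)\<^sup>2)) + 2 * \<delta> * real N"
    using inscribed_polygon_length[OF P(1) sq N P(3)] by simp
  also have "integral {0..1} (\<lambda>x. sqrt (1 + (deriv \<psi> x)\<^sup>2)) = tension \<sigma> \<psi> / \<sigma>"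
    using \<sigma> by (simp add: tension_primitive[OF P(1) sq])
  finally show ?thesis unfolding adhesion_h_def using \<gamma> by (intro mult_left_mono) auto
qed

definition energy_real ::
    "real \<Rightarrow> real \<Rightarrow> real \<Rightarrow> (real \<Rightarrow> real) \<Rightarrow> (real \<Rightarrow> real) \<Rightarrow> nat \<Rightarrow> real \<Rightarrow> real \<Rightarrow> (real \<Rightarrow> real) \<Rightarrow> real" where
  "energy_real C \<sigma> \<gamma> \<psi> \<zeta> N \<delta> \<rho> v =
     bending_h C N v + tension \<sigma> v - adhesion_h \<gamma> \<zeta> \<psi> N \<delta> v + penalty_h \<psi> N \<rho> v"

text \<open>The discrete minimizers have \<open>e = 0\<close>. For \<open>e > 0\<close> such functions exist because
  the energy is bounded below.\<close>

definition near_minimizer ::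
    "real \<Rightarrow> real \<Rightarrow> real \<Rightarrow> (real \<Rightarrow> real) \<Rightarrow> (real \<Rightarrow> real) \<Rightarrow> real \<Rightarrow> nat \<Rightarrow> real \<Rightarrow> real \<Rightarrow> real \<Rightarrow> (real \<Rightarrow> real) \<Rightarrow> bool" where
  "near_minimizer C \<sigma> \<gamma> \<psi> \<zeta> S N \<delta> \<rho> e v \<longleftrightarrow> v \<in> V_h N \<and> v \<in> X_ball S \<and>
     (\<forall>w. w \<in> V_h N \<longrightarrow> w \<in> X_ball S \<longrightarrow> energy_real C \<sigma> \<gamma> \<psi> \<zeta> N \<delta> \<rho> v \<le> energy_real C \<sigma> \<gamma> \<psi> \<zeta> N \<delta> \<rho> w + e)"

lemma discrete_minimizer_near:
  assumes "discrete_minimizer C \<sigma> \<gamma> \<psi> \<zeta> S N \<delta> \<rho> v"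
  shows "near_minimizer C \<sigma> \<gamma> \<psi> \<zeta> S N \<delta> \<rho> 0 v"
  using assms unfolding discrete_minimizer_def near_minimizer_def is_arg_min_def energy_h_def energy_real_def
  by (auto simp: not_less split: if_splits)

lemma penalty_h_nonneg: "\<rho> > 0 \<Longrightarrow> penalty_h \<psi> N \<rho> v \<ge> 0"
  unfolding penalty_h_def by (intro mult_nonneg_nonneg sum_nonneg) auto

lemma const_V_h: "(\<lambda>_. m) \<in> V_h N"
proof -
  have "\<exists>a b. \<forall>x\<in>I. m = a + b * x" for I :: "real set"
    by (intro exI[of _ m] exI[of _ 0]) simp
  then show ?thesis by (simp add: V_h_def)
qed

lemma const_X_ball:
  assumes "\<bar>m\<bar> \<le> S"
  shows "(\<lambda>_. m) \<in> X_ball S"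
proof (rule X_ballI[of _ "\<bar>m\<bar>" 0])
  have p: "is_primitive (\<lambda>_. m) (\<lambda>_. 0)" by (rule primitiveI) auto
  have s: "square_integrable (\<lambda>_. 0)" by (rule continuous_square_integrable) auto
  show "(\<lambda>_. m) \<in> H1_per" by (rule H1_perI[OF p s]) simp
  show "Linf_norm (\<lambda>_. m) \<le> ereal \<bar>m\<bar>" by (rule Linf_norm_continuous_le) auto
  show "W1inf_seminorm (\<lambda>_. m) \<le> ereal 0" by (rule W1inf_seminorm_le[OF p s]) auto
qed (use assms in simp)

lemma const_energy_le:
  assumes "cutoff \<zeta>" "\<gamma> > 0" "N \<ge> 1"
  shows "energy_real C \<sigma> \<gamma> \<psi> \<zeta> N \<delta> \<rho> (\<lambda>_. m) \<le> \<sigma> + penalty_h \<psi> N \<rho> (\<lambda>_. m)"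
proof -
  have 0: "slope N (\<lambda>_. m) j = 0" for j by (simp add: slope_def nodal_def)
  have "bending_h C N (\<lambda>_. m) = 0" unfolding bending_h_eq bend_term_def 0 by simp
  moreover have "tension \<sigma> (\<lambda>_. m) = \<sigma>"
    unfolding tension_V_h(1)[OF const_V_h assms(3)] 0 using assms(3) by simp
  ultimately show ?thesis
    unfolding energy_real_def using adhesion_h_nonneg[OF assms] by simp
qed

text \<open>The comparison function is the constant \<open>max v\<close>. It belongs to \<open>X_ball S\<close>
  because \<open>|max v|\<close> is at most the norm of \<open>v\<close>, its bending is zero and its
  tension is \<open>\<sigma>\<close>. Raising the nodal values does not increase the penalty, so the
  penalty of \<open>v\<close> drops out.\<close>

lemma near_minimizer_bound:
  assumes \<zeta>: "cutoff \<zeta>" and pos: "\<gamma> > 0" "\<sigma> > 0" "\<rho> > 0" "\<delta> > 0" and \<psi>: "smooth_periodic \<psi>"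
    and N: "N \<ge> 1" and nm: "near_minimizer C \<sigma> \<gamma> \<psi> \<zeta> S N \<delta> \<rho> e v"
  shows "bending_h C N v + tension \<sigma> v \<le> \<sigma> + \<gamma> * (tension \<sigma> \<psi> / \<sigma> + 2 * \<delta> * real N) + e"
proof -
  have v: "v \<in> V_h N" "v \<in> X_ball S"
    and min: "\<And>w. \<lbrakk>w \<in> V_h N; w \<in> X_ball S\<rbrakk> \<Longrightarrow>
        energy_real C \<sigma> \<gamma> \<psi> \<zeta> N \<delta> \<rho> v \<le> energy_real C \<sigma> \<gamma> \<psi> \<zeta> N \<delta> \<rho> w + e"
    using nm unfolding near_minimizer_def by auto
  have vc: "continuous_on {0..1} v" using v(1) by (simp add: V_h_def)
  obtain x0 where x0: "x0 \<in> {0..1}" "\<And>x. x \<in> {0..1} \<Longrightarrow> v x \<le> v x0"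
    using continuous_attains_sup[OF _ _ vc] by auto
  define w where "w = (\<lambda>_::real. v x0)"
  have w: "w \<in> V_h N" "w \<in> X_ball S"
    unfolding w_def using const_V_h const_X_ball[OF X_ball_bound[OF v(2) x0(1)]] by auto
  have "penalty_h \<psi> N \<rho> w \<le> penalty_h \<psi> N \<rho> v"
    unfolding penalty_h_def
  proof (intro mult_left_mono sum_mono mult_right_mono power_mono)
    fix j
    have "nodal N v j \<le> nodal N w j"
      unfolding nodal_def w_def using N by (intro x0) (auto simp: divide_le_eq_1 less_imp_le)
    then show "\<bar>max 0 (- (nodal N w j - nodal N \<psi> j))\<bar> \<le> \<bar>max 0 (- (nodal N v j - nodal N \<psi> j))\<bar>"
      by auto
  qed (use pos in auto)
  moreover have "energy_real C \<sigma> \<gamma> \<psi> \<zeta> N \<delta> \<rho> w \<le> \<sigma> + penalty_h \<psi> N \<rho> w"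
    unfolding w_def by (rule const_energy_le[OF \<zeta> pos(1) N])
  ultimately have "bending_h C N v + tension \<sigma> v \<le> \<sigma> + adhesion_h \<gamma> \<zeta> \<psi> N \<delta> v + e"
    using min[OF w] unfolding energy_real_def by linarith
  then show ?thesis using adhesion_h_le[OF \<zeta> pos(1,2) \<psi> N pos(4), of v] by linarith
qed

text \<open>The energy bound is inserted into the turning bound. The coefficient 4 of \<open>\<gamma>\<close> in the
  hypothesis leaves room for the error \<open>e\<close>.\<close>

lemma near_minimizer_slope:
  assumes \<zeta>: "cutoff \<zeta>" and pos: "C > 0" "\<gamma> > 0" "\<sigma> > 0" "\<rho> > 0" "\<delta> > 0" and \<psi>: "smooth_periodic \<psi>"
    and N: "N \<ge> 1" and nm: "near_minimizer C \<sigma> \<gamma> \<psi> \<zeta> S N \<delta> \<rho> e v"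
    and c0: "c\<^sub>0 > 0" "\<delta> \<le> c\<^sub>0 * (1 / real N)" "e \<le> 2 * \<gamma> * c\<^sub>0"
    and \<phi>: "0 < \<phi>\<^sub>0" "\<phi>\<^sub>0 < pi / 2"
    and cond: "1 / sqrt (2 * C * \<sigma>) * (\<sigma> + 4 * \<gamma> * (tension \<sigma> \<psi> / \<sigma> + c\<^sub>0))
         + arctan (real_of_ereal (W1inf_seminorm \<psi>) + 2 * c\<^sub>0) \<le> \<phi>\<^sub>0"
    and j: "1 \<le> j" "j \<le> N"
  shows "\<bar>slope N v j\<bar> \<le> tan \<phi>\<^sub>0"
proof -
  note P = smooth_periodicD[OF \<psi>]
  have sq: "square_integrable (deriv \<psi>)" by (rule continuous_square_integrable[OF P(6)])
  have T: "tension \<sigma> \<psi> / \<sigma> \<ge> 0"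
    unfolding tension_primitive[OF P(1) sq] using pos(3) abs_intD(1)[OF sqrt_abs_int[OF sq]]
    by (simp add: integral_nonneg)
  have v: "v \<in> V_h N" using nm by (simp add: near_minimizer_def)
  have s: "sqrt (2 * C * \<sigma>) > 0" using pos by simp
  have "sqrt (2 * C * \<sigma>) * \<bar>arctan (slope N v j)\<bar> \<le> \<sigma> + \<gamma> * (tension \<sigma> \<psi> / \<sigma> + 2 * \<delta> * real N) + e"
    using turning_bound[OF v N j pos(1,3)] near_minimizer_bound[OF \<zeta> pos(2-5) \<psi> N nm] by linarith
  also have "\<dots> \<le> \<sigma> + 4 * \<gamma> * (tension \<sigma> \<psi> / \<sigma> + c\<^sub>0)"
  proof -
    have "\<delta> * real N \<le> c\<^sub>0" using c0(2) N by (simp add: field_simps)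
    then have "\<gamma> * (\<delta> * real N) \<le> \<gamma> * c\<^sub>0" using pos by (intro mult_left_mono) auto
    moreover define t where "t = tension \<sigma> \<psi> / \<sigma>"
    have "0 \<le> \<gamma> * t" using T pos unfolding t_def by (intro mult_nonneg_nonneg) auto
    ultimately show ?thesis
      using c0(3) unfolding t_def[symmetric] distrib_left by (simp add: mult.assoc mult.left_commute[of \<gamma>])
  qed
  finally have "\<bar>arctan (slope N v j)\<bar> \<le> 1 / sqrt (2 * C * \<sigma>) * (\<sigma> + 4 * \<gamma> * (tension \<sigma> \<psi> / \<sigma> + c\<^sub>0))"
    using s by (simp add: field_simps)
  also have "\<dots> \<le> \<phi>\<^sub>0"
  proof -
    have "0 \<le> real_of_ereal (W1inf_seminorm \<psi>)"
      unfolding W1inf_seminorm_def by (rule real_of_ereal_pos[OF Linf_norm_nonneg])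
    then have "0 \<le> arctan (real_of_ereal (W1inf_seminorm \<psi>) + 2 * c\<^sub>0)" using c0 by simp
    then show ?thesis using cond by linarith
  qed
  finally have "\<bar>arctan (slope N v j)\<bar> \<le> \<phi>\<^sub>0" .
  then show ?thesis using \<phi> by (intro abs_le_tan) auto
qed

section \<open>Recovery sequences\<close>

lemma primitive_affine: "is_primitive (\<lambda>t. a * t + b) (\<lambda>_. a)"
  by (rule primitive_C1) (auto intro!: derivative_eq_intros)

text \<open>This and the next lemma compare the mean of \<open>p\<close> over a cell with its end values. For two
  adjacent cells together, they represent a slope jump as the integral of \<open>q\<close> against a hat
  function.\<close>

lemma peano_right:
  assumes p: "is_primitive p q" and ab: "0 \<le> a" "a \<le> b" "b \<le> 1"
  shows "integral {a..b} (\<lambda>t. (t - a) * q t) = (b - a) * p b - integral {a..b} p"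
proof -
  have "is_primitive (\<lambda>t. (1 * t + - a) * p t) (\<lambda>t. (1 * t + - a) * q t + 1 * p t)"
    by (rule primitive_mult[OF primitive_affine p])
  from primitive_diff[OF this ab] have "(b - a) * p b = integral {a..b} (\<lambda>t. (t - a) * q t + p t)"
    by simp
  also have "\<dots> = integral {a..b} (\<lambda>t. (t - a) * q t) + integral {a..b} p"
  proof (rule integral_add)
    have "(\<lambda>t. (t - a) * q t) absolutely_integrable_on {0..1}"
      by (intro abs_int_mult_continuous primitive_abs_int[OF p] continuous_intros)
    then show "(\<lambda>t. (t - a) * q t) integrable_on {a..b}" by (rule abs_int_sub(2)) (use ab in auto)
    show "p integrable_on {a..b}"
      by (intro integrable_continuous_real continuous_on_subset[OF primitive_continuous[OF p]]) (use ab in auto)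
  qed
  finally show ?thesis by simp
qed

lemma peano_left:
  assumes p: "is_primitive p q" and ab: "0 \<le> a" "a \<le> b" "b \<le> 1"
  shows "integral {a..b} (\<lambda>t. (b - t) * q t) = integral {a..b} p - (b - a) * p a"
proof -
  have i: "(\<lambda>t. (t - a) * q t) integrable_on {a..b}" "q integrable_on {a..b}"
  proof -
    have "(\<lambda>t. (t - a) * q t) absolutely_integrable_on {0..1}"
      by (intro abs_int_mult_continuous primitive_abs_int[OF p] continuous_intros)
    then show "(\<lambda>t. (t - a) * q t) integrable_on {a..b}" by (rule abs_int_sub(2)) (use ab in auto)
    show "q integrable_on {a..b}" using ab by (intro abs_int_sub(2)[OF primitive_abs_int[OF p]])
  qed
  have "integral {a..b} (\<lambda>t. (b - t) * q t) = integral {a..b} (\<lambda>t. (b - a) * q t - (t - a) * q t)"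
    by (simp add: algebra_simps)
  also have "\<dots> = (b - a) * integral {a..b} q - integral {a..b} (\<lambda>t. (t - a) * q t)"
    using i by (subst integral_diff) (auto intro: integrable_cmult_real)
  also have "\<dots> = integral {a..b} p - (b - a) * p a"
    unfolding peano_right[OF p ab] primitive_diff[OF p ab, symmetric] by (simp add: algebra_simps)
  finally show ?thesis .
qed

lemma weighted_cauchy_schwarz:
  fixes k q :: "real \<Rightarrow> real"
  assumes k: "continuous_on {0..1} k" "\<And>x. x \<in> {a..b} \<Longrightarrow> 0 \<le> k x" and q: "square_integrable q"
    and ab: "0 \<le> a" "b \<le> 1" and K: "integral {a..b} k > 0"
  shows "(integral {a..b} (\<lambda>x. k x * q x))\<^sup>2 \<le> integral {a..b} k * integral {a..b} (\<lambda>x. k x * (q x)\<^sup>2)"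
proof -
  define I where "I = integral {a..b} (\<lambda>x. k x * q x)"
  define m where "m = I / integral {a..b} k"
  have i1: "(\<lambda>x. k x * q x) integrable_on {a..b}"
    using ab by (intro abs_int_sub(2)[OF abs_int_mult_continuous[OF k(1) square_integrable_imp(1)[OF q]]])
  have i2: "(\<lambda>x. k x * (q x)\<^sup>2) integrable_on {a..b}"
    using ab by (intro abs_int_sub(2)[OF abs_int_mult_continuous[OF k(1) square_integrable_imp(2)[OF q]]])
  have i3: "k integrable_on {a..b}"
    using ab by (intro integrable_continuous_real continuous_on_subset[OF k(1)]) auto
  have eq: "k x * (q x - m)\<^sup>2 = k x * (q x)\<^sup>2 - 2 * m * (k x * q x) + m\<^sup>2 * k x" for x
    by (simp add: power2_eq_square algebra_simps)
  have j1: "(\<lambda>x. 2 * m * (k x * q x)) integrable_on {a..b}" by (rule integrable_cmult_real[OF i1])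
  have j2: "(\<lambda>x. k x * (q x)\<^sup>2 - 2 * m * (k x * q x)) integrable_on {a..b}"
    by (rule integrable_diff[OF i2 j1])
  have j3: "(\<lambda>x. m\<^sup>2 * k x) integrable_on {a..b}" by (rule integrable_cmult_real[OF i3])
  have "(\<lambda>x. k x * (q x - m)\<^sup>2) integrable_on {a..b}" unfolding eq by (rule integrable_add[OF j2 j3])
  then have "0 \<le> integral {a..b} (\<lambda>x. k x * (q x - m)\<^sup>2)"
    by (rule integral_nonneg) (use k in auto)
  also have "\<dots> = integral {a..b} (\<lambda>x. k x * (q x)\<^sup>2) - 2 * m * I + m\<^sup>2 * integral {a..b} k"
    unfolding eq integral_add[OF j2 j3] integral_diff[OF i2 j1] I_def by simp
  also have "m\<^sup>2 * integral {a..b} k = m * I" using K by (simp add: m_def power2_eq_square)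
  finally have "m * I \<le> integral {a..b} (\<lambda>x. k x * (q x)\<^sup>2)" by linarith
  then have "I * I / integral {a..b} k \<le> integral {a..b} (\<lambda>x. k x * (q x)\<^sup>2)" by (simp add: m_def)
  then have "I * I \<le> integral {a..b} (\<lambda>x. k x * (q x)\<^sup>2) * integral {a..b} k"
    using K by (simp add: pos_divide_le_eq)
  then show ?thesis by (simp only: I_def power2_eq_square mult.commute)
qed

text \<open>Step functions are controlled on \<open>[0, 1)\<close>, since the point 1 belongs to none of the
  half-open cells.\<close>

lemma integral_le_Ico:
  fixes f g :: "real \<Rightarrow> real"
  assumes "f integrable_on {0..1}" "g integrable_on {0..1}" "\<And>x. 0 \<le> x \<Longrightarrow> x < 1 \<Longrightarrow> f x \<le> g x"
  shows "integral {0..1} f \<le> integral {0..1} g"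
  unfolding integral_open_interval_real
  using assms by (intro integral_le) (auto simp: integrable_on_open_interval_real)

text \<open>An admissible function \<open>w\<close> with first derivative \<open>p\<close> and second derivative
  \<open>q\<close>. Within this locale, finite element functions are constructed whose discrete energies
  are asymptotically at most the energy of \<open>w\<close>.\<close>

locale competitor =
  fixes \<psi> w p q :: "real \<Rightarrow> real"
  assumes \<psi>: "smooth_periodic \<psi>" and w: "is_primitive w p" and p: "is_primitive p q"
    and q: "square_integrable q" and w_per: "w 0 = w 1" and p_per: "p 0 = p 1"
    and above: "\<And>x. x \<in> {0..1} \<Longrightarrow> \<psi> x \<le> w x"
begin

definition z where "z = (\<lambda>x. w x - \<psi> x)"
definition z1 where "z1 = (\<lambda>x. p x - deriv \<psi> x)"
definition z2 where "z2 = (\<lambda>x. q x - deriv (deriv \<psi>) x)"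

lemmas \<psi>D = smooth_periodicD[OF \<psi>]

lemma p_cont: "continuous_on {0..1} p" by (rule primitive_continuous[OF p])
lemma w_cont: "continuous_on {0..1} w" by (rule primitive_continuous[OF w])

lemma z_prim: "is_primitive z z1"
  using primitive_lincomb[OF w \<psi>D(1), of 1 "-1"] by (simp add: z_def z1_def)

lemma z1_prim: "is_primitive z1 z2"
  using primitive_lincomb[OF p \<psi>D(2), of 1 "-1"] by (simp add: z1_def z2_def)

lemma z2_sq: "square_integrable z2"
proof (rule square_integrableI)
  show "z2 absolutely_integrable_on {0..1}" by (rule primitive_abs_int[OF z1_prim])
  have "deriv (deriv \<psi>) absolutely_integrable_on {0..1}" by (rule primitive_abs_int[OF \<psi>D(2)])
  have eq: "(z2 x)\<^sup>2 = (q x)\<^sup>2 - 2 * (deriv (deriv \<psi>) x * q x) + (deriv (deriv \<psi>) x)\<^sup>2" for x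
    by (simp add: z2_def power2_eq_square algebra_simps)
  show "(\<lambda>x. (z2 x)\<^sup>2) integrable_on {0..1}"
    unfolding eq
    by (intro integrable_add integrable_diff integrable_cmult_real abs_intD(1)[OF square_integrable_imp(2)[OF q]]
        abs_intD(1)[OF abs_int_mult_continuous] \<psi>D(7) square_integrable_imp(1)[OF q]
        integrable_continuous_real continuous_intros)
qed

lemma z_nonneg: "x \<in> {0..1} \<Longrightarrow> 0 \<le> z x"
  using above by (simp add: z_def)

abbreviation K where "K \<equiv> contact_set \<psi> w"

lemma K_iff: "x \<in> K \<longleftrightarrow> x \<in> {0..1} \<and> z x = 0"
  by (auto simp: contact_set_def z_def)

lemma z_deriv:
  assumes "x \<in> {0..1}"
  shows "(z has_real_derivative z1 x) (at x within {0..1})"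
proof -
  have "((\<lambda>x. integral {0..x} z1) has_real_derivative z1 x) (at x within {0..1})"
    by (rule integral_has_real_derivative[OF primitive_continuous[OF z1_prim] assms])
  then have "((\<lambda>x. z 0 + integral {0..x} z1) has_real_derivative z1 x) (at x within {0..1})"
    by (auto intro!: derivative_eq_intros)
  then show ?thesis
    by (rule has_field_derivative_transform_within[where d = 1])
       (use assms primitive_eq[OF z_prim, symmetric] in auto)
qed

text \<open>The nonnegative function \<open>z\<close> is minimal at a contact point, so \<open>z1\<close> is
  nonnegative there unless the point is 1, and nonpositive unless the point is 0. By periodicity, 0 and 1
  are contact points simultaneously and \<open>z1\<close> takes the same value at both.\<close>

lemma z1_zero_on_K:
  assumes "y \<in> K"
  shows "z1 y = 0"
proof -
  have right: "z1 y \<ge> 0" if y: "y \<in> K" "y < 1" for y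
  proof (rule ccontr)
    assume "\<not> 0 \<le> z1 y"
    then have neg: "z1 y < 0" by simp
    have y01: "y \<in> {0..1}" "z y = 0" using y by (auto simp: K_iff)
    obtain d where "d > 0" and d: "\<And>h. \<lbrakk>h > 0; y + h \<in> {0..1}; h < d\<rbrakk> \<Longrightarrow> z (y + h) < z y"
      using has_real_derivative_neg_dec_right[OF z_deriv[OF y01(1)] neg] by blast
    define h where "h = min (d / 2) (1 - y)"
    have "h > 0" "h < d" "y + h \<in> {0..1}"
      using \<open>d > 0\<close> y y01 by (auto simp: h_def min_def)
    then show False using d[of h] z_nonneg[of "y + h"] y01 by simp
  qed
  have left: "z1 y \<le> 0" if y: "y \<in> K" "y > 0" for y
  proof (rule ccontr)
    assume "\<not> z1 y \<le> 0"
    then have pos: "z1 y > 0" by simp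
    have y01: "y \<in> {0..1}" "z y = 0" using y by (auto simp: K_iff)
    obtain d where "d > 0" and d: "\<And>h. \<lbrakk>h > 0; y - h \<in> {0..1}; h < d\<rbrakk> \<Longrightarrow> z (y - h) < z y"
      using has_real_derivative_pos_inc_left[OF z_deriv[OF y01(1)] pos] by blast
    define h where "h = min (d / 2) y"
    have "h > 0" "h < d" "y - h \<in> {0..1}"
      using \<open>d > 0\<close> y y01 by (auto simp: h_def min_def)
    then show False using d[of h] z_nonneg[of "y - h"] y01 by simp
  qed
  have per: "z1 0 = z1 1" "z 0 = z 1" using p_per \<psi>D(3,4) w_per by (auto simp: z1_def z_def)
  have y: "y \<in> {0..1}" "z y = 0" using assms by (auto simp: K_iff)
  show ?thesis
  proof (cases "y = 0 \<or> y = 1")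
    case True
    then have "0 \<in> K" "1 \<in> K" using y per(2) by (auto simp: K_iff)
    then have "z1 0 \<ge> 0" "z1 1 \<le> 0" using right[of 0] left[of 1] by auto
    then show ?thesis using per(1) True by auto
  next
    case False
    then show ?thesis using right[OF assms] left[OF assms] y by force
  qed
qed

lemma z2_zero_on_K: "AE x in unit_meas. x \<in> K \<longrightarrow> z2 x = 0"
  using AE_zero_deriv_on_zero_set[OF z1_prim]
  by (rule eventually_mono) (auto dest: z1_zero_on_K)

text \<open>Nodes of cells that meet the contact set are moved onto the obstacle; the nodes 0 and \<open>N\<close>
  are the same node of the periodic mesh and are treated alike. Then all cells that meet the contact set
  adhere completely, however small \<open>\<delta>\<close> is.\<close>

definition touched where "touched N j \<longleftrightarrow> K \<inter> cell N j \<noteq> {}"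
definition snapped where
  "snapped N j \<longleftrightarrow> (if j = 0 \<or> j = N then touched N 1 \<or> touched N N else touched N j \<or> touched N (j + 1))"
definition node_value where
  "node_value N j = (if snapped N j then \<psi> (real j / real N) else w (real j / real N))"
definition approx where "approx N = interp N (node_value N)"
definition gap where "gap N j = nodal N w j - nodal N (approx N) j"
text \<open>The quantity that controls how far the nodes of a touched cell are moved.\<close>

definition local_excess where
  "local_excess N j = (if touched N (wrap_index N j) then integral (cell N (wrap_index N j)) (\<lambda>x. (z2 x)\<^sup>2) else 0)"
definition excess where "excess N = (\<Sum>j=1..N. local_excess N j)"

lemma z2_int: "(\<lambda>x. (z2 x)\<^sup>2) integrable_on {0..1}"
  by (rule abs_intD(1)[OF square_integrable_imp(2)[OF z2_sq]])

lemma cell_eq: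
  assumes "N \<ge> 1" "1 \<le> j" "j \<le> N"
  obtains a b where "cell N j = {a..b}" "0 \<le> a" "a \<le> b" "b \<le> 1" "b - a = 1 / real N"
    "a = real (j - 1) / real N" "b = real j / real N"
  using that[of "real (j - 1) / real N" "real j / real N"] assms
  by (auto simp: cell_def of_nat_diff field_simps)

lemma local_excess_nonneg: "N \<ge> 1 \<Longrightarrow> 1 \<le> j \<Longrightarrow> j \<le> N + 1 \<Longrightarrow> local_excess N j \<ge> 0"
proof -
  assume a: "N \<ge> 1" "1 \<le> j" "j \<le> N + 1"
  obtain c d where "cell N (wrap_index N j) = {c..d}" "0 \<le> c" "d \<le> 1"
    using cell_eq[of N "wrap_index N j"] wrap_index_range[OF a] a(1) by metis
  then show ?thesis unfolding local_excess_def
    using integrable_subinterval_real[OF z2_int, of c d] by (auto intro!: integral_nonneg)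
qed

text \<open>Both \<open>z\<close> and \<open>z1\<close> vanish at some point of the cell. Two integrations from this
  point gain the factor \<open>N\<^sup>-\<^sup>3\<close>.\<close>

lemma z_sq_on_touched_cell:
  assumes N: "N \<ge> 1" and j: "1 \<le> j" "j \<le> N" and t: "touched N j" and x: "x \<in> cell N j"
  shows "(z x)\<^sup>2 \<le> (1 / real N) ^ 3 * integral (cell N j) (\<lambda>x. (z2 x)\<^sup>2)"
proof -
  obtain a b where ab: "cell N j = {a..b}" "0 \<le> a" "a \<le> b" "b \<le> 1" "b - a = 1 / real N"
    using cell_eq[OF N j] by metis
  define h I where "h = 1 / real N" and "I = integral {a..b} (\<lambda>x. (z2 x)\<^sup>2)"
  have h: "h > 0" "b - a = h" using N ab by (auto simp: h_def)
  obtain y where y: "y \<in> K" "a \<le> y" "y \<le> b" using t ab by (auto simp: touched_def)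
  have i2: "(\<lambda>x. (z2 x)\<^sup>2) integrable_on {a..b}"
    using integrable_subinterval_real[OF z2_int] ab by auto
  have mono: "integral {c..d} (\<lambda>x. (z2 x)\<^sup>2) \<le> I" "0 \<le> integral {c..d} (\<lambda>x. (z2 x)\<^sup>2)"
    if "a \<le> c" "d \<le> b" for c d
  proof -
    have "(\<lambda>x. (z2 x)\<^sup>2) integrable_on {c..d}"
      using integrable_subinterval_real[OF i2] that by auto
    then show "integral {c..d} (\<lambda>x. (z2 x)\<^sup>2) \<le> I" "0 \<le> integral {c..d} (\<lambda>x. (z2 x)\<^sup>2)"
      unfolding I_def using i2 that by (auto intro!: integral_subset_le integral_nonneg)
  qed
  have I0: "0 \<le> I" using mono[of a b] by simp
  have z1b: "(z1 t)\<^sup>2 \<le> h * I" if t: "a \<le> t" "t \<le> b" for t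
  proof -
    have "(z1 t - z1 y)\<^sup>2 \<le> h * I"
    proof (cases "y \<le> t")
      case True
      have "(z1 t - z1 y)\<^sup>2 \<le> (t - y) * integral {y..t} (\<lambda>x. (z2 x)\<^sup>2)"
        using primitive_holder(1)[OF z1_prim z2_sq, of y t] True t y ab by auto
      also have "\<dots> \<le> h * I" using mono[of y t] h t y True I0 by (intro mult_mono) auto
      finally show ?thesis .
    next
      case False
      have "(z1 y - z1 t)\<^sup>2 \<le> (y - t) * integral {t..y} (\<lambda>x. (z2 x)\<^sup>2)"
        using primitive_holder(1)[OF z1_prim z2_sq, of t y] False t y ab by auto
      also have "\<dots> \<le> h * I" using mono[of t y] h t y False I0 by (intro mult_mono) auto
      finally show ?thesis by (simp add: power2_commute)
    qed
    then show ?thesis using z1_zero_on_K[OF y(1)] by simp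
  qed
  have z1sq: "square_integrable z1" by (rule continuous_square_integrable[OF primitive_continuous[OF z1_prim]])
  have step: "(z d - z c)\<^sup>2 \<le> h ^ 3 * I" if cd: "a \<le> c" "c \<le> d" "d \<le> b" for c d
  proof -
    have "integral {c..d} (\<lambda>x. (z1 x)\<^sup>2) \<le> integral {c..d} (\<lambda>x. h * I)"
      using cd ab by (intro integral_le z1b abs_int_sub(2)[OF square_integrable_imp(2)[OF z1sq]]) auto
    also have "\<dots> = (d - c) * (h * I)" using cd by simp
    also have "\<dots> \<le> h * (h * I)" using cd h I0 by (intro mult_right_mono) auto
    finally have le: "integral {c..d} (\<lambda>x. (z1 x)\<^sup>2) \<le> h * (h * I)" .
    have dc: "d - c \<le> h" using cd h by linarith
    have zi: "0 \<le> integral {c..d} (\<lambda>x. (z1 x)\<^sup>2)"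
      using cd ab by (intro integral_nonneg abs_int_sub(2)[OF square_integrable_imp(2)[OF z1sq]]) auto
    have "(z d - z c)\<^sup>2 \<le> (d - c) * integral {c..d} (\<lambda>x. (z1 x)\<^sup>2)"
      using primitive_holder(1)[OF z_prim z1sq, of c d] cd ab by auto
    also have "\<dots> \<le> h * (h * (h * I))"
      using less_imp_le[OF h(1)] by (intro mult_mono dc le zi)
    finally show ?thesis by (simp add: power3_eq_cube)
  qed
  have "z y = 0" using y by (simp add: K_iff)
  then have "(z x)\<^sup>2 \<le> h ^ 3 * I"
    using step[of x y] step[of y x] x y ab(1) by (cases "x \<le> y") (auto simp: power2_commute)
  then show ?thesis by (simp add: h_def I_def ab(1))
qed

lemma nodal_w: "j \<le> N \<Longrightarrow> N \<ge> 1 \<Longrightarrow> nodal N w j = w (real j / real N)"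
  by (rule nodal_eq[OF w_per])

lemma node_value_per: "N \<ge> 1 \<Longrightarrow> node_value N N = node_value N 0"
  using w_per \<psi>D(3) by (simp add: node_value_def snapped_def)

lemma approx_V_h: "N \<ge> 1 \<Longrightarrow> approx N \<in> V_h N"
  unfolding approx_def by (rule interp_V_h) (auto simp: node_value_per)

lemma nodal_approx: "N \<ge> 1 \<Longrightarrow> j \<le> N \<Longrightarrow> nodal N (approx N) j = node_value N j"
  unfolding approx_def by (rule nodal_interp) (auto simp: node_value_per)

lemma gap_eq: "N \<ge> 1 \<Longrightarrow> j \<le> N \<Longrightarrow> gap N j = (if snapped N j then z (real j / real N) else 0)"
  unfolding gap_def nodal_w nodal_approx by (simp add: node_value_def z_def)

lemma gap_wrap: "gap N (N + 1) = gap N 1" "gap N 0 = gap N N"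
  unfolding gap_def using nodal_wrap by metis+

lemma local_excess_touched: "touched N (wrap_index N j) \<Longrightarrow> local_excess N j = integral (cell N (wrap_index N j)) (\<lambda>x. (z2 x)\<^sup>2)"
  by (simp add: local_excess_def)

lemma gap_sq:
  assumes N: "N \<ge> 1" and j: "1 \<le> j" "j \<le> N"
  shows "(gap N j)\<^sup>2 \<le> (1 / real N) ^ 3 * (local_excess N j + local_excess N (j + 1))"
proof (cases "snapped N j")
  case False
  then show ?thesis
    using local_excess_nonneg[OF N j(1)] local_excess_nonneg[OF N, of "j + 1"] j
    by (simp add: gap_eq[OF N j(2)])
next
  case True
  have h: "0 \<le> (1 / real N) ^ 3" by simp
  have le: "0 \<le> local_excess N j" "0 \<le> local_excess N (j + 1)"
    using local_excess_nonneg[OF N j(1)] local_excess_nonneg[OF N, of "j + 1"] j by auto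
  have g: "gap N j = z (real j / real N)" using True by (simp add: gap_eq[OF N j(2)])
  have "touched N j \<or> touched N (wrap_index N (j + 1))"
    using True j by (auto simp: snapped_def wrap_index_def split: if_splits)
  then show ?thesis
  proof
    assume t: "touched N j"
    have "real j / real N \<in> cell N j" by (simp add: cell_def divide_right_mono)
    from z_sq_on_touched_cell[OF N j t this] t j
    have "(gap N j)\<^sup>2 \<le> (1 / real N) ^ 3 * local_excess N j"
      by (simp add: g local_excess_def wrap_index_simps)
    also have "\<dots> \<le> (1 / real N) ^ 3 * (local_excess N j + local_excess N (j + 1))"
      using le h by (intro mult_left_mono) auto
    finally show ?thesis .
  next
    assume t: "touched N (wrap_index N (j + 1))"
    define x where "x = real (wrap_index N (j + 1) - 1) / real N"
    have r: "1 \<le> wrap_index N (j + 1)" "wrap_index N (j + 1) \<le> N" using wrap_index_range[OF N, of "j + 1"] j by auto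
    have x: "x \<in> cell N (wrap_index N (j + 1))"
      using r by (simp add: cell_def x_def divide_right_mono of_nat_diff)
    have "z x = z (real j / real N)"
    proof (cases "j = N")
      case True
      have "z 0 = z 1" using w_per \<psi>D(3) by (simp add: z_def)
      then show ?thesis using True N by (simp add: x_def wrap_index_def)
    next
      case False
      then show ?thesis by (simp add: x_def wrap_index_def)
    qed
    with z_sq_on_touched_cell[OF N r t x]
    have "(gap N j)\<^sup>2 \<le> (1 / real N) ^ 3 * local_excess N (j + 1)"
      unfolding g local_excess_touched[OF t] by simp
    also have "\<dots> \<le> (1 / real N) ^ 3 * (local_excess N j + local_excess N (j + 1))"
      using le h by (intro mult_left_mono) auto
    finally show ?thesis .
  qed
qed

definition Q where "Q = integral {0..1} (\<lambda>x. (q x)\<^sup>2)"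
definition Z where "Z = integral {0..1} (\<lambda>x. (z2 x)\<^sup>2)"
text \<open>The first term is the oscillation of \<open>p\<close> over a cell, the second one accounts for the moved
  nodes; together they bound the distance of the slopes of \<open>approx N\<close> from \<open>p\<close>.\<close>

definition kappa where "kappa N = sqrt (Q / real N) + 2 * sqrt (2 * Z / real N)"

lemma QZ_nonneg: "0 \<le> Q" "0 \<le> Z"
  unfolding Q_def Z_def using z2_int abs_intD(1)[OF square_integrable_imp(2)[OF q]]
  by (auto intro!: integral_nonneg)

lemma kappa_nonneg: "0 \<le> kappa N" "sqrt (Q / real N) \<le> kappa N"
  using QZ_nonneg by (auto simp: kappa_def)

lemma local_excess_le:
  assumes "N \<ge> 1" "1 \<le> j" "j \<le> N + 1"
  shows "local_excess N j \<le> Z"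
proof -
  obtain c d where cd: "cell N (wrap_index N j) = {c..d}" "0 \<le> c" "d \<le> 1"
    using cell_eq[of N "wrap_index N j"] wrap_index_range[OF assms] assms(1) by metis
  have "integral {c..d} (\<lambda>x. (z2 x)\<^sup>2) \<le> Z"
    unfolding Z_def using integrable_subinterval_real[OF z2_int, of c d] z2_int cd
    by (intro integral_subset_le) auto
  then show ?thesis using QZ_nonneg cd by (simp add: local_excess_def)
qed

lemma gap_small:
  assumes N: "N \<ge> 1" and j: "j \<le> N"
  shows "\<bar>gap N j\<bar> * real N \<le> sqrt (2 * Z / real N)"
proof -
  have main: "\<bar>gap N j\<bar> * real N \<le> sqrt (2 * Z / real N)" if j: "1 \<le> j" "j \<le> N" for j
  proof (rule real_le_rsqrt)
    have "(\<bar>gap N j\<bar> * real N)\<^sup>2 = (gap N j)\<^sup>2 * (real N)\<^sup>2" by (simp add: power_mult_distrib)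
    also have "\<dots> \<le> ((1 / real N) ^ 3 * (local_excess N j + local_excess N (j + 1))) * (real N)\<^sup>2"
      by (intro mult_right_mono gap_sq[OF N j]) simp
    also have "\<dots> \<le> ((1 / real N) ^ 3 * (Z + Z)) * (real N)\<^sup>2"
      using j N by (intro mult_right_mono mult_left_mono add_mono local_excess_le) auto
    also have "\<dots> = 2 * Z / real N" using N by (simp add: power3_eq_cube power2_eq_square)
    finally show "(\<bar>gap N j\<bar> * real N)\<^sup>2 \<le> 2 * Z / real N" .
  qed
  show ?thesis
  proof (cases "j = 0")
    case True
    then show ?thesis using main[of N] N gap_wrap(2)[of N] by simp
  next
    case False
    then show ?thesis using main[of j] j by simp
  qed
qed

lemma slope_approx: "slope N (approx N) j = slope N w j - real N * (gap N j - gap N (j - 1))"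
  by (simp add: slope_eq gap_def algebra_simps)

lemma p_holder:
  assumes "s \<in> {0..1}" "t \<in> {0..1}" "\<bar>s - t\<bar> \<le> h"
  shows "\<bar>p s - p t\<bar> \<le> sqrt (Q * h)"
proof -
  have main: "\<bar>p s - p t\<bar> \<le> sqrt (Q * h)" if "0 \<le> s" "s \<le> t" "t \<le> 1" "t - s \<le> h" for s t
  proof (rule real_le_rsqrt)
    note H = primitive_holder[OF p q that(1-3)]
    have "\<bar>p s - p t\<bar>\<^sup>2 = (p t - p s)\<^sup>2" by (simp add: power2_commute)
    also have "\<dots> \<le> (t - s) * Q"
      using H mult_left_mono[OF H(2), of "t - s"] that(2) unfolding Q_def by linarith
    also have "\<dots> \<le> h * Q" using that QZ_nonneg by (intro mult_right_mono) auto
    finally show "\<bar>p s - p t\<bar>\<^sup>2 \<le> Q * h" by (simp add: mult.commute)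
  qed
  show ?thesis
  proof (cases "s \<le> t")
    case True
    then show ?thesis using main[of s t] assms by auto
  next
    case False
    then show ?thesis using main[of t s] assms by (auto simp: abs_minus_commute)
  qed
qed

lemma slope_w:
  assumes N: "N \<ge> 1" and j: "1 \<le> j" "j \<le> N"
  shows "slope N w j = real N * integral (cell N j) p"
proof -
  obtain a b where ab: "cell N j = {a..b}" "0 \<le> a" "a \<le> b" "b \<le> 1" "a = real (j - 1) / real N" "b = real j / real N"
    using cell_eq[OF N j] by metis
  have "integral {a..b} p = w b - w a" using primitive_diff[OF w ab(2-4)] by simp
  moreover have "nodal N w j = w b" "nodal N w (j - 1) = w a"
    using j N ab(5,6) nodal_w by auto
  ultimately show ?thesis by (simp add: slope_eq ab(1))
qed

lemma p_int: "0 \<le> a \<Longrightarrow> b \<le> 1 \<Longrightarrow> p integrable_on {a..b}"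
  by (intro integrable_continuous_real continuous_on_subset[OF p_cont]) auto

lemma slope_w_close:
  assumes N: "N \<ge> 1" and j: "1 \<le> j" "j \<le> N" and x: "x \<in> cell N j"
  shows "\<bar>slope N w j - p x\<bar> \<le> sqrt (Q / real N)"
proof -
  obtain a b where ab: "cell N j = {a..b}" "0 \<le> a" "a \<le> b" "b \<le> 1" "b - a = 1 / real N"
    using cell_eq[OF N j] by metis
  define s where "s = sqrt (Q / real N)"
  have close: "\<bar>p t - p x\<bar> \<le> s" if "t \<in> {a..b}" for t
    using p_holder[of t x "1 / real N"] that x ab by (auto simp: s_def)
  have i: "p integrable_on {a..b}" using ab by (intro p_int)
  have "integral {a..b} p \<le> integral {a..b} (\<lambda>_. p x + s)"
    using close i by (intro integral_le) (auto simp: abs_le_iff algebra_simps)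
  moreover have "integral {a..b} (\<lambda>_. p x - s) \<le> integral {a..b} p"
    using close i by (intro integral_le) (auto simp: abs_le_iff algebra_simps)
  ultimately have "(p x - s) * (1 / real N) \<le> integral {a..b} p" "integral {a..b} p \<le> (p x + s) * (1 / real N)"
    using ab(3,5) by (simp_all add: mult.commute)
  then have "p x - s \<le> real N * integral {a..b} p" "real N * integral {a..b} p \<le> p x + s"
    using N by (simp_all add: field_simps)
  then show ?thesis unfolding slope_w[OF N j] ab(1) s_def by auto
qed

lemma slope_close:
  assumes N: "N \<ge> 1" and j: "1 \<le> j" "j \<le> N" and x: "x \<in> cell N j"
  shows "\<bar>slope N (approx N) j - p x\<bar> \<le> kappa N"
proof -
  have "\<bar>real N * (gap N j - gap N (j - 1))\<bar> \<le> \<bar>gap N j\<bar> * real N + \<bar>gap N (j - 1)\<bar> * real N"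
    using abs_triangle_ineq4[of "gap N j * real N" "gap N (j - 1) * real N"]
    by (simp add: abs_mult algebra_simps)
  also have "\<dots> \<le> 2 * sqrt (2 * Z / real N)"
    using add_mono[OF gap_small[OF N, of j] gap_small[OF N, of "j - 1"]] j by force
  finally show ?thesis
    using slope_w_close[OF assms] unfolding slope_approx kappa_def by linarith
qed

lemma p_wrap_index:
  assumes "N \<ge> 1" "1 \<le> j" "j \<le> N"
  shows "p (real (wrap_index N (j + 1) - 1) / real N) = p (real j / real N)"
  using assms p_per by (simp add: wrap_index_def)

lemma slope_jump:
  assumes N: "N \<ge> 1" and j: "1 \<le> j" "j \<le> N"
  shows "\<bar>slope N (approx N) (j + 1) - slope N (approx N) j\<bar> \<le> 2 * kappa N"
proof -
  have r: "1 \<le> wrap_index N (j + 1)" "wrap_index N (j + 1) \<le> N" using wrap_index_range[OF N, of "j + 1"] j by auto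
  show ?thesis
    using slope_close[OF N j node_in_cell[OF N]] slope_close[OF N r left_node_in_cell[OF N r(1)]]
    unfolding slope_wrap_index[of N _ j] p_wrap_index[OF N j] by linarith
qed

text \<open>The bending density of \<open>w\<close>, up to the factor \<open>C / 2\<close>.\<close>

definition D where "D = (\<lambda>x. (q x)\<^sup>2 / sqrt (1 + (p x)\<^sup>2) ^ 5)"

lemma D_abs_int: "D absolutely_integrable_on {0..1}"
  unfolding D_def by (rule bend_density_abs_int[OF p_cont q])

lemma D_nonneg: "D x \<ge> 0" by (simp add: D_def)

text \<open>The Cauchy-Schwarz inequality with weight \<open>k\<close>, where \<open>k\<close> is one half of a hat
  function of height \<open>1 / N\<close>. Replacing the value \<open>s\<close> at which the density is
  frozen by \<open>p t\<close> costs the factor \<open>(1 + \<tau>)\<^sup>5\<close>.\<close>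

lemma kernel_bound:
  assumes N: "N \<ge> 1" and ab: "0 \<le> a" "b \<le> 1"
    and k: "continuous_on {0..1} k" "\<And>x. x \<in> {a..b} \<Longrightarrow> 0 \<le> k x" "integral {a..b} k = 1 / (2 * (real N)\<^sup>2)"
    and s: "\<And>t. t \<in> {a..b} \<Longrightarrow> \<bar>p t - s\<bar> \<le> \<tau>" and \<tau>: "\<tau> \<ge> 0"
  shows "2 * (real N * integral {a..b} (\<lambda>x. k x * q x))\<^sup>2 * real N / sqrt (1 + s\<^sup>2) ^ 5
      \<le> (1 + \<tau>) ^ 5 * (real N * integral {a..b} (\<lambda>x. k x * D x))"
proof -
  define A where "A = sqrt (1 + s\<^sup>2)"
  have A: "A > 0" by (simp add: A_def add_pos_nonneg)
  have iq: "(\<lambda>x. k x * (q x)\<^sup>2) integrable_on {a..b}"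
    using ab by (intro abs_int_sub(2)[OF abs_int_mult_continuous[OF k(1) square_integrable_imp(2)[OF q]]])
  have iD: "(\<lambda>x. k x * D x) integrable_on {a..b}"
    using ab by (intro abs_int_sub(2)[OF abs_int_mult_continuous[OF k(1) D_abs_int]])
  have "(integral {a..b} (\<lambda>x. k x * q x))\<^sup>2 \<le> 1 / (2 * (real N)\<^sup>2) * integral {a..b} (\<lambda>x. k x * (q x)\<^sup>2)"
    using weighted_cauchy_schwarz[OF k(1,2) q ab] N unfolding k(3) by simp
  then have "(2 * (real N)\<^sup>2) * (integral {a..b} (\<lambda>x. k x * q x))\<^sup>2
      \<le> (2 * (real N)\<^sup>2) * (1 / (2 * (real N)\<^sup>2) * integral {a..b} (\<lambda>x. k x * (q x)\<^sup>2))"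
    by (rule mult_left_mono) simp
  then have 1: "2 * (real N * integral {a..b} (\<lambda>x. k x * q x))\<^sup>2 \<le> integral {a..b} (\<lambda>x. k x * (q x)\<^sup>2)"
    using N by (simp add: power_mult_distrib)
  have "integral {a..b} (\<lambda>x. k x * (q x)\<^sup>2) \<le> integral {a..b} (\<lambda>x. (A ^ 5 * (1 + \<tau>) ^ 5) * (k x * D x))"
  proof (rule integral_le[OF iq integrable_cmult_real[OF iD]])
    fix x assume x: "x \<in> {a..b}"
    have sp: "sqrt (1 + (p x)\<^sup>2) > 0" by (simp add: add_pos_nonneg)
    have "sqrt (1 + (p x)\<^sup>2) \<le> (1 + \<tau>) * A" unfolding A_def by (rule sqrt_sq_ratio[OF s[OF x]])
    then have "sqrt (1 + (p x)\<^sup>2) ^ 5 \<le> ((1 + \<tau>) * A) ^ 5" using sp by (intro power_mono) auto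
    then have "sqrt (1 + (p x)\<^sup>2) ^ 5 * D x \<le> ((1 + \<tau>) * A) ^ 5 * D x"
      by (rule mult_right_mono) (rule D_nonneg)
    moreover have "sqrt (1 + (p x)\<^sup>2) ^ 5 * D x = (q x)\<^sup>2" using sp by (simp add: D_def)
    ultimately have "(q x)\<^sup>2 \<le> (A ^ 5 * (1 + \<tau>) ^ 5) * D x"
      by (simp add: power_mult_distrib mult.commute)
    from mult_left_mono[OF this k(2)[OF x]]
    show "k x * (q x)\<^sup>2 \<le> (A ^ 5 * (1 + \<tau>) ^ 5) * (k x * D x)" by (simp only: mult.left_commute)
  qed
  with 1 have "2 * (real N * integral {a..b} (\<lambda>x. k x * q x))\<^sup>2 \<le> (A ^ 5 * (1 + \<tau>) ^ 5) * integral {a..b} (\<lambda>x. k x * D x)"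
    by simp
  then have "2 * (real N * integral {a..b} (\<lambda>x. k x * q x))\<^sup>2 * real N
      \<le> (A ^ 5 * (1 + \<tau>) ^ 5) * integral {a..b} (\<lambda>x. k x * D x) * real N"
    by (rule mult_right_mono) simp
  then have "2 * (real N * integral {a..b} (\<lambda>x. k x * q x))\<^sup>2 * real N
      \<le> ((1 + \<tau>) ^ 5 * (real N * integral {a..b} (\<lambda>x. k x * D x))) * A ^ 5"
    by (simp only: ac_simps)
  then show ?thesis using A by (simp add: A_def[symmetric] pos_divide_le_eq)
qed

text \<open>The bending energy of a cell, split by the two hat functions that live on it.\<close>

definition \<alpha> where "\<alpha> N j = real N * integral (cell N j) (\<lambda>t. (t - real (j - 1) / real N) * D t)"
definition \<beta> where "\<beta> N j = real N * integral (cell N j) (\<lambda>t. (real j / real N - t) * D t)"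

lemma alpha_beta:
  assumes N: "N \<ge> 1" and j: "1 \<le> j" "j \<le> N"
  shows "\<alpha> N j + \<beta> N j = integral (cell N j) D"
proof -
  obtain a b where ab: "cell N j = {a..b}" "0 \<le> a" "a \<le> b" "b \<le> 1" "b - a = 1 / real N"
    "a = real (j - 1) / real N" "b = real j / real N"
    using cell_eq[OF N j] by metis
  have i: "(\<lambda>t. f t * D t) integrable_on {a..b}" if "continuous_on {0..1} f" for f
    using ab by (intro abs_int_sub(2)[OF abs_int_mult_continuous[OF that D_abs_int]])
  have "integral {a..b} (\<lambda>t. (t - a) * D t) + integral {a..b} (\<lambda>t. (b - t) * D t) =
      integral {a..b} (\<lambda>t. (t - a) * D t + (b - t) * D t)"
    by (subst integral_add) (auto intro!: i continuous_intros)
  also have "\<dots> = integral {a..b} (\<lambda>t. (1 / real N) * D t)"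
    unfolding distrib_right[symmetric] ab(5)[symmetric] by simp
  finally have "integral {a..b} (\<lambda>t. (t - a) * D t) + integral {a..b} (\<lambda>t. (b - t) * D t) =
      integral {a..b} D / real N" by simp
  then have "real N * (integral {a..b} (\<lambda>t. (t - a) * D t) + integral {a..b} (\<lambda>t. (b - t) * D t)) = integral {a..b} D"
    using N by simp
  then show ?thesis
    unfolding \<alpha>_def \<beta>_def ab(1) ab(6)[symmetric] ab(7)[symmetric] by (simp add: distrib_left)
qed

lemma slope_jump_main:
  assumes N: "N \<ge> 1" and j: "1 \<le> j" "j \<le> N"
  shows "(slope N w (j + 1) - slope N w j)\<^sup>2 * real N / sqrt (1 + (slope N (approx N) j)\<^sup>2) ^ 5
      \<le> (1 + 2 * kappa N) ^ 5 * (\<alpha> N j + \<beta> N (wrap_index N (j + 1)))"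
proof -
  define i where "i = wrap_index N (j + 1)"
  have r: "1 \<le> i" "i \<le> N" using wrap_index_range[OF N, of "j + 1"] j by (auto simp: i_def)
  obtain a b where ab: "cell N j = {a..b}" "0 \<le> a" "a \<le> b" "b \<le> 1" "b - a = 1 / real N"
    "a = real (j - 1) / real N" "b = real j / real N"
    using cell_eq[OF N j] by metis
  obtain c d where cd: "cell N i = {c..d}" "0 \<le> c" "c \<le> d" "d \<le> 1" "d - c = 1 / real N"
    "c = real (i - 1) / real N" "d = real i / real N"
    using cell_eq[OF N r] by metis
  have pcb: "p c = p b" using p_wrap_index[OF N j] by (simp add: i_def cd(6) ab(7))
  define s where "s = slope N (approx N) j"
  define U V where "U = real N * integral {a..b} (\<lambda>t. (t - a) * q t)" and
    "V = real N * integral {c..d} (\<lambda>t. (d - t) * q t)"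
  have "U = p b - slope N w j"
    unfolding U_def peano_right[OF p ab(2-4)] slope_w[OF N j] ab(1,5) using N by (simp add: right_diff_distrib)
  moreover have "V = slope N w i - p c"
    unfolding V_def peano_left[OF p cd(2-4)] slope_w[OF N r] cd(1,5) using N by (simp add: right_diff_distrib)
  ultimately have UV: "slope N w (j + 1) - slope N w j = U + V"
    using pcb unfolding slope_wrap_index[of N w j] i_def by linarith
  have sclose: "\<bar>p b - s\<bar> \<le> kappa N"
    using slope_close[OF N j, of b] ab by (auto simp: s_def abs_minus_commute)
  have near: "\<bar>p t - s\<bar> \<le> 2 * kappa N" if "\<bar>p t - p b\<bar> \<le> sqrt (Q * (1 / real N))" for t
    using that sclose kappa_nonneg(2)[of N] by simp
  have k1: "integral {a..b} (\<lambda>t. t - a) = 1 / (2 * (real N)\<^sup>2)"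
  proof -
    have "((\<lambda>t. t - a) has_integral ((b - a)\<^sup>2 / 2 - (a - a)\<^sup>2 / 2)) {a..b}"
      by (rule fundamental_theorem_of_calculus[OF ab(3)])
         (auto intro!: derivative_eq_intros simp: has_real_derivative_iff_has_vector_derivative[symmetric])
    then show ?thesis using ab(5) by (simp add: integral_unique power_divide)
  qed
  have k2: "integral {c..d} (\<lambda>t. d - t) = 1 / (2 * (real N)\<^sup>2)"
  proof -
    have "((\<lambda>t. d - t) has_integral (- ((d - d)\<^sup>2 / 2) - - ((d - c)\<^sup>2 / 2))) {c..d}"
      by (rule fundamental_theorem_of_calculus[OF cd(3)])
         (auto intro!: derivative_eq_intros simp: has_real_derivative_iff_has_vector_derivative[symmetric] field_simps)
    then show ?thesis using cd(5) by (simp add: integral_unique power_divide)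
  qed
  have "2 * U\<^sup>2 * real N / sqrt (1 + s\<^sup>2) ^ 5 \<le> (1 + 2 * kappa N) ^ 5 * \<alpha> N j"
    unfolding U_def \<alpha>_def ab(1) ab(6)[symmetric]
  proof (rule kernel_bound[OF N ab(2,4) _ _ k1])
    fix t assume "t \<in> {a..b}"
    then have "t \<in> {0..1}" "b \<in> {0..1}" "\<bar>t - b\<bar> \<le> 1 / real N"
      using ab(2-5) unfolding atLeastAtMost_iff by linarith+
    then show "\<bar>p t - s\<bar> \<le> 2 * kappa N" by (intro near p_holder)
  qed (use kappa_nonneg[of N] in \<open>auto intro!: continuous_intros\<close>)
  moreover have "2 * V\<^sup>2 * real N / sqrt (1 + s\<^sup>2) ^ 5 \<le> (1 + 2 * kappa N) ^ 5 * \<beta> N i"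
    unfolding V_def \<beta>_def cd(1) cd(7)[symmetric]
  proof (rule kernel_bound[OF N cd(2,4) _ _ k2])
    fix t assume "t \<in> {c..d}"
    then have "t \<in> {0..1}" "c \<in> {0..1}" "\<bar>t - c\<bar> \<le> 1 / real N"
      using cd(2-5) unfolding atLeastAtMost_iff by linarith+
    then show "\<bar>p t - s\<bar> \<le> 2 * kappa N" by (intro near, unfold pcb[symmetric], intro p_holder)
  qed (use kappa_nonneg[of N] in \<open>auto intro!: continuous_intros\<close>)
  moreover have "(U + V)\<^sup>2 * real N / sqrt (1 + s\<^sup>2) ^ 5
      \<le> 2 * U\<^sup>2 * real N / sqrt (1 + s\<^sup>2) ^ 5 + 2 * V\<^sup>2 * real N / sqrt (1 + s\<^sup>2) ^ 5"
  proof -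
    have "0 \<le> (U - V)\<^sup>2" by simp
    then have "(U + V)\<^sup>2 \<le> 2 * U\<^sup>2 + 2 * V\<^sup>2" by (simp add: power2_sum power2_diff)
    then have "(U + V)\<^sup>2 * real N / sqrt (1 + s\<^sup>2) ^ 5 \<le> (2 * U\<^sup>2 + 2 * V\<^sup>2) * real N / sqrt (1 + s\<^sup>2) ^ 5"
      by (intro divide_right_mono mult_right_mono) auto
    then show ?thesis by (simp only: distrib_right add_divide_distrib)
  qed
  ultimately show ?thesis unfolding UV s_def[symmetric] i_def[symmetric] distrib_left by linarith
qed

lemma sum_slope_jump_main:
  assumes N: "N \<ge> 1"
  shows "(\<Sum>j=1..N. (slope N w (j + 1) - slope N w j)\<^sup>2 * real N / sqrt (1 + (slope N (approx N) j)\<^sup>2) ^ 5)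
      \<le> (1 + 2 * kappa N) ^ 5 * integral {0..1} D"
proof -
  have "(\<Sum>j=1..N. (slope N w (j + 1) - slope N w j)\<^sup>2 * real N / sqrt (1 + (slope N (approx N) j)\<^sup>2) ^ 5)
      \<le> (\<Sum>j=1..N. (1 + 2 * kappa N) ^ 5 * (\<alpha> N j + \<beta> N (wrap_index N (j + 1))))"
    using slope_jump_main[OF N] by (intro sum_mono) auto
  also have "\<dots> = (1 + 2 * kappa N) ^ 5 * ((\<Sum>j=1..N. \<alpha> N j) + (\<Sum>j=1..N. \<beta> N (wrap_index N (j + 1))))"
    by (simp only: sum_distrib_left[symmetric] sum.distrib)
  also have "(\<Sum>j=1..N. \<beta> N (wrap_index N (j + 1))) = (\<Sum>j=1..N. \<beta> N (wrap_index N j))"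
    using N by (intro sum_cyclic_shift) (auto simp: wrap_index_def)
  also have "\<dots> = (\<Sum>j=1..N. \<beta> N j)" by (intro sum.cong) (auto simp: wrap_index_def)
  also have "(\<Sum>j=1..N. \<alpha> N j) + (\<Sum>j=1..N. \<beta> N j) = (\<Sum>j=1..N. integral (cell N j) D)"
    unfolding sum.distrib[symmetric] by (intro sum.cong alpha_beta[OF N]) auto
  also have "\<dots> = integral {0..1} D" using integral_cells[OF N abs_intD(1)[OF D_abs_int]] by simp
  finally show ?thesis .
qed

text \<open>The slope jumps caused by moving the nodes.\<close>

definition gap2 where "gap2 N j = real N * (gap N (j + 1) - 2 * gap N j + gap N (j - 1))"

text \<open>Second differences of \<open>gap N\<close> are bounded by its values, whose squares are of order
  \<open>N\<^sup>-\<^sup>3\<close> times the local excess; this is exactly the order of squared slope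
  jumps.\<close>

lemma sum_gap2:
  assumes N: "N \<ge> 1"
  shows "(\<Sum>j=1..N. (gap2 N j)\<^sup>2 * real N) \<le> 36 * excess N"
proof -
  have "(gap2 N j)\<^sup>2 * real N \<le> 6 * (real N) ^ 3 * ((gap N (j + 1))\<^sup>2 + (gap N j)\<^sup>2 + (gap N (j - 1))\<^sup>2)" for j
  proof -
    have "(x - 2 * y + u)\<^sup>2 \<le> 6 * (x\<^sup>2 + y\<^sup>2 + u\<^sup>2)" for x y u :: real
    proof -
      \<comment> \<open>\<open>6 (x\<^sup>2 + y\<^sup>2 + u\<^sup>2) - (x - 2 y + u)\<^sup>2\<close> is the sum of these squares.\<close>
      have "0 \<le> (2 * x + y)\<^sup>2 + (2 * u + y)\<^sup>2 + (x - u)\<^sup>2" by simp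
      then show ?thesis by (simp add: power2_eq_square algebra_simps)
    qed
    from mult_left_mono[OF this, of "(real N) ^ 3" "gap N (j + 1)" "gap N j" "gap N (j - 1)"]
    show ?thesis by (simp add: gap2_def power_mult_distrib power3_eq_cube power2_eq_square ac_simps)
  qed
  then have "(\<Sum>j=1..N. (gap2 N j)\<^sup>2 * real N)
      \<le> (\<Sum>j=1..N. 6 * (real N) ^ 3 * ((gap N (j + 1))\<^sup>2 + (gap N j)\<^sup>2 + (gap N (j - 1))\<^sup>2))"
    by (intro sum_mono)
  also have "\<dots> = 6 * (real N) ^ 3 * ((\<Sum>j=1..N. (gap N (j + 1))\<^sup>2) + (\<Sum>j=1..N. (gap N j)\<^sup>2) + (\<Sum>j=1..N. (gap N (j - 1))\<^sup>2))"
    by (simp only: sum_distrib_left[symmetric] sum.distrib)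
  also have "(\<Sum>j=1..N. (gap N (j + 1))\<^sup>2) = (\<Sum>j=1..N. (gap N j)\<^sup>2)"
    using N gap_wrap(1)[of N] by (intro sum_cyclic_shift) auto
  also have "(\<Sum>j=1..N. (gap N (j - 1))\<^sup>2) = (\<Sum>j=1..N. (gap N j)\<^sup>2)"
    using gap_wrap(2)[of N] by (intro sum_cyclic_shift_down[of "\<lambda>j. (gap N j)\<^sup>2"]) simp
  also have "6 * (real N) ^ 3 * ((\<Sum>j=1..N. (gap N j)\<^sup>2) + (\<Sum>j=1..N. (gap N j)\<^sup>2) + (\<Sum>j=1..N. (gap N j)\<^sup>2))
      = 18 * (real N) ^ 3 * (\<Sum>j=1..N. (gap N j)\<^sup>2)" by simp
  also have "\<dots> \<le> 18 * (real N) ^ 3 * (\<Sum>j=1..N. (1 / real N) ^ 3 * (local_excess N j + local_excess N (j + 1)))"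
    using gap_sq[OF N] by (intro mult_left_mono sum_mono) auto
  also have "(\<Sum>j=1..N. (1 / real N) ^ 3 * (local_excess N j + local_excess N (j + 1)))
      = (1 / real N) ^ 3 * ((\<Sum>j=1..N. local_excess N j) + (\<Sum>j=1..N. local_excess N (j + 1)))"
    by (simp only: sum_distrib_left[symmetric] sum.distrib)
  also have "(\<Sum>j=1..N. local_excess N (j + 1)) = (\<Sum>j=1..N. local_excess N j)"
    using N by (intro sum_cyclic_shift) (auto simp: local_excess_def wrap_index_def)
  also have "18 * (real N) ^ 3 * ((1 / real N) ^ 3 * ((\<Sum>j=1..N. local_excess N j) + (\<Sum>j=1..N. local_excess N j)))
      = 36 * excess N" using N by (simp add: power_divide excess_def)
  finally show ?thesis .
qed

text \<open>Young's inequality with parameter \<open>\<eta>\<close> separates the slope jumps of \<open>w\<close>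
  from those caused by moving the nodes.\<close>

lemma bending_approx:
  assumes N: "N \<ge> 1" and C: "C > 0" and \<eta>: "\<eta> > 0"
  shows "bending_h C N (approx N) \<le> C / 2 * ((1 + 2 * kappa N) ^ 10 *
      ((1 + \<eta>) * ((1 + 2 * kappa N) ^ 5 * integral {0..1} D) + (1 + 1 / \<eta>) * (36 * excess N)))"
proof -
  define d where "d = slope N (approx N)"
  define e where "e = slope N w"
  have jump: "d (j + 1) - d j = (e (j + 1) - e j) - gap2 N j" for j
    unfolding d_def e_def slope_approx gap2_def by (simp add: algebra_simps)
  have young: "(x - y)\<^sup>2 \<le> (1 + \<eta>) * x\<^sup>2 + (1 + 1 / \<eta>) * y\<^sup>2" for x y :: real
  proof -
    have "0 \<le> (sqrt \<eta> * x + y / sqrt \<eta>)\<^sup>2" by simp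
    also have "\<dots> = \<eta> * x\<^sup>2 + 2 * (x * y) + y\<^sup>2 / \<eta>"
      using \<eta> by (simp add: power2_sum power_mult_distrib power_divide)
    finally show ?thesis by (simp add: power2_diff distrib_right)
  qed
  have single: "bend_term (1 / real N) (d j) (d (j + 1))
      \<le> (1 + 2 * kappa N) ^ 10 * ((1 + \<eta>) * ((e (j + 1) - e j)\<^sup>2 * real N / sqrt (1 + (d j)\<^sup>2) ^ 5)
          + (1 + 1 / \<eta>) * ((gap2 N j)\<^sup>2 * real N))" (is "?l \<le> _") if j: "1 \<le> j" "j \<le> N" for j
  proof -
    have A: "sqrt (1 + (d j)\<^sup>2) ^ 5 \<ge> 1" by (rule one_le_power) simp
    have "?l \<le> (1 + 2 * kappa N) ^ 10 * ((d (j + 1) - d j)\<^sup>2 / (1 / real N * sqrt (1 + (d j)\<^sup>2) ^ 5))"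
      using bend_term_upper[of "1 / real N" "d (j + 1)" "d j" "2 * kappa N"] slope_jump[OF N j] N
      by (simp add: d_def)
    also have "\<dots> \<le> (1 + 2 * kappa N) ^ 10 * ((1 + \<eta>) * ((e (j + 1) - e j)\<^sup>2 * real N / sqrt (1 + (d j)\<^sup>2) ^ 5)
          + (1 + 1 / \<eta>) * ((gap2 N j)\<^sup>2 * real N))"
    proof (intro mult_left_mono)
      have "(d (j + 1) - d j)\<^sup>2 / (1 / real N * sqrt (1 + (d j)\<^sup>2) ^ 5)
          = (d (j + 1) - d j)\<^sup>2 * (real N / sqrt (1 + (d j)\<^sup>2) ^ 5)" by simp
      also have "\<dots> \<le> ((1 + \<eta>) * (e (j + 1) - e j)\<^sup>2 + (1 + 1 / \<eta>) * (gap2 N j)\<^sup>2) * (real N / sqrt (1 + (d j)\<^sup>2) ^ 5)"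
        unfolding jump by (intro mult_right_mono young) simp
      also have "\<dots> = (1 + \<eta>) * ((e (j + 1) - e j)\<^sup>2 * real N / sqrt (1 + (d j)\<^sup>2) ^ 5)
          + (1 + 1 / \<eta>) * (gap2 N j)\<^sup>2 * (real N / sqrt (1 + (d j)\<^sup>2) ^ 5)"
      proof -
        have "(a * x + b * y) * (n / r) = a * (x * n / r) + b * y * (n / r)" for a b x y n r :: real
          by (simp add: distrib_right add_divide_distrib mult.assoc)
        then show ?thesis .
      qed
      also have "(1 + 1 / \<eta>) * (gap2 N j)\<^sup>2 * (real N / sqrt (1 + (d j)\<^sup>2) ^ 5) \<le> (1 + 1 / \<eta>) * (gap2 N j)\<^sup>2 * real N"
      proof (intro mult_left_mono)
        have "real N / sqrt (1 + (d j)\<^sup>2) ^ 5 \<le> real N / 1"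
          using A by (intro divide_left_mono) (auto simp: add_pos_nonneg)
        then show "real N / sqrt (1 + (d j)\<^sup>2) ^ 5 \<le> real N" by simp
      qed (use \<eta> in auto)
      finally show "(d (j + 1) - d j)\<^sup>2 / (1 / real N * sqrt (1 + (d j)\<^sup>2) ^ 5)
          \<le> (1 + \<eta>) * ((e (j + 1) - e j)\<^sup>2 * real N / sqrt (1 + (d j)\<^sup>2) ^ 5) + (1 + 1 / \<eta>) * ((gap2 N j)\<^sup>2 * real N)"
        by (simp only: mult.assoc)
    qed (use kappa_nonneg[of N] in auto)
    finally show ?thesis .
  qed
  have "(\<Sum>j=1..N. bend_term (1 / real N) (d j) (d (j + 1)))
      \<le> (\<Sum>j=1..N. (1 + 2 * kappa N) ^ 10 * ((1 + \<eta>) * ((e (j + 1) - e j)\<^sup>2 * real N / sqrt (1 + (d j)\<^sup>2) ^ 5)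
          + (1 + 1 / \<eta>) * ((gap2 N j)\<^sup>2 * real N)))"
    by (intro sum_mono single) auto
  also have "\<dots> = (1 + 2 * kappa N) ^ 10 * ((1 + \<eta>) * (\<Sum>j=1..N. (e (j + 1) - e j)\<^sup>2 * real N / sqrt (1 + (d j)\<^sup>2) ^ 5)
          + (1 + 1 / \<eta>) * (\<Sum>j=1..N. (gap2 N j)\<^sup>2 * real N))"
    by (simp only: sum_distrib_left[symmetric] sum.distrib)
  also have "\<dots> \<le> (1 + 2 * kappa N) ^ 10 *
      ((1 + \<eta>) * ((1 + 2 * kappa N) ^ 5 * integral {0..1} D) + (1 + 1 / \<eta>) * (36 * excess N))"
    using sum_slope_jump_main[OF N] sum_gap2[OF N] \<eta> kappa_nonneg(1)[of N]
    by (intro mult_left_mono add_mono) (auto simp: d_def e_def)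
  finally show ?thesis unfolding bending_h_eq d_def[symmetric] using C by (intro mult_left_mono) auto
qed

end

context competitor begin

lemma kappa_tendsto:
  assumes "(\<lambda>n. 1 / real (N n)) \<longlonglongrightarrow> 0"
  shows "(\<lambda>n. kappa (N n)) \<longlonglongrightarrow> 0"
proof -
  have "(\<lambda>n. sqrt (Q * (1 / real (N n))) + 2 * sqrt (2 * Z * (1 / real (N n)))) \<longlonglongrightarrow>
      sqrt (Q * 0) + 2 * sqrt (2 * Z * 0)"
    by (intro tendsto_intros assms)
  then show ?thesis by (simp add: kappa_def)
qed

lemma K_compact: "compact K"
  by (rule contact_set_compact[OF w_cont \<psi>D(5)])

lemma K_sets: "K \<in> sets lebesgue"
  using K_compact by (intro fmeasurableD lmeasurable_compact)

lemma excess_integral: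
  assumes N: "N \<ge> 1"
  shows "excess N = (LINT x|unit_meas. step N (\<lambda>j. if touched N j then 1 else 0) x * (z2 x)\<^sup>2)"
    and "integrable unit_meas (\<lambda>x. step N (\<lambda>j. if touched N j then 1 else 0) x * (z2 x)\<^sup>2)"
proof -
  let ?c = "\<lambda>j. if touched N j then 1 else 0 :: real"
  have "((\<lambda>x. step N ?c x * (z2 x)\<^sup>2) has_integral ?c j * integral (cell N j) (\<lambda>x. (z2 x)\<^sup>2)) (cell N j)"
    if j: "1 \<le> j" "j \<le> N" for j
  proof (rule step_mult_has_integral_cell[OF N j(1)])
    obtain a b where "cell N j = {a..b}" "0 \<le> a" "b \<le> 1" using cell_eq[OF N j] by metis
    then have "(\<lambda>x. (z2 x)\<^sup>2) integrable_on cell N j"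
      using integrable_subinterval_real[OF z2_int] by auto
    then show "((\<lambda>x. (z2 x)\<^sup>2) has_integral integral (cell N j) (\<lambda>x. (z2 x)\<^sup>2)) (cell N j)"
      by (rule integrable_integral)
  qed
  then have "((\<lambda>x. step N ?c x * (z2 x)\<^sup>2) has_integral (\<Sum>j=1..N. ?c j * integral (cell N j) (\<lambda>x. (z2 x)\<^sup>2))) {0..real N / real N}"
    by (intro has_integral_cells[OF N])
  also have "(\<Sum>j=1..N. ?c j * integral (cell N j) (\<lambda>x. (z2 x)\<^sup>2)) = excess N"
    unfolding excess_def by (intro sum.cong) (auto simp: local_excess_def wrap_index_def)
  finally have I: "((\<lambda>x. step N ?c x * (z2 x)\<^sup>2) has_integral excess N) {0..1}" using N by simp
  have "(\<lambda>x. step N ?c x * (z2 x)\<^sup>2) absolutely_integrable_on {0..1}"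
    by (rule nonnegative_absolutely_integrable_1) (use I in \<open>auto simp: step_def\<close>)
  then show "excess N = (LINT x|unit_meas. step N ?c x * (z2 x)\<^sup>2)"
    "integrable unit_meas (\<lambda>x. step N ?c x * (z2 x)\<^sup>2)"
    using I by (auto simp: integral_unit integral_unique integrable_unit_iff)
qed

lemma touched_eventually_not:
  assumes N: "\<And>n. N n \<ge> 1" "(\<lambda>n. 1 / real (N n)) \<longlonglongrightarrow> 0" and x: "x \<in> {0<..<1}" "x \<notin> K"
  shows "\<forall>\<^sub>F n in sequentially. step (N n) (\<lambda>j. if touched (N n) j then 1 else 0 :: real) x = 0"
proof -
  have "open (- K)" using K_compact by (simp add: compact_imp_closed open_Compl)
  then obtain r where r: "r > 0" "ball x r \<subseteq> - K" using x(2) openE by blast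
  have "\<forall>\<^sub>F n in sequentially. 1 / real (N n) < r" using order_tendstoD(2)[OF N(2) r(1)] .
  then show ?thesis
  proof eventually_elim
    case (elim n)
    obtain j where j: "1 \<le> j" "j \<le> N n" "x \<in> cell (N n) j" "\<And>c. step (N n) c x = c j"
      using step_cases[OF N(1), of x n] x(1) by (metis greaterThanLessThan_iff less_imp_le)
    obtain a b where ab: "cell (N n) j = {a..b}" "b - a = 1 / real (N n)" using cell_eq[OF N(1) j(1,2)] by metis
    have "cell (N n) j \<subseteq> ball x r"
      using j(3) ab elim by (auto simp: dist_real_def)
    then have "\<not> touched (N n) j" using r(2) by (auto simp: touched_def)
    then show ?case by (simp add: j(4))
  qed
qed

text \<open>The touched cells shrink to the contact set, where \<open>z2\<close> vanishes almost everywhere.\<close>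

lemma excess_tendsto:
  assumes N: "\<And>n. N n \<ge> 1" "(\<lambda>n. 1 / real (N n)) \<longlonglongrightarrow> 0"
  shows "(\<lambda>n. excess (N n)) \<longlonglongrightarrow> 0"
proof -
  let ?s = "\<lambda>n. step (N n) (\<lambda>j. if touched (N n) j then 1 else 0 :: real)"
  have "(\<lambda>n. LINT x|unit_meas. ?s n x * (z2 x)\<^sup>2) \<longlonglongrightarrow> (LINT x|unit_meas. 0)"
  proof (rule integral_dominated_convergence[where w = "\<lambda>x. (z2 x)\<^sup>2"])
    show "integrable unit_meas (\<lambda>x. (z2 x)\<^sup>2)"
      using square_integrable_imp(2)[OF z2_sq] by (simp add: integrable_unit_iff)
    show "(\<lambda>x. ?s n x * (z2 x)\<^sup>2) \<in> borel_measurable unit_meas" for n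
      using excess_integral(2)[OF N(1)] by (rule borel_measurable_integrable)
    show "AE x in unit_meas. norm (?s n x * (z2 x)\<^sup>2) \<le> (z2 x)\<^sup>2" for n
      by (intro AE_I2) (auto simp: step_def)
    have "AE x in unit_meas. x \<in> {0<..<1}"
      unfolding AE_unit_iff by (rule negligible_subset[OF negligible_empty]) auto
    then show "AE x in unit_meas. (\<lambda>n. ?s n x * (z2 x)\<^sup>2) \<longlonglongrightarrow> 0"
      using z2_zero_on_K
    proof eventually_elim
      case (elim x)
      show ?case
      proof (cases "x \<in> K")
        case True
        then show ?thesis using elim(2) by simp
      next
        case False
        show ?thesis
          by (rule tendsto_eventually)
             (use touched_eventually_not[OF N elim(1) False] in \<open>auto elim: eventually_mono\<close>)
      qed
    qed
  qed auto
  then show ?thesis by (simp add: excess_integral(1)[OF N(1), symmetric])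
qed

lemma sqrt_p_int: "(\<lambda>x. sqrt (1 + (p x)\<^sup>2)) absolutely_integrable_on {0..1}"
  by (rule sqrt_abs_int[OF continuous_square_integrable[OF p_cont]])

lemma step_close:
  assumes "N \<ge> 1" "0 \<le> x" "x < 1"
  shows "\<bar>step N (slope N (approx N)) x - p x\<bar> \<le> kappa N"
  using step_cases[OF assms] slope_close[OF assms(1)] by metis

lemma tension_approx:
  assumes N: "N \<ge> 1" and \<sigma>: "\<sigma> > 0"
  shows "tension \<sigma> (approx N) \<le> tension \<sigma> w + \<sigma> * kappa N"
proof -
  have "integral {0..1} (\<lambda>x. sqrt (1 + (step N (slope N (approx N)) x)\<^sup>2))
      \<le> integral {0..1} (\<lambda>x. sqrt (1 + (p x)\<^sup>2) + kappa N)"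
  proof (rule integral_le_Ico)
    show "(\<lambda>x. sqrt (1 + (step N (slope N (approx N)) x)\<^sup>2)) integrable_on {0..1}"
      by (intro abs_intD(1) sqrt_abs_int step_square_integrable N)
    show "(\<lambda>x. sqrt (1 + (p x)\<^sup>2) + kappa N) integrable_on {0..1}"
      by (intro integrable_add abs_intD(1)[OF sqrt_p_int]) auto
    fix x :: real assume "0 \<le> x" "x < 1"
    then show "sqrt (1 + (step N (slope N (approx N)) x)\<^sup>2) \<le> sqrt (1 + (p x)\<^sup>2) + kappa N"
      using step_close[OF N, of x] sqrt_sq_diff[of "step N (slope N (approx N)) x" "p x"] by linarith
  qed
  also have "\<dots> = integral {0..1} (\<lambda>x. sqrt (1 + (p x)\<^sup>2)) + kappa N"
    using abs_intD(1)[OF sqrt_p_int] by (subst integral_add) auto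
  finally have "\<sigma> * integral {0..1} (\<lambda>x. sqrt (1 + (step N (slope N (approx N)) x)\<^sup>2))
      \<le> \<sigma> * (integral {0..1} (\<lambda>x. sqrt (1 + (p x)\<^sup>2)) + kappa N)"
    using \<sigma> by (intro mult_left_mono) auto
  then show ?thesis
    unfolding tension_V_h(2)[OF approx_V_h[OF N] N]
      tension_primitive[OF w continuous_square_integrable[OF p_cont]] by (simp add: distrib_left)
qed

lemma adhesion_w:
  "adhesion \<gamma> \<psi> w = \<gamma> * integral {0..1} (\<lambda>x. indicat_real K x * sqrt (1 + (p x)\<^sup>2))"
  by (rule adhesion_primitive[OF w continuous_square_integrable[OF p_cont] \<psi>D(5)])

lemma nodal_psi: "j \<le> N \<Longrightarrow> N \<ge> 1 \<Longrightarrow> nodal N \<psi> j = \<psi> (real j / real N)"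
  by (rule nodal_eq[OF \<psi>D(3)])

text \<open>Both nodes of a touched cell lie on the obstacle, so the cut-off factors are 1 on a set of cells that
  covers the contact set.\<close>

lemma adhesion_approx:
  assumes N: "N \<ge> 1" and \<gamma>: "\<gamma> > 0" and \<zeta>: "cutoff \<zeta>"
  shows "adhesion_h \<gamma> \<zeta> \<psi> N \<delta> (approx N) \<ge> adhesion \<gamma> \<psi> w - \<gamma> * kappa N"
proof -
  define d where "d = slope N (approx N)"
  define c where "c = (\<lambda>j. if touched N j then sqrt (1 + (d j)\<^sup>2) else 0)"
  have cut: "cutoff_node \<zeta> \<psi> N \<delta> (approx N) j = 1" if "snapped N j" "j \<le> N" for j
    using that cutoffD(3)[OF \<zeta>]
    by (simp add: cutoff_node_def nodal_approx[OF N] nodal_psi[OF _ N] node_value_def)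
  have "integral {0..1} (\<lambda>x. indicat_real K x * sqrt (1 + (p x)\<^sup>2) - kappa N) \<le> integral {0..1} (step N c)"
  proof (rule integral_le_Ico)
    show "(\<lambda>x. indicat_real K x * sqrt (1 + (p x)\<^sup>2) - kappa N) integrable_on {0..1}"
      by (intro integrable_diff abs_intD(1)[OF indicator_mult_abs_int[OF K_sets sqrt_p_int]]) auto
    show "step N c integrable_on {0..1}" by (rule abs_intD(1)[OF step_abs_int[OF N]])
    fix x :: real assume x: "0 \<le> x" "x < 1"
    obtain j where j: "1 \<le> j" "j \<le> N" "x \<in> cell N j" "\<And>c. step N c x = c j"
      using step_cases[OF N x] by metis
    show "indicat_real K x * sqrt (1 + (p x)\<^sup>2) - kappa N \<le> step N c x"
    proof (cases "x \<in> K")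
      case True
      then have "touched N j" using j(3) by (auto simp: touched_def)
      moreover have "sqrt (1 + (p x)\<^sup>2) - kappa N \<le> sqrt (1 + (d j)\<^sup>2)"
        using slope_close[OF N j(1-3)] sqrt_sq_diff[of "p x" "d j"] unfolding d_def by linarith
      ultimately show ?thesis using True by (simp add: j(4) c_def)
    next
      case False
      have "0 \<le> c j" by (simp add: c_def)
      then show ?thesis using False kappa_nonneg(1)[of N] by (simp add: j(4))
    qed
  qed
  also have "\<dots> = (\<Sum>j=1..N. c j) / real N" by (rule step_integral[OF N])
  also have "\<dots> = (\<Sum>j=1..N. c j / real N)" by (simp add: sum_divide_distrib)
  also have "\<dots> \<le> (\<Sum>j=1..N. cutoff_node \<zeta> \<psi> N \<delta> (approx N) (j - 1) * cutoff_node \<zeta> \<psi> N \<delta> (approx N) j * (2 * seg N (approx N) j))"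
  proof (intro sum_mono)
    fix j assume j: "j \<in> {1..N}"
    show "c j / real N \<le> cutoff_node \<zeta> \<psi> N \<delta> (approx N) (j - 1) * cutoff_node \<zeta> \<psi> N \<delta> (approx N) j * (2 * seg N (approx N) j)"
    proof (cases "touched N j")
      case True
      have "snapped N j" "snapped N (j - 1)"
        using True j by (auto simp: snapped_def)
      then have "cutoff_node \<zeta> \<psi> N \<delta> (approx N) j = 1" "cutoff_node \<zeta> \<psi> N \<delta> (approx N) (j - 1) = 1"
        using j by (auto intro!: cut)
      then show ?thesis using True by (simp add: c_def d_def seg_def)
    next
      case False
      have "0 \<le> cutoff_node \<zeta> \<psi> N \<delta> (approx N) (j - 1) * cutoff_node \<zeta> \<psi> N \<delta> (approx N) j * (2 * seg N (approx N) j)"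
        using seg_pos[OF N, of "approx N" j] by (intro mult_nonneg_nonneg[OF cutoff_product(1)[OF \<zeta>]]) auto
      then show ?thesis using False by (simp add: c_def)
    qed
  qed
  finally have "integral {0..1} (\<lambda>x. indicat_real K x * sqrt (1 + (p x)\<^sup>2) - kappa N) \<le> \<dots>" .
  moreover have "integral {0..1} (\<lambda>x. indicat_real K x * sqrt (1 + (p x)\<^sup>2) - kappa N)
      = integral {0..1} (\<lambda>x. indicat_real K x * sqrt (1 + (p x)\<^sup>2)) - kappa N"
    using abs_intD(1)[OF indicator_mult_abs_int[OF K_sets sqrt_p_int]] by (subst integral_diff) auto
  ultimately show ?thesis
    unfolding adhesion_h_def adhesion_w right_diff_distrib[symmetric] using \<gamma> by (intro mult_left_mono) auto
qed

lemma penalty_approx: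
  assumes N: "N \<ge> 1"
  shows "penalty_h \<psi> N \<rho> (approx N) = 0"
proof -
  have "nodal N \<psi> j \<le> nodal N (approx N) j" if "j \<in> {1..N}" for j
    using that N above[of "real j / real N"]
    by (auto simp: nodal_psi nodal_approx[OF N] node_value_def divide_le_eq_1)
  then show ?thesis by (simp add: penalty_h_def)
qed

lemma approx_X_ball:
  assumes N: "N \<ge> 1" and m: "\<And>x. x \<in> {0..1} \<Longrightarrow> \<bar>w x\<bar> \<le> m" "\<And>x. x \<in> {0..1} \<Longrightarrow> \<bar>p x\<bar> \<le> m'"
    and S: "m + m' + 2 * kappa N \<le> S"
  shows "approx N \<in> X_ball S"
proof (rule X_ballI)
  show "approx N \<in> H1_per" by (rule V_h_H1_per[OF approx_V_h[OF N] N])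
  have kap: "sqrt (2 * Z / real N) \<le> kappa N"
    using QZ_nonneg by (simp add: kappa_def)
  have "\<bar>node_value N j\<bar> \<le> m + kappa N" if j: "j \<le> N" for j
  proof -
    have "\<bar>gap N j\<bar> * 1 \<le> \<bar>gap N j\<bar> * real N" using N by (intro mult_left_mono) auto
    then have "\<bar>gap N j\<bar> \<le> kappa N" using gap_small[OF N j] kap by linarith
    moreover have "node_value N j = w (real j / real N) - gap N j"
      using nodal_w[OF j N] nodal_approx[OF N j] by (simp add: gap_def)
    moreover have "\<bar>w (real j / real N)\<bar> \<le> m" using j N by (intro m) (auto simp: divide_le_eq_1)
    ultimately show ?thesis by linarith
  qed
  then have "\<bar>approx N x\<bar> \<le> m + kappa N" if "x \<in> {0..1}" for x
    unfolding approx_def using interp_bounded[OF N that] by blast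
  then show "Linf_norm (approx N) \<le> ereal (m + kappa N)"
    using approx_V_h[OF N] by (intro Linf_norm_continuous_le) (auto simp: V_h_def)
  show "W1inf_seminorm (approx N) \<le> ereal (m' + kappa N)"
  proof (rule V_h_seminorm_le[OF approx_V_h[OF N] N])
    fix j assume j: "1 \<le> j" "j \<le> N"
    have "\<bar>p (real j / real N)\<bar> \<le> m'" using j N by (intro m) (auto simp: divide_le_eq_1)
    then show "\<bar>slope N (approx N) j\<bar> \<le> m' + kappa N"
      using slope_close[OF N j node_in_cell[OF N]] by linarith
  qed
qed (use S in simp)

lemma bending_w: "bending C w = C / 2 * integral {0..1} D"
  unfolding D_def by (rule bending_primitive[OF w p q])

theorem recovery_sequence:
  assumes pos: "C > 0" "\<sigma> > 0" "\<gamma> > 0" and \<zeta>: "cutoff \<zeta>"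
    and N: "\<And>n. N n \<ge> 1" "(\<lambda>n. 1 / real (N n)) \<longlonglongrightarrow> 0"
    and m: "\<And>x. x \<in> {0..1} \<Longrightarrow> \<bar>w x\<bar> \<le> m" "\<And>x. x \<in> {0..1} \<Longrightarrow> \<bar>p x\<bar> \<le> m'" and S: "m + m' < S"
    and e: "e > 0"
  shows "\<forall>\<^sub>F n in sequentially. approx (N n) \<in> X_ball S \<and>
      energy_real C \<sigma> \<gamma> \<psi> \<zeta> (N n) (\<delta> n) (\<rho> n) (approx (N n)) \<le> bending C w + tension \<sigma> w - adhesion \<gamma> \<psi> w + e"
proof -
  have I: "0 \<le> integral {0..1} D"
    using abs_intD(1)[OF D_abs_int] D_nonneg by (intro integral_nonneg) auto
  \<comment> \<open>Small enough for the factor \<open>1 + \<eta>\<close> in \<open>bending_approx\<close> to cost less than \<open>e / 2\<close>; the summand 1 avoids division by zero.\<close>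
  define \<eta> where "\<eta> = e / (4 * (C / 2 * integral {0..1} D + 1))"
  have B0: "0 \<le> C / 2 * integral {0..1} D" using pos I by simp
  then have \<eta>: "\<eta> > 0" using e by (simp add: \<eta>_def)
  have \<eta>B: "\<eta> * (C / 2 * integral {0..1} D) < e / 2"
  proof -
    have "\<eta> * (C / 2 * integral {0..1} D) \<le> \<eta> * (C / 2 * integral {0..1} D + 1)"
      using \<eta> by (intro mult_left_mono) auto
    also have "\<dots> = e / 4"
    proof -
      have t: "e / (4 * t) * t = e / 4" if "t \<noteq> 0" for t :: real using that by simp
      show ?thesis unfolding \<eta>_def by (rule t) (use B0 in linarith)
    qed
    finally show ?thesis using e by linarith
  qed
  define F where "F = (\<lambda>n. C / 2 * ((1 + 2 * kappa (N n)) ^ 10 *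
      ((1 + \<eta>) * ((1 + 2 * kappa (N n)) ^ 5 * integral {0..1} D) + (1 + 1 / \<eta>) * (36 * excess (N n))))
      + \<sigma> * kappa (N n) + \<gamma> * kappa (N n))"
  note lim = kappa_tendsto[OF N(2)] excess_tendsto[OF N]
  have "F \<longlonglongrightarrow> C / 2 * ((1 + 2 * 0) ^ 10 *
      ((1 + \<eta>) * ((1 + 2 * 0) ^ 5 * integral {0..1} D) + (1 + 1 / \<eta>) * (36 * 0))) + \<sigma> * 0 + \<gamma> * 0"
    unfolding F_def by (intro tendsto_intros lim)
  also have "C / 2 * ((1 + 2 * 0) ^ 10 *
      ((1 + \<eta>) * ((1 + 2 * 0) ^ 5 * integral {0..1} D) + (1 + 1 / \<eta>) * (36 * 0))) + \<sigma> * 0 + \<gamma> * 0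
      = C / 2 * integral {0..1} D + \<eta> * (C / 2 * integral {0..1} D)"
    by (simp add: distrib_right distrib_left)
  finally have "\<forall>\<^sub>F n in sequentially. F n < bending C w + e"
    using \<eta>B e by (intro order_tendstoD(2)) (auto simp: bending_w)
  moreover have "\<forall>\<^sub>F n in sequentially. m + m' + 2 * kappa (N n) < S"
  proof (rule order_tendstoD(2))
    show "(\<lambda>n. m + m' + 2 * kappa (N n)) \<longlonglongrightarrow> m + m' + 2 * 0" by (intro tendsto_intros lim)
  qed (use S in simp)
  ultimately show ?thesis
  proof eventually_elim
    case (elim n)
    have "energy_real C \<sigma> \<gamma> \<psi> \<zeta> (N n) (\<delta> n) (\<rho> n) (approx (N n)) \<le> F n + tension \<sigma> w - adhesion \<gamma> \<psi> w"
      using bending_approx[OF N(1) pos(1) \<eta>, of n] tension_approx[OF N(1) pos(2), of n]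
        adhesion_approx[OF N(1) pos(3) \<zeta>, of n "\<delta> n"]
      unfolding energy_real_def penalty_approx[OF N(1)] F_def by linarith
    then show ?case
      using elim approx_X_ball[OF N(1) m, of n S] by auto
  qed
qed

end

section \<open>Limits of discrete functions\<close>

text \<open>For this \<open>G\<close>, the square of the derivative of \<open>G \<circ> u'\<close> is the bending
  density of \<open>u\<close>.\<close>

lemma bending_antiderivative:
  obtains G G' :: "real \<Rightarrow> real" where "\<And>t. (G has_real_derivative G' t) (at t)"
    "\<And>t. (G' t)\<^sup>2 = 1 / sqrt (1 + t\<^sup>2) ^ 5" "\<And>t. 0 < G' t" "\<And>t. G' t \<le> 1" "continuous_on UNIV G'"
proof -
  define G' where "G' = (\<lambda>t::real. (1 + t\<^sup>2) powr (- 5 / 4))"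
  have pos: "1 + t\<^sup>2 > 0" for t :: real by (simp add: add_pos_nonneg)
  have ne: "1 + t\<^sup>2 \<noteq> 0" for t :: real using pos[of t] by linarith
  have cont: "continuous_on UNIV G'"
    unfolding G'_def by (intro continuous_intros ballI ne)
  have "\<exists>F. \<forall>x. -\<infinity> < ereal x \<longrightarrow> ereal x < \<infinity> \<longrightarrow> (F has_vector_derivative G' x) (at x)"
    using cont by (intro einterval_antiderivative) (auto simp: continuous_on_eq_continuous_at)
  then obtain G where "\<And>t. (G has_real_derivative G' t) (at t)"
    by (auto simp: has_real_derivative_iff_has_vector_derivative)
  moreover have "(G' t)\<^sup>2 = 1 / sqrt (1 + t\<^sup>2) ^ 5" for t
  proof -
    have "(G' t)\<^sup>2 = (1 + t\<^sup>2) powr (- (5 / 2))"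
      unfolding G'_def power2_eq_square powr_add[symmetric] by simp
    also have "\<dots> = 1 / (1 + t\<^sup>2) powr (5 / 2)" by (simp add: powr_minus_divide)
    finally show ?thesis by (simp add: powr_5_2)
  qed
  moreover have "0 < G' t" for t unfolding G'_def using ne by (simp add: powr_gt_zero)
  moreover have "G' t \<le> 1" for t
  proof -
    have "G' t = 1 / (1 + t\<^sup>2) powr (5 / 4)" by (simp add: G'_def powr_minus_divide)
    also have "\<dots> \<le> 1 / 1" using ne[of t] by (intro divide_left_mono ge_one_powr_ge_zero) auto
    finally show ?thesis by simp
  qed
  ultimately show ?thesis using cont that by blast
qed

text \<open>The node \<open>j / N\<close> carries the slope of the cell to its right. Unlike the slopes themselves,
  this function is continuous, and its Dirichlet energy is the sum of the squared slope jumps times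
  \<open>N\<close>.\<close>

definition slope_interp :: "nat \<Rightarrow> (real \<Rightarrow> real) \<Rightarrow> real \<Rightarrow> real" where
  "slope_interp N v = interp N (\<lambda>j. slope N v (j + 1))"

lemma interp_energy:
  assumes "N \<ge> 1"
  shows "integral {0..1} (\<lambda>x. (step N (\<lambda>j. (c j - c (j - 1)) * real N) x)\<^sup>2) = (\<Sum>j=1..N. (c j - c (j - 1))\<^sup>2 * real N)"
proof -
  have "integral {0..1} (\<lambda>x. (step N (\<lambda>j. (c j - c (j - 1)) * real N) x)\<^sup>2) =
      (\<Sum>j=1..N. ((c j - c (j - 1)) * real N)\<^sup>2) / real N"
    using step_integral[OF assms, of "\<lambda>j. ((c j - c (j - 1)) * real N)\<^sup>2"] by (simp add: step_def[abs_def])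
  also have "\<dots> = (\<Sum>j=1..N. (c j - c (j - 1))\<^sup>2 * real N)"
    unfolding sum_divide_distrib using assms
    by (intro sum.cong) (auto simp: power_mult_distrib power2_eq_square[of "real N"])
  finally show ?thesis .
qed

text \<open>What compactness extracts from a sequence of near-minimizers. The limit function is the primitive
  \<open>u\<close> of \<open>p\<close> with \<open>u 0 = u0\<close>.\<close>

locale convergent_sequence =
  fixes C \<sigma> \<gamma> :: real and \<psi> \<zeta> :: "real \<Rightarrow> real" and N :: "nat \<Rightarrow> nat" and \<delta> \<rho> :: "nat \<Rightarrow> real"
    and v :: "nat \<Rightarrow> real \<Rightarrow> real" and M J Kp \<beta> u0 :: real and p :: "real \<Rightarrow> real"
  assumes pos: "C > 0" "\<sigma> > 0" "\<gamma> > 0" and \<psi>: "smooth_periodic \<psi>" and \<zeta>: "cutoff \<zeta>"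
    and N: "\<And>n. N n \<ge> 1" "(\<lambda>n. 1 / real (N n)) \<longlonglongrightarrow> 0"
    and \<delta>: "\<And>n. \<delta> n > 0" "\<delta> \<longlonglongrightarrow> 0" and \<rho>: "\<And>n. \<rho> n > 0" "\<rho> \<longlonglongrightarrow> 0"
    and v: "\<And>n. v n \<in> V_h (N n)"
    and slope_bound: "\<And>n j. 1 \<le> j \<Longrightarrow> j \<le> N n \<Longrightarrow> \<bar>slope (N n) (v n) j\<bar> \<le> M"
    and jumps: "\<And>n. (\<Sum>j=1..N n. (slope (N n) (v n) (j + 1) - slope (N n) (v n) j)\<^sup>2 * real (N n)) \<le> J"
    and penalty: "\<And>n. penalty_h \<psi> (N n) (\<rho> n) (v n) \<le> Kp"
    and bend_lim: "(\<lambda>n. bending_h C (N n) (v n)) \<longlonglongrightarrow> \<beta>"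
    and v0_lim: "(\<lambda>n. v n 0) \<longlonglongrightarrow> u0"
    and p: "continuous_on {0..1} p"
    and p_unif: "\<And>e. e > 0 \<Longrightarrow> \<forall>\<^sub>F n in sequentially. \<forall>x\<in>{0..1}. \<bar>slope_interp (N n) (v n) x - p x\<bar> < e"
begin

definition d where "d n = slope (N n) (v n)"
definition s where "s n = step (N n) (d n)"
definition \<tau> where "\<tau> n = sqrt (J * (1 / real (N n)))"
definition u where "u x = u0 + integral {0..x} p"

lemmas \<psi>D = smooth_periodicD[OF \<psi>]

lemma J: "0 \<le> J" by (rule order_trans[OF _ jumps[of 0]]) (auto intro: sum_nonneg)

lemma \<tau>_lim: "\<tau> \<longlonglongrightarrow> 0"
proof -
  have "(\<lambda>n. sqrt (J * (1 / real (N n)))) \<longlonglongrightarrow> sqrt (J * 0)" by (intro tendsto_intros N)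
  then show ?thesis by (simp add: \<tau>_def[abs_def])
qed

lemma \<tau>_nonneg: "0 \<le> \<tau> n" using J by (simp add: \<tau>_def)

lemma jump_le:
  assumes j: "1 \<le> j" "j \<le> N n"
  shows "\<bar>d n (j + 1) - d n j\<bar> \<le> \<tau> n"
  unfolding \<tau>_def
proof (rule real_le_rsqrt)
  have "(d n (j + 1) - d n j)\<^sup>2 * real (N n) \<le> (\<Sum>j=1..N n. (d n (j + 1) - d n j)\<^sup>2 * real (N n))"
    using j by (intro member_le_sum) auto
  also have "\<dots> \<le> J" unfolding d_def by (rule jumps)
  finally show "\<bar>d n (j + 1) - d n j\<bar>\<^sup>2 \<le> J * (1 / real (N n))"
    using N(1)[of n] by (simp add: field_simps)
qed

lemma v_prim: "is_primitive (v n) (s n)"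
  unfolding s_def d_def by (rule V_h_primitive[OF v N(1)])

lemma s_sq: "square_integrable (s n)"
  unfolding s_def by (rule step_square_integrable[OF N(1)])

lemma u_prim: "is_primitive u p"
  by (rule primitiveI) (auto simp: u_def intro!: absolutely_integrable_continuous_real p)

lemma p_sq: "square_integrable p" by (rule continuous_square_integrable[OF p])

lemma u_cont: "continuous_on {0..1} u" by (rule primitive_continuous[OF u_prim])

lemma s_unif: "e > 0 \<Longrightarrow> \<forall>\<^sub>F n in sequentially. \<forall>x\<in>{0..<1}. \<bar>s n x - p x\<bar> < e"
proof -
  assume e: "e > 0"
  have "\<forall>\<^sub>F n in sequentially. \<forall>x\<in>{0..1}. \<bar>slope_interp (N n) (v n) x - p x\<bar> < e / 2"
    using e by (intro p_unif) simp
  moreover have "\<forall>\<^sub>F n in sequentially. \<tau> n < e / 2"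
    using e by (intro order_tendstoD(2)[OF \<tau>_lim]) simp
  ultimately show ?thesis
  proof eventually_elim
    case (elim n)
    show ?case
    proof
      fix x :: real assume x: "x \<in> {0..<1}"
      obtain j where j: "1 \<le> j" "j \<le> N n" "x \<in> cell (N n) j" "\<And>c. step (N n) c x = c j"
        using step_cases[OF N(1), of x n] x by (metis atLeastLessThan_iff)
      have "\<bar>slope_interp (N n) (v n) x - d n j\<bar> \<le> \<bar>d n (j + 1) - d n j\<bar>"
        using interp_close[OF N(1) j(1-3), of "\<lambda>j. slope (N n) (v n) (j + 1)"] j(1)
        by (simp add: slope_interp_def d_def)
      also have "\<dots> \<le> \<tau> n" by (rule jump_le[OF j(1,2)])
      finally have "\<bar>slope_interp (N n) (v n) x - s n x\<bar> \<le> \<tau> n" by (simp add: s_def j(4))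
      moreover have "\<bar>slope_interp (N n) (v n) x - p x\<bar> < e / 2" using elim(1) x by auto
      ultimately show "\<bar>s n x - p x\<bar> < e" using elim(2) by linarith
    qed
  qed
qed

lemma s_bound: "x \<in> {0..<1} \<Longrightarrow> \<bar>s n x\<bar> \<le> M"
  using step_cases[OF N(1), of x n] slope_bound[of _ n] unfolding s_def d_def
  by (metis atLeastLessThan_iff)

lemma v_unif: "e > 0 \<Longrightarrow> \<forall>\<^sub>F n in sequentially. \<forall>x\<in>{0..1}. \<bar>v n x - u x\<bar> < e"
proof -
  assume e: "e > 0"
  have "\<forall>\<^sub>F n in sequentially. dist (v n 0) u0 < e / 2"
    using e by (intro tendstoD[OF v0_lim]) simp
  moreover have "\<forall>\<^sub>F n in sequentially. \<forall>x\<in>{0..<1}. \<bar>s n x - p x\<bar> < e / 2"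
    using e by (intro s_unif) simp
  ultimately show ?thesis
  proof eventually_elim
    case (elim n)
    show ?case
    proof
      fix x :: real assume x: "x \<in> {0..1}"
      have i: "s n integrable_on {0..x}" "p integrable_on {0..x}"
        using x by (auto intro!: abs_int_sub(2)[OF square_integrable_imp(1)[OF s_sq]] abs_int_sub(2)[OF square_integrable_imp(1)[OF p_sq]])
      have "\<bar>integral {0..x} (\<lambda>t. s n t - p t)\<bar> \<le> integral {0..x} (\<lambda>t. e / 2)"
        unfolding integral_open_interval_real[of 0 x] real_norm_def[symmetric]
        using i elim(2) x
        by (intro integral_norm_bound_integral integrable_diff)
           (auto simp: integrable_on_open_interval_real less_imp_le)
      then have "\<bar>integral {0..x} (s n) - integral {0..x} p\<bar> \<le> x * (e / 2)"
        using i x by (simp add: integral_diff)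
      also have "\<dots> \<le> 1 * (e / 2)" using x e by (intro mult_right_mono) auto
      finally have "\<bar>integral {0..x} (s n) - integral {0..x} p\<bar> \<le> e / 2" by simp
      moreover have "v n x = v n 0 + integral {0..x} (s n)"
        using primitive_eq[OF v_prim, of x n] x by simp
      ultimately show "\<bar>v n x - u x\<bar> < e"
        using elim(1) unfolding u_def dist_real_def by linarith
    qed
  qed
qed

lemma v_lim: "x \<in> {0..1} \<Longrightarrow> (\<lambda>n. v n x) \<longlonglongrightarrow> u x"
proof (rule tendstoI)
  fix e :: real assume "e > 0" and x: "x \<in> {0..1}"
  show "\<forall>\<^sub>F n in sequentially. dist (v n x) (u x) < e"
    using v_unif[OF \<open>e > 0\<close>] by eventually_elim (use x in \<open>auto simp: dist_real_def\<close>)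
qed

lemma u_per: "u 0 = u 1"
proof -
  have "v n 0 = v n 1" for n using v[of n] by (simp add: V_h_def)
  then show ?thesis using v_lim[of 0] v_lim[of 1] by (simp add: LIMSEQ_unique)
qed

lemma slope_interp_lim: "x \<in> {0..1} \<Longrightarrow> (\<lambda>n. slope_interp (N n) (v n) x) \<longlonglongrightarrow> p x"
proof (rule tendstoI)
  fix e :: real assume "e > 0" and x: "x \<in> {0..1}"
  show "\<forall>\<^sub>F n in sequentially. dist (slope_interp (N n) (v n) x) (p x) < e"
    using p_unif[OF \<open>e > 0\<close>] by eventually_elim (use x in \<open>auto simp: dist_real_def\<close>)
qed

lemma p_per: "p 0 = p 1"
proof -
  have "slope_interp (N n) (v n) 0 = slope_interp (N n) (v n) 1" for n
    using interp_node[OF N(1), of n "\<lambda>j. slope (N n) (v n) (j + 1)" 0]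
      interp_node[OF N(1), of n "\<lambda>j. slope (N n) (v n) (j + 1)" "N n"] N(1)[of n] slope_wrap[of "N n" "v n"]
    by (simp add: slope_interp_def)
  then show ?thesis using slope_interp_lim[of 0] slope_interp_lim[of 1] by (simp add: LIMSEQ_unique)
qed

lemma H1_conv: "(\<lambda>n. H1_norm (\<lambda>x. v n x - u x)) \<longlonglongrightarrow> 0"
proof (rule tendstoI)
  fix e :: real assume e: "e > 0"
  define e' where "e' = e / 2"
  have e': "e' > 0" using e by (simp add: e'_def)
  show "\<forall>\<^sub>F n in sequentially. dist (H1_norm (\<lambda>x. v n x - u x)) 0 < e"
    using v_unif[OF e'] s_unif[OF e']
  proof eventually_elim
    case (elim n)
    define f g where "f = (\<lambda>x. v n x - u x)" and "g = (\<lambda>x. s n x - p x)"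
    have fg: "is_primitive f g"
      using primitive_lincomb[OF v_prim[of n] u_prim, of 1 "-1"] by (simp add: f_def g_def)
    have g: "square_integrable g"
    proof (rule square_integrableI[OF primitive_abs_int[OF fg]])
      have i: "(\<lambda>x. (s n x)\<^sup>2 - 2 * (p x * s n x) + (p x)\<^sup>2) integrable_on {0..1}"
        by (intro integrable_add integrable_diff integrable_cmult_real abs_intD(1)[OF square_integrable_imp(2)[OF s_sq]]
            abs_intD(1)[OF abs_int_mult_continuous[OF p square_integrable_imp(1)[OF s_sq]]] abs_intD(1)[OF square_integrable_imp(2)[OF p_sq]])
      have "(g x)\<^sup>2 = (s n x)\<^sup>2 - 2 * (p x * s n x) + (p x)\<^sup>2" for x
        by (simp add: g_def power2_diff)
      then show "(\<lambda>x. (g x)\<^sup>2) integrable_on {0..1}" using i by simp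
    qed
    have fs: "square_integrable f" by (rule continuous_square_integrable[OF primitive_continuous[OF fg]])
    have sq: "integral {0..1} (\<lambda>x. (h x)\<^sup>2) \<le> e'\<^sup>2"
      if "square_integrable h" "\<And>x. 0 \<le> x \<Longrightarrow> x < 1 \<Longrightarrow> \<bar>h x\<bar> \<le> e'" for h
    proof -
      have "integral {0..1} (\<lambda>x. (h x)\<^sup>2) \<le> integral {0..1} (\<lambda>x::real. e'\<^sup>2)"
        using that e' abs_intD(1)[OF square_integrable_imp(2)[OF that(1)]]
        by (intro integral_le_Ico) (auto simp: abs_le_square_iff[symmetric])
      then show ?thesis by simp
    qed
    have 1: "(LINT x|unit_meas. (f x)\<^sup>2) \<le> e'\<^sup>2"
      unfolding integral_unit[OF square_integrable_imp(2)[OF fs]]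
      using elim(1) by (intro sq fs) (auto simp: f_def less_imp_le)
    have "AE x in unit_meas. (wderiv f x)\<^sup>2 = (g x)\<^sup>2"
      using wderiv_primitive(3)[OF fg g] by eventually_elim simp
    note ae = this
    have 2: "(LINT x|unit_meas. (wderiv f x)\<^sup>2) \<le> e'\<^sup>2"
    proof -
      have "integral {0..1} (\<lambda>x. (g x)\<^sup>2) \<le> e'\<^sup>2"
        using elim(2) by (intro sq[OF g]) (auto simp: g_def less_imp_le)
      then show ?thesis using LINT_cong_unit[OF ae square_integrable_imp(2)[OF g]] by simp
    qed
    have "H1_norm f \<le> sqrt (e'\<^sup>2 + e'\<^sup>2)"
      unfolding H1_norm_def using 1 2 by (intro real_sqrt_le_mono) simp
    also have "\<dots> < sqrt ((2 * e')\<^sup>2)"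
      using e' by (intro real_sqrt_less_mono) (simp add: power2_eq_square)
    also have "\<dots> = e" using e by (simp add: e'_def)
    finally have "H1_norm f < e" .
    moreover have "0 \<le> H1_norm f" by (simp add: H1_norm_def)
    ultimately show ?case by (simp add: f_def)
  qed
qed

lemma node_of_point:
  assumes "x \<in> {0..<1}"
  obtains j where "1 \<le> j" "j \<le> N n" "\<And>c. step (N n) c x = c j" "real j / real (N n) \<in> {0..1}"
    "\<bar>real j / real (N n) - x\<bar> \<le> 1 / real (N n)"
proof -
  obtain j where j: "1 \<le> j" "j \<le> N n" "x \<in> cell (N n) j" "\<And>c. step (N n) c x = c j"
    using step_cases[OF N(1), of x n] assms by (metis atLeastLessThan_iff)
  have "real j / real (N n) \<in> {0..1}" using j N(1)[of n] by (auto simp: divide_le_eq_1)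
  moreover have "\<bar>real j / real (N n) - x\<bar> \<le> 1 / real (N n)"
    using j(3) unfolding cell_def by (auto simp: diff_divide_distrib)
  ultimately show ?thesis using that j by blast
qed

lemma nodal_v: "j \<le> N n \<Longrightarrow> nodal (N n) (v n) j = v n (real j / real (N n))"
  using v[of n] N(1)[of n] by (intro nodal_eq) (auto simp: V_h_def)

lemma nodal_psi: "j \<le> N n \<Longrightarrow> nodal (N n) \<psi> j = \<psi> (real j / real (N n))"
  using \<psi>D(3) N(1)[of n] by (intro nodal_eq)

text \<open>Where \<open>u\<close> is below \<open>\<psi>\<close>, all nodes in some fixed interval violate the
  constraint by a fixed amount, which makes the penalty sum, without the factor \<open>1 / \<rho>
  n\<close>, larger than a positive constant; but it is at most \<open>\<rho> n * Kp\<close>.\<close>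

lemma u_above: "x \<in> {0..1} \<Longrightarrow> \<psi> x \<le> u x"
proof -
  define z where "z = (\<lambda>x. u x - \<psi> x)"
  have zc: "continuous_on {0..1} z" unfolding z_def by (intro continuous_intros u_cont \<psi>D)
  have inner: "0 \<le> z x0" if x0: "x0 \<in> {0<..<1}" for x0
  proof (rule ccontr)
    assume "\<not> 0 \<le> z x0"
    define a where "a = - z x0 / 2"
    have a: "a > 0" using \<open>\<not> 0 \<le> z x0\<close> by (simp add: a_def)
    obtain \<eta>0 where \<eta>0: "\<eta>0 > 0" "\<And>y. y \<in> {0..1} \<Longrightarrow> dist y x0 < \<eta>0 \<Longrightarrow> dist (z y) (z x0) < a"
      using zc x0 a unfolding continuous_on_iff by (metis atLeastAtMost_iff greaterThanLessThan_iff less_imp_le)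
    \<comment> \<open>The interval \<open>[x0, x0 + \<eta> / 2]\<close> has to stay below 1, where step functions are not controlled.\<close>
    define \<eta> where "\<eta> = min \<eta>0 (1 - x0)"
    have \<eta>': "\<eta> > 0" "\<eta> \<le> \<eta>0" "\<eta> \<le> 1 - x0" using \<eta>0(1) x0 by (auto simp: \<eta>_def)
    then have \<eta>: "\<eta> > 0" "\<eta> \<le> \<eta>0" "x0 + \<eta> / 2 < 1" by linarith+
    define c where "c = \<eta> / 2 * (a / 2)\<^sup>2"
    have c: "c > 0" using \<eta> a by (simp add: c_def)
    have "\<forall>\<^sub>F n in sequentially. 1 / real (N n) < \<eta> / 2"
      using \<eta> by (intro order_tendstoD(2)[OF N(2)]) simp
    moreover have "\<forall>\<^sub>F n in sequentially. \<forall>x\<in>{0..1}. \<bar>v n x - u x\<bar> < a / 2"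
      using a by (intro v_unif) simp
    moreover have "(\<lambda>n. \<rho> n * Kp) \<longlonglongrightarrow> 0 * Kp" by (intro tendsto_intros \<rho>)
    then have "\<forall>\<^sub>F n in sequentially. \<rho> n * Kp < c"
      using c by (intro order_tendstoD(2)) auto
    ultimately have "\<forall>\<^sub>F n in sequentially. False"
    proof eventually_elim
      case (elim n)
      define g where "g = (\<lambda>j. \<bar>max 0 (- (nodal (N n) (v n) j - nodal (N n) \<psi> j))\<bar>\<^sup>2)"
      have gi: "step (N n) g integrable_on {0..1}" by (rule abs_intD(1)[OF step_abs_int[OF N(1)]])
      have "c = integral {x0..x0 + \<eta> / 2} (\<lambda>x. (a / 2)\<^sup>2)" using \<eta> by (simp add: c_def)
      also have "\<dots> \<le> integral {x0..x0 + \<eta> / 2} (step (N n) g)"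
      proof (rule integral_le)
        show "step (N n) g integrable_on {x0..x0 + \<eta> / 2}"
          using gi x0 \<eta> by (intro integrable_subinterval_real[OF gi]) auto
        fix x assume x: "x \<in> {x0..x0 + \<eta> / 2}"
        then have "x \<in> {0..<1}" using x0 \<eta> by auto
        then obtain j where j: "1 \<le> j" "j \<le> N n" "\<And>c. step (N n) c x = c j" "real j / real (N n) \<in> {0..1}"
          "\<bar>real j / real (N n) - x\<bar> \<le> 1 / real (N n)" using node_of_point by metis
        define y where "y = real j / real (N n)"
        have "dist y x0 < \<eta>0" using j(5) x elim(1) \<eta> by (auto simp: y_def dist_real_def)
        then have "dist (z y) (z x0) < a" using \<eta>0(2)[of y] j(4) by (simp add: y_def)
        then have "z y < - a" unfolding dist_real_def a_def by linarith
        moreover have "\<bar>v n y - u y\<bar> < a / 2" using elim(2) j(4) by (simp add: y_def)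
        ultimately have "a / 2 \<le> - (v n y - \<psi> y)" unfolding z_def by linarith
        then have "(a / 2)\<^sup>2 \<le> g j"
          unfolding g_def nodal_v[OF j(2)] nodal_psi[OF j(2)] y_def[symmetric] using a by (intro power_mono) auto
        then show "(a / 2)\<^sup>2 \<le> step (N n) g x" by (simp add: j(3))
      qed auto
      also have "\<dots> \<le> integral {0..1} (step (N n) g)"
        using gi x0 \<eta> by (intro integral_subset_le integrable_subinterval_real[OF gi]) (auto simp: step_def g_def)
      also have "\<dots> = \<rho> n * penalty_h \<psi> (N n) (\<rho> n) (v n)"
      proof -
        have "(\<Sum>j=1..N n. g j) / real (N n) = (\<Sum>j=1..N n. g j * (1 / real (N n)))"
          by (simp add: sum_divide_distrib)
        moreover have "\<rho> n * (1 / \<rho> n * X) = X" for X using \<rho>(1)[of n] by simp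
        ultimately show ?thesis unfolding step_integral[OF N(1)] penalty_h_def g_def by (simp only:)
      qed
      also have "\<dots> \<le> \<rho> n * Kp" using penalty \<rho>(1)[of n] by (intro mult_left_mono) auto
      finally show False using elim(3) by simp
    qed
    then show False by simp
  qed
  assume x: "x \<in> {0..1}"
  have cl: "closure {0<..<1::real} = {0..1}" by simp
  have "0 \<le> z x"
    by (rule continuous_ge_on_closure[of "{0<..<1}"]) (use x zc inner cl in simp_all)
  then show ?thesis by (simp add: z_def)
qed

lemma tension_lower: "e > 0 \<Longrightarrow> \<forall>\<^sub>F n in sequentially. tension \<sigma> u - e \<le> tension \<sigma> (v n)"
proof -
  assume e: "e > 0"
  have "\<forall>\<^sub>F n in sequentially. \<forall>x\<in>{0..<1}. \<bar>s n x - p x\<bar> < e / \<sigma>"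
    using e pos by (intro s_unif) simp
  then show ?thesis
  proof eventually_elim
    case (elim n)
    have ip: "(\<lambda>x. sqrt (1 + (p x)\<^sup>2)) integrable_on {0..1}" by (rule abs_intD(1)[OF sqrt_abs_int[OF p_sq]])
    have "integral {0..1} (\<lambda>x. sqrt (1 + (p x)\<^sup>2) - e / \<sigma>) \<le> integral {0..1} (\<lambda>x. sqrt (1 + (s n x)\<^sup>2))"
    proof (rule integral_le_Ico)
      show "(\<lambda>x. sqrt (1 + (p x)\<^sup>2) - e / \<sigma>) integrable_on {0..1}" by (intro integrable_diff ip) auto
      show "(\<lambda>x. sqrt (1 + (s n x)\<^sup>2)) integrable_on {0..1}" by (rule abs_intD(1)[OF sqrt_abs_int[OF s_sq]])
      fix x :: real assume "0 \<le> x" "x < 1"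
      then have "\<bar>s n x - p x\<bar> < e / \<sigma>" using elim by simp
      then show "sqrt (1 + (p x)\<^sup>2) - e / \<sigma> \<le> sqrt (1 + (s n x)\<^sup>2)"
        using sqrt_sq_diff[of "p x" "s n x"] by linarith
    qed
    also have "integral {0..1} (\<lambda>x. sqrt (1 + (p x)\<^sup>2) - e / \<sigma>) = integral {0..1} (\<lambda>x. sqrt (1 + (p x)\<^sup>2)) - e / \<sigma>"
      using ip by (subst integral_diff) auto
    finally have "\<sigma> * (integral {0..1} (\<lambda>x. sqrt (1 + (p x)\<^sup>2)) - e / \<sigma>) \<le> \<sigma> * integral {0..1} (\<lambda>x. sqrt (1 + (s n x)\<^sup>2))"
      using pos by (intro mult_left_mono) auto
    then show ?case
      unfolding tension_primitive[OF u_prim p_sq] tension_primitive[OF v_prim s_sq] using pos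
      by (simp add: right_diff_distrib)
  qed
qed

text \<open>The interpolants of \<open>G\<close> of the slopes converge to \<open>G \<circ> p\<close>, and by
  \<open>bend_term_lower\<close> their Dirichlet energies are at most \<open>(1 + \<tau> n)\<^sup>5 * 2 /
  C\<close> times the bending energy. Hence \<open>G \<circ> p\<close> has a square-integrable derivative
  with the right norm, and so does \<open>p\<close> because \<open>G'\<close> is positive.\<close>

lemma bending_limit:
  obtains q where "is_primitive p q" "square_integrable q" "bending C u \<le> \<beta>"
proof -
  obtain G G' :: "real \<Rightarrow> real" where G: "\<And>t. (G has_real_derivative G' t) (at t)"
    and G'2: "\<And>t. (G' t)\<^sup>2 = 1 / sqrt (1 + t\<^sup>2) ^ 5" and G'pos: "\<And>t. 0 < G' t"
    and G'1: "\<And>t. G' t \<le> 1" and G'c: "continuous_on UNIV G'"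
    using bending_antiderivative by blast
  have Glip: "\<bar>G b - G a\<bar> \<le> \<bar>b - a\<bar>" for a b
  proof -
    obtain \<xi> where "G b - G a = G' \<xi> * (b - a)" using mean_value_segment[of a b G G'] G by blast
    then show ?thesis using G'pos[of \<xi>] G'1[of \<xi>] by (simp add: abs_mult mult_left_le_one_le)
  qed
  define c where "c = (\<lambda>n j. G (d n (j + 1)))"
  define F where "F = (\<lambda>n. interp (N n) (c n))"
  define g where "g = (\<lambda>n. step (N n) (\<lambda>j. (c n j - c n (j - 1)) * real (N n)))"
  define Kn where "Kn = (\<lambda>n. (1 + \<tau> n) ^ 5 * (2 / C * bending_h C (N n) (v n)))"
  obtain h where h: "is_primitive (\<lambda>x. G (p x)) h" "square_integrable h"
    and hb: "integral {0..1} (\<lambda>x. (h x)\<^sup>2) \<le> (1 + 0) ^ 5 * (2 / C * \<beta>)"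
  proof (rule weak_limit_primitive[of F g Kn "(1 + 0) ^ 5 * (2 / C * \<beta>)" "\<lambda>x. G (p x)"])
    show "is_primitive (F n) (g n)" for n unfolding F_def g_def by (rule interp_primitive[OF N(1)])
    show "square_integrable (g n)" for n unfolding g_def by (rule step_square_integrable[OF N(1)])
    show "Kn \<longlonglongrightarrow> (1 + 0) ^ 5 * (2 / C * \<beta>)"
      unfolding Kn_def by (intro tendsto_intros \<tau>_lim bend_lim)
    show "integral {0..1} (\<lambda>x. (g n x)\<^sup>2) \<le> Kn n" for n
    proof -
      have t: "(1 + \<tau> n) ^ 5 > 0" using \<tau>_nonneg[of n] by simp
      have "(c n j - c n (j - 1))\<^sup>2 * real (N n) \<le> (1 + \<tau> n) ^ 5 *
          (bend_term (1 / real (N n)) (d n j) (d n (j + 1)))"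
        (is "_ \<le> _ * ?T") if j: "1 \<le> j" "j \<le> N n" for j
      proof -
        have "(G (d n (j + 1)) - G (d n j))\<^sup>2 / (1 / real (N n)) / (1 + \<tau> n) ^ 5 \<le> ?T"
          by (rule bend_term_lower[OF _ jump_le[OF j] G G'2]) (use N(1)[of n] in simp)
        then have "(G (d n (j + 1)) - G (d n j))\<^sup>2 / (1 / real (N n)) \<le> ?T * (1 + \<tau> n) ^ 5"
          using t by (simp only: pos_divide_le_eq)
        then show ?thesis using j by (simp add: c_def mult.commute)
      qed
      then have "(\<Sum>j=1..N n. (c n j - c n (j - 1))\<^sup>2 * real (N n)) \<le> (\<Sum>j=1..N n. (1 + \<tau> n) ^ 5 *
          (bend_term (1 / real (N n)) (d n j) (d n (j + 1))))"
        by (intro sum_mono) auto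
      also have "\<dots> = Kn n"
        unfolding Kn_def bending_h_eq d_def sum_distrib_left[symmetric] using pos by simp
      finally show ?thesis unfolding g_def interp_energy[OF N(1)] .
    qed
    show "(\<lambda>n. F n x) \<longlonglongrightarrow> G (p x)" if x: "x \<in> {0..1}" for x
    proof (rule tendstoI)
      fix e :: real assume e: "e > 0"
      have "\<forall>\<^sub>F n in sequentially. \<tau> n < e / 3"
        using e by (intro order_tendstoD(2)[OF \<tau>_lim]) simp
      moreover have "\<forall>\<^sub>F n in sequentially. \<forall>x\<in>{0..1}. \<bar>slope_interp (N n) (v n) x - p x\<bar> < e / 3"
        using e by (intro p_unif) simp
      ultimately show "\<forall>\<^sub>F n in sequentially. dist (F n x) (G (p x)) < e"
      proof eventually_elim
        case (elim n)
        have "\<exists>j. 1 \<le> j \<and> j \<le> N n \<and> x \<in> cell (N n) j"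
        proof (cases "x < 1")
          case True
          then show ?thesis using step_cases[OF N(1), of x n] x by (metis atLeastAtMost_iff)
        next
          case False
          then show ?thesis using x N(1)[of n] by (intro exI[of _ "N n"]) (auto simp: cell_def divide_le_eq_1)
        qed
        then obtain j where j: "1 \<le> j" "j \<le> N n" "x \<in> cell (N n) j" by blast
        have "\<bar>F n x - G (d n j)\<bar> \<le> \<bar>G (d n (j + 1)) - G (d n j)\<bar>"
          using interp_close[OF N(1) j, of "c n"] j(1) by (simp add: F_def c_def)
        also have "\<dots> \<le> \<tau> n" using Glip[of "d n (j + 1)" "d n j"] jump_le[OF j(1,2)] by linarith
        finally have 1: "\<bar>F n x - G (d n j)\<bar> \<le> \<tau> n" .
        have "\<bar>slope_interp (N n) (v n) x - d n j\<bar> \<le> \<bar>d n (j + 1) - d n j\<bar>"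
          using interp_close[OF N(1) j, of "\<lambda>j. slope (N n) (v n) (j + 1)"] j(1)
          by (simp add: slope_interp_def d_def)
        moreover have "\<bar>slope_interp (N n) (v n) x - p x\<bar> < e / 3" using elim(2) x by blast
        ultimately have "\<bar>d n j - p x\<bar> < \<tau> n + e / 3"
          using jump_le[OF j(1,2)] by linarith
        then have "\<bar>G (d n j) - G (p x)\<bar> < \<tau> n + e / 3" using Glip[of "d n j" "p x"] by linarith
        then show ?case using 1 elim(1) unfolding dist_real_def by linarith
      qed
    qed
  qed
  define q where "q = (\<lambda>x. h x / G' (p x))"
  have pq: "is_primitive p q"
    unfolding q_def by (rule inverse_chain_rule_primitive[OF h(1) p G G'c G'pos])
  have eq: "(q x)\<^sup>2 / sqrt (1 + (p x)\<^sup>2) ^ 5 = (h x)\<^sup>2" for x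
  proof -
    have "(G' (p x))\<^sup>2 \<noteq> 0" using G'pos[of "p x"] by simp
    then show ?thesis unfolding q_def power_divide using G'2[of "p x"] by (simp add: field_simps)
  qed
  have qs: "square_integrable q"
  proof (rule square_integrableI[OF primitive_abs_int[OF pq]])
    have "(q x)\<^sup>2 = sqrt (1 + (p x)\<^sup>2) ^ 5 * (h x)\<^sup>2" for x
    proof -
      have "sqrt (1 + (p x)\<^sup>2) ^ 5 > 0" by (simp add: add_pos_nonneg)
      then show ?thesis unfolding eq[symmetric] by simp
    qed
    moreover have "(\<lambda>x. sqrt (1 + (p x)\<^sup>2) ^ 5 * (h x)\<^sup>2) integrable_on {0..1}"
      by (intro abs_intD(1)[OF abs_int_mult_continuous] continuous_intros p square_integrable_imp(2)[OF h(2)])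
    ultimately show "(\<lambda>x. (q x)\<^sup>2) integrable_on {0..1}" by simp
  qed
  have "bending C u = C / 2 * integral {0..1} (\<lambda>x. (h x)\<^sup>2)"
    unfolding bending_primitive[OF u_prim pq qs] eq ..
  also have "\<dots> \<le> C / 2 * ((1 + 0) ^ 5 * (2 / C * \<beta>))" using hb pos by (intro mult_left_mono) auto
  also have "\<dots> = \<beta>" using pos by simp
  finally show ?thesis using that pq qs by blast
qed

abbreviation K where "K \<equiv> contact_set \<psi> u"

lemma K_compact: "compact K" by (rule contact_set_compact[OF u_cont \<psi>D(5)])

lemma K_sets: "K \<in> sets lebesgue"
  using K_compact by (intro fmeasurableD lmeasurable_compact)

definition contact_weight where "contact_weight n j = cutoff_node \<zeta> \<psi> (N n) (\<delta> n) (v n) (j - 1) * cutoff_node \<zeta> \<psi> (N n) (\<delta> n) (v n) j"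

text \<open>Near \<open>x\<close>, the function \<open>u\<close> exceeds the obstacle by a fixed amount; so does
  \<open>v n\<close> eventually, and this amount is more than \<open>\<delta> n\<close>.\<close>

lemma contact_weight_eventually_zero:
  assumes x: "x \<in> {0<..<1}" "x \<notin> K"
  shows "\<forall>\<^sub>F n in sequentially. step (N n) (contact_weight n) x = 0"
proof -
  define z where "z = (\<lambda>x. u x - \<psi> x)"
  have zc: "continuous_on {0..1} z" unfolding z_def by (intro continuous_intros u_cont \<psi>D)
  define a where "a = z x / 4"
  have "z x \<noteq> 0" "z x \<ge> 0" using x u_above[of x] by (auto simp: z_def contact_set_def)
  then have a: "a > 0" by (simp add: a_def)
  obtain \<eta> where \<eta>: "\<eta> > 0" "\<And>y. y \<in> {0..1} \<Longrightarrow> dist y x < \<eta> \<Longrightarrow> dist (z y) (z x) < a"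
    using zc x a unfolding continuous_on_iff by (metis atLeastAtMost_iff greaterThanLessThan_iff less_imp_le)
  have "\<forall>\<^sub>F n in sequentially. 1 / real (N n) < \<eta>" by (rule order_tendstoD(2)[OF N(2) \<eta>(1)])
  moreover have "\<forall>\<^sub>F n in sequentially. \<forall>x\<in>{0..1}. \<bar>v n x - u x\<bar> < a" by (rule v_unif[OF a])
  moreover have "\<forall>\<^sub>F n in sequentially. \<delta> n < a" by (rule order_tendstoD(2)[OF \<delta>(2) a])
  ultimately show ?thesis
  proof eventually_elim
    case (elim n)
    have "x \<in> {0..<1}" using x by auto
    then obtain j where j: "1 \<le> j" "j \<le> N n" "\<And>c. step (N n) c x = c j" "real j / real (N n) \<in> {0..1}"
      "\<bar>real j / real (N n) - x\<bar> \<le> 1 / real (N n)" using node_of_point by metis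
    define y where "y = real j / real (N n)"
    have "dist (z y) (z x) < a" using j(4,5) elim(1) by (intro \<eta>(2)) (auto simp: y_def dist_real_def)
    then have "z y > 2 * a" unfolding dist_real_def a_def by linarith
    moreover have "\<bar>v n y - u y\<bar> < a" using elim(2) j(4) by (simp add: y_def)
    ultimately have "\<delta> n < v n y - \<psi> y" using elim(3) unfolding z_def by linarith
    then have "\<not> \<bar>nodal (N n) (v n) j - nodal (N n) \<psi> j\<bar> \<le> \<delta> n"
      unfolding nodal_v[OF j(2)] nodal_psi[OF j(2)] y_def[symmetric] by linarith
    then have "cutoff_node \<zeta> \<psi> (N n) (\<delta> n) (v n) j = 0"
      using cutoff_node_close[OF \<zeta> \<delta>(1)] by blast
    then show ?case by (simp add: j(3) contact_weight_def)
  qed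
qed

text \<open>The discrete adhesion density \<open>F n\<close> is at most \<open>H n\<close>, in which the cut-off
  factors on the contact set are replaced by 1. The functions \<open>H n\<close> are uniformly bounded and
  converge pointwise to the adhesion density of \<open>u\<close>.\<close>

lemma adhesion_upper:
  assumes e: "e > 0"
  shows "\<forall>\<^sub>F n in sequentially. adhesion_h \<gamma> \<zeta> \<psi> (N n) (\<delta> n) (v n) \<le> adhesion \<gamma> \<psi> u + e"
proof -
  define F where "F = (\<lambda>n. step (N n) (\<lambda>j. contact_weight n j * sqrt (1 + (d n j)\<^sup>2)))"
  define H where "H = (\<lambda>n x. F n x - indicat_real K x * F n x + indicat_real K x * sqrt (1 + (s n x)\<^sup>2))"
  define A where "A = (\<lambda>x. indicat_real K x * sqrt (1 + (p x)\<^sup>2))"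
  have A: "A absolutely_integrable_on {0..1}"
    unfolding A_def by (rule indicator_mult_abs_int[OF K_sets sqrt_abs_int[OF p_sq]])
  have contact_weight: "0 \<le> contact_weight n j" "contact_weight n j \<le> 1" for n j unfolding contact_weight_def using cutoff_product[OF \<zeta>] by auto
  have F_eq: "F n x = step (N n) (contact_weight n) x * sqrt (1 + (s n x)\<^sup>2)" for n x
    by (simp add: F_def s_def step_def)
  have F_le: "0 \<le> F n x" "F n x \<le> sqrt (1 + (s n x)\<^sup>2)" for n x
    unfolding F_eq using contact_weight by (auto simp: step_def intro!: mult_left_le_one_le)
  have F_int: "F n absolutely_integrable_on {0..1}" for n unfolding F_def by (rule step_abs_int[OF N(1)])
  have H_int: "H n absolutely_integrable_on {0..1}" for n
    unfolding H_def
    by (intro set_integral_add(1) set_integral_diff(1) F_int indicator_mult_abs_int K_sets sqrt_abs_int s_sq)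
  have AE01: "AE x in unit_meas. x \<in> {0<..<1}"
    unfolding AE_unit_iff by (rule negligible_subset[OF negligible_empty]) auto
  have H_range: "0 \<le> H n x" "H n x \<le> sqrt (1 + M\<^sup>2)" if "x \<in> {0<..<1}" for n x
  proof -
    have "\<bar>s n x\<bar> \<le> M" using s_bound[of x n] that by simp
    then have sM: "sqrt (1 + (s n x)\<^sup>2) \<le> sqrt (1 + M\<^sup>2)" by (simp add: abs_le_square_iff[symmetric])
    show "0 \<le> H n x" "H n x \<le> sqrt (1 + M\<^sup>2)"
    proof -
      have "H n x = (if x \<in> K then sqrt (1 + (s n x)\<^sup>2) else F n x)"
        by (simp add: H_def)
      then show "0 \<le> H n x" "H n x \<le> sqrt (1 + M\<^sup>2)"
        by (simp_all only: split: if_split) (use F_le(1)[of n x] order_trans[OF F_le(2) sM] sM in simp_all)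
    qed
  qed
  have "(\<lambda>n. LINT x|unit_meas. H n x) \<longlonglongrightarrow> (LINT x|unit_meas. A x)"
  proof (rule integral_dominated_convergence[where w = "\<lambda>_. sqrt (1 + M\<^sup>2)"])
    show "A \<in> borel_measurable unit_meas" "\<And>n. H n \<in> borel_measurable unit_meas"
      using A H_int by (auto simp: integrable_unit_iff[symmetric])
    show "integrable unit_meas (\<lambda>_. sqrt (1 + M\<^sup>2))"
      unfolding integrable_unit_iff by (rule absolutely_integrable_continuous_real) auto
    show "AE x in unit_meas. norm (H n x) \<le> sqrt (1 + M\<^sup>2)" for n
      using AE01 by eventually_elim (use H_range in auto)
    show "AE x in unit_meas. (\<lambda>n. H n x) \<longlonglongrightarrow> A x"
      using AE01
    proof eventually_elim
      case (elim x)
      show ?case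
      proof (cases "x \<in> K")
        case True
        have "(\<lambda>n. s n x) \<longlonglongrightarrow> p x"
        proof (rule tendstoI)
          fix e :: real assume "e > 0"
          show "\<forall>\<^sub>F n in sequentially. dist (s n x) (p x) < e"
            using s_unif[OF \<open>e > 0\<close>] by eventually_elim (use elim in \<open>auto simp: dist_real_def\<close>)
        qed
        then have "(\<lambda>n. sqrt (1 + (s n x)\<^sup>2)) \<longlonglongrightarrow> sqrt (1 + (p x)\<^sup>2)" by (intro tendsto_intros)
        then show ?thesis using True by (simp add: H_def A_def)
      next
        case False
        have "\<forall>\<^sub>F n in sequentially. H n x = A x"
          using contact_weight_eventually_zero[OF elim False]
          by eventually_elim (use False in \<open>simp add: H_def A_def F_eq\<close>)
        then show ?thesis by (rule tendsto_eventually)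
      qed
    qed
  qed
  then have "(\<lambda>n. \<gamma> * integral {0..1} (H n)) \<longlonglongrightarrow> \<gamma> * integral {0..1} A"
    unfolding integral_unit[OF H_int] integral_unit[OF A] by (intro tendsto_intros)
  then have "\<forall>\<^sub>F n in sequentially. \<gamma> * integral {0..1} (H n) < \<gamma> * integral {0..1} A + e"
    by (rule order_tendstoD(2)) (use e in simp)
  moreover have "\<gamma> * integral {0..1} A = adhesion \<gamma> \<psi> u"
    unfolding adhesion_primitive[OF u_prim p_sq \<psi>D(5)] A_def ..
  moreover have "adhesion_h \<gamma> \<zeta> \<psi> (N n) (\<delta> n) (v n) \<le> \<gamma> * integral {0..1} (H n)" for n
  proof -
    have "adhesion_h \<gamma> \<zeta> \<psi> (N n) (\<delta> n) (v n) = \<gamma> * ((\<Sum>j=1..N n. contact_weight n j * sqrt (1 + (d n j)\<^sup>2)) / real (N n))"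
      unfolding adhesion_h_def seg_def contact_weight_def d_def by (simp add: sum_divide_distrib)
    also have "\<dots> = \<gamma> * integral {0..1} (F n)" unfolding F_def step_integral[OF N(1)] ..
    also have "\<dots> \<le> \<gamma> * integral {0..1} (H n)"
    proof (intro mult_left_mono integral_le_Ico)
      show "F n integrable_on {0..1}" "H n integrable_on {0..1}"
        by (rule abs_intD(1)[OF F_int], rule abs_intD(1)[OF H_int])
      show "F n x \<le> H n x" for x using F_le[of n x] by (auto simp: H_def indicator_def)
    qed (use pos in simp)
    finally show ?thesis .
  qed
  ultimately show ?thesis
    by (auto elim!: eventually_mono intro: order_trans less_imp_le)
qed

theorem lower_bound:
  obtains q where "is_primitive p q" "square_integrable q"
    "\<And>e. e > 0 \<Longrightarrow> \<forall>\<^sub>F n in sequentially. bending C u + tension \<sigma> u - adhesion \<gamma> \<psi> u - e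
        \<le> energy_real C \<sigma> \<gamma> \<psi> \<zeta> (N n) (\<delta> n) (\<rho> n) (v n)"
proof -
  obtain q where q: "is_primitive p q" "square_integrable q" "bending C u \<le> \<beta>"
    using bending_limit by blast
  have "\<forall>\<^sub>F n in sequentially. bending C u + tension \<sigma> u - adhesion \<gamma> \<psi> u - e
        \<le> energy_real C \<sigma> \<gamma> \<psi> \<zeta> (N n) (\<delta> n) (\<rho> n) (v n)" if e: "e > 0" for e
  proof -
    have e3: "e / 3 > 0" using e by simp
    have "\<forall>\<^sub>F n in sequentially. \<beta> - e / 3 < bending_h C (N n) (v n)"
      by (rule order_tendstoD(1)[OF bend_lim]) (use e in simp)
    then show ?thesis
      using tension_lower[OF e3] adhesion_upper[OF e3]
    proof eventually_elim
      case (elim n)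
      then show ?case
        using penalty_h_nonneg[OF \<rho>(1), of \<psi> "N n" n "v n"] q(3) unfolding energy_real_def by linarith
    qed
  qed
  then show ?thesis using that q by blast
qed

end

context competitor begin

section \<open>Reduction to competitors of small slope\<close>

text \<open>On the contact set, \<open>w\<close> and \<open>\<psi>\<close> have the same derivative.\<close>

lemma adhesion_le_psi:
  assumes "\<sigma> > 0" "\<gamma> > 0"
  shows "adhesion \<gamma> \<psi> w \<le> \<gamma> * (tension \<sigma> \<psi> / \<sigma>)"
proof -
  have sq: "square_integrable (deriv \<psi>)" by (rule continuous_square_integrable[OF \<psi>D(6)])
  have "integral {0..1} (\<lambda>x. indicat_real K x * sqrt (1 + (p x)\<^sup>2)) \<le> integral {0..1} (\<lambda>x. sqrt (1 + (deriv \<psi> x)\<^sup>2))"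
  proof (rule integral_le)
    show "(\<lambda>x. indicat_real K x * sqrt (1 + (p x)\<^sup>2)) integrable_on {0..1}"
      by (rule abs_intD(1)[OF indicator_mult_abs_int[OF K_sets sqrt_p_int]])
    show "(\<lambda>x. sqrt (1 + (deriv \<psi> x)\<^sup>2)) integrable_on {0..1}"
      by (rule abs_intD(1)[OF sqrt_abs_int[OF sq]])
    fix x
    show "indicat_real K x * sqrt (1 + (p x)\<^sup>2) \<le> sqrt (1 + (deriv \<psi> x)\<^sup>2)"
    proof (cases "x \<in> K")
      case True
      then have "p x = deriv \<psi> x" using z1_zero_on_K[of x] by (simp add: z1_def)
      then show ?thesis using True by simp
    qed simp
  qed
  then show ?thesis
    unfolding adhesion_w tension_primitive[OF \<psi>D(1) sq] using assms by (simp add: mult_left_mono)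
qed

lemma zero_slope:
  obtains x0 where "x0 \<in> {0..1}" "p x0 = 0"
proof -
  have i: "integral {0..1} p = 0" using primitive_diff[OF w, of 0 1] w_per by simp
  have pi: "p integrable_on {0..1}" by (rule p_int) auto
  obtain x1 where x1: "x1 \<in> {0..1}" "\<And>x. x \<in> {0..1} \<Longrightarrow> p x1 \<le> p x"
    using continuous_attains_inf[OF _ _ p_cont] by auto
  obtain x2 where x2: "x2 \<in> {0..1}" "\<And>x. x \<in> {0..1} \<Longrightarrow> p x \<le> p x2"
    using continuous_attains_sup[OF _ _ p_cont] by auto
  have "integral {0..1} (\<lambda>_::real. p x1) \<le> integral {0..1} p" by (rule integral_le) (use pi x1 in auto)
  then have 1: "p x1 \<le> 0" using i by simp
  have "integral {0..1} p \<le> integral {0..1} (\<lambda>_::real. p x2)" by (rule integral_le) (use pi x2 in auto)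
  then have 2: "p x2 \<ge> 0" using i by simp
  have "connected (p ` {0..1})" by (rule connected_continuous_image[OF p_cont]) auto
  then have "0 \<in> p ` {0..1}"
    by (rule connectedD_interval[of _ "p x1" "p x2"]) (use x1 x2 1 2 in auto)
  then show ?thesis using that by auto
qed

text \<open>As for \<open>turning_bound\<close>: the inclination angle vanishes somewhere, its derivative is
  \<open>q / (1 + p\<^sup>2)\<close>, and the pointwise inequality is \<open>turning_le_energy\<close>
  with \<open>L = sqrt (1 + p\<^sup>2)\<close>.\<close>

lemma continuous_turning_bound:
  assumes C: "C > 0" "\<sigma> > 0" and x: "x \<in> {0..1}"
  shows "sqrt (2 * C * \<sigma>) * \<bar>arctan (p x)\<bar> \<le> bending C w + tension \<sigma> w"
proof -
  define g where "g = (\<lambda>x. inverse (1 + (p x)\<^sup>2) * q x)"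
  have ne: "1 + t\<^sup>2 \<noteq> 0" for t :: real by (metis add_pos_nonneg less_irrefl zero_le_power2 zero_less_one)
  have prim: "is_primitive (\<lambda>x. arctan (p x)) g"
    unfolding g_def
  proof (rule chain_rule_primitive[OF p])
    show "(arctan has_real_derivative inverse (1 + t\<^sup>2)) (at t)" for t by (rule DERIV_arctan)
    show "continuous_on UNIV (\<lambda>t::real. inverse (1 + t\<^sup>2))" by (intro continuous_intros ballI ne)
  qed
  have gi: "g absolutely_integrable_on {0..1}" by (rule primitive_abs_int[OF prim])
  have var: "\<bar>arctan (p b) - arctan (p a)\<bar> \<le> integral {0..1} (\<lambda>x. \<bar>g x\<bar>)" if "0 \<le> a" "a \<le> b" "b \<le> 1" for a b
  proof -
    have "\<bar>arctan (p b) - arctan (p a)\<bar> = norm (integral {a..b} g)"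
      using primitive_diff[OF prim that] by simp
    also have "\<dots> \<le> integral {a..b} (\<lambda>x. \<bar>g x\<bar>)"
      by (rule integral_norm_bound_integral)
         (use that in \<open>auto intro!: abs_int_sub(2)[OF gi] integrable_subinterval_real[OF abs_intD(2)[OF gi]]\<close>)
    also have "\<dots> \<le> integral {0..1} (\<lambda>x. \<bar>g x\<bar>)"
      by (rule integral_subset_le)
         (use that in \<open>auto intro!: abs_intD(2)[OF gi] integrable_subinterval_real[OF abs_intD(2)[OF gi]]\<close>)
    finally show ?thesis .
  qed
  obtain x0 where x0: "x0 \<in> {0..1}" "p x0 = 0" using zero_slope by blast
  have "\<bar>arctan (p x)\<bar> \<le> integral {0..1} (\<lambda>x. \<bar>g x\<bar>)"
    using var[of x x0] var[of x0 x] x x0 by (cases "x \<le> x0") auto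
  then have "sqrt (2 * C * \<sigma>) * \<bar>arctan (p x)\<bar> \<le> sqrt (2 * C * \<sigma>) * integral {0..1} (\<lambda>x. \<bar>g x\<bar>)"
    using C by (intro mult_left_mono) auto
  also have "\<dots> = integral {0..1} (\<lambda>x. sqrt (2 * C * \<sigma>) * \<bar>g x\<bar>)" by simp
  also have "\<dots> \<le> integral {0..1} (\<lambda>x. C / 2 * D x + \<sigma> * sqrt (1 + (p x)\<^sup>2))"
  proof (rule integral_le)
    show "(\<lambda>x. sqrt (2 * C * \<sigma>) * \<bar>g x\<bar>) integrable_on {0..1}"
      by (rule integrable_cmult_real[OF abs_intD(2)[OF gi]])
    show "(\<lambda>x. C / 2 * D x + \<sigma> * sqrt (1 + (p x)\<^sup>2)) integrable_on {0..1}"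
      by (intro integrable_add integrable_cmult_real abs_intD(1)[OF D_abs_int] abs_intD(1)[OF sqrt_p_int])
    fix x
    define L where "L = sqrt (1 + (p x)\<^sup>2)"
    have L: "L > 0" by (simp add: L_def add_pos_nonneg)
    have L2: "1 + (p x)\<^sup>2 = L\<^sup>2" by (simp add: L_def)
    have "sqrt (2 * C * \<sigma>) * \<bar>g x\<bar> \<le> C / 2 * (\<bar>g x\<bar>\<^sup>2 * (1 / L)) + \<sigma> * L"
      by (rule turning_le_energy[OF C L])
    also have "\<bar>g x\<bar>\<^sup>2 * (1 / L) = D x"
    proof -
      have "L ^ 5 = L\<^sup>2 * L\<^sup>2 * L" by (simp add: power_eq_if power2_eq_square)
      then show ?thesis
        unfolding g_def D_def L2 L_def[symmetric]
        using L by (simp add: power_mult_distrib divide_inverse power2_eq_square)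
    qed
    finally show "sqrt (2 * C * \<sigma>) * \<bar>g x\<bar> \<le> C / 2 * D x + \<sigma> * sqrt (1 + (p x)\<^sup>2)" by (simp add: L_def)
  qed
  also have "\<dots> = bending C w + tension \<sigma> w"
    unfolding bending_w tension_primitive[OF w continuous_square_integrable[OF p_cont]]
    by (subst integral_add)
       (auto intro!: integrable_cmult_real abs_intD(1)[OF D_abs_int] abs_intD(1)[OF sqrt_p_int])
  finally show ?thesis .
qed

lemma bending_w_nonneg: "C > 0 \<Longrightarrow> bending C w \<ge> 0"
  unfolding bending_w using D_nonneg abs_intD(1)[OF D_abs_int]
  by (intro mult_nonneg_nonneg integral_nonneg) auto

lemma tension_w_ge: "\<sigma> > 0 \<Longrightarrow> tension \<sigma> w \<ge> \<sigma>"
proof -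
  assume \<sigma>: "\<sigma> > 0"
  have "integral {0..1} (\<lambda>x::real. 1::real) \<le> integral {0..1} (\<lambda>x. sqrt (1 + (p x)\<^sup>2))"
    by (rule integral_le) (use abs_intD(1)[OF sqrt_p_int] in auto)
  then have "\<sigma> * 1 \<le> \<sigma> * integral {0..1} (\<lambda>x. sqrt (1 + (p x)\<^sup>2))" using \<sigma> by (intro mult_left_mono) auto
  then show ?thesis unfolding tension_primitive[OF w continuous_square_integrable[OF p_cont]] by simp
qed

lemma adhesion_no_contact: "K = {} \<Longrightarrow> adhesion \<gamma> \<psi> w = 0"
  unfolding adhesion_w by simp

text \<open>The interval has length 1, so a bound for the slope bounds the oscillation.\<close>

lemma w_lip:
  assumes "\<And>x. x \<in> {0..1} \<Longrightarrow> \<bar>p x\<bar> \<le> m" "x \<in> {0..1}" "y \<in> {0..1}"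
  shows "\<bar>w x - w y\<bar> \<le> m"
proof -
  have main: "\<bar>w b - w a\<bar> \<le> m" if "0 \<le> a" "a \<le> b" "b \<le> 1" for a b
  proof -
    have m: "0 \<le> m" using assms(1)[of 0] by force
    have "\<bar>w b - w a\<bar> = norm (integral {a..b} p)" using primitive_diff[OF w that] by simp
    also have "\<dots> \<le> integral {a..b} (\<lambda>_. m)"
      by (rule integral_norm_bound_integral) (use that assms(1) p_int in auto)
    also have "\<dots> = (b - a) * m" using that by simp
    also have "\<dots> \<le> 1 * m" using that m by (intro mult_right_mono) auto
    finally show ?thesis by simp
  qed
  show ?thesis using main[of x y] main[of y x] assms(2,3) by (cases "x \<le> y") (auto simp: abs_minus_commute)
qed

end

lemma X2_competitor:
  assumes "smooth_periodic \<psi>" "y \<in> X2 \<psi>"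
  obtains p q where "competitor \<psi> y p q"
proof -
  have "y \<in> H2_per" "\<And>x. x \<in> {0..1} \<Longrightarrow> \<psi> x \<le> y x" using assms(2) by (auto simp: X2_def)
  then show ?thesis using H2_perD[of y] assms(1) that unfolding competitor_def by metis
qed

locale obstacle_problem =
  fixes C \<sigma> \<gamma> c\<^sub>0 \<phi>\<^sub>0 :: real and \<psi> \<zeta> :: "real \<Rightarrow> real"
  assumes pos: "C > 0" "\<sigma> > 0" "\<gamma> > 0" and \<psi>: "smooth_periodic \<psi>" and \<zeta>: "cutoff \<zeta>"
    and c0: "c\<^sub>0 > 0" and \<phi>0: "0 < \<phi>\<^sub>0" "\<phi>\<^sub>0 < pi / 2"
    and cond: "1 / sqrt (2 * C * \<sigma>) * (\<sigma> + 4 * \<gamma> * (tension \<sigma> \<psi> / \<sigma> + c\<^sub>0))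
         + arctan (real_of_ereal (W1inf_seminorm \<psi>) + 2 * c\<^sub>0) \<le> \<phi>\<^sub>0"
begin

lemmas \<psi>D = smooth_periodicD[OF \<psi>]

definition E :: "(real \<Rightarrow> real) \<Rightarrow> real" where
  "E u = bending C u + tension \<sigma> u - adhesion \<gamma> \<psi> u"

definition psi_sup where "psi_sup = real_of_ereal (Linf_norm \<psi>)"

lemma psi_sup: "Linf_norm \<psi> = ereal psi_sup" "x \<in> {0..1} \<Longrightarrow> \<bar>\<psi> x\<bar> \<le> psi_sup"
proof -
  have "bounded (\<psi> ` {0..1})"
    by (intro compact_imp_bounded compact_continuous_image \<psi>D(5)) auto
  then obtain B where "\<And>x. x \<in> {0..1} \<Longrightarrow> \<bar>\<psi> x\<bar> \<le> B" unfolding bounded_iff by fastforce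
  then have "Linf_norm \<psi> \<le> ereal B" by (rule Linf_norm_continuous_le[OF \<psi>D(5)])
  then show 1: "Linf_norm \<psi> = ereal psi_sup"
    using Linf_norm_nonneg[of \<psi>] unfolding psi_sup_def by (cases "Linf_norm \<psi>") auto
  show "\<bar>\<psi> x\<bar> \<le> psi_sup" if "x \<in> {0..1}" for x
    using Linf_norm_ge[OF \<psi>D(5) that] unfolding 1 by simp
qed

lemma tan_pos: "tan \<phi>\<^sub>0 > 0" using \<phi>0 by (rule tan_gt_zero)

lemma psi_sup_nonneg: "0 \<le> psi_sup" using psi_sup(2)[of 0] by force

lemma psi_tension: "tension \<sigma> \<psi> / \<sigma> \<ge> 0"
proof -
  have sq: "square_integrable (deriv \<psi>)" by (rule continuous_square_integrable[OF \<psi>D(6)])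
  show ?thesis
    unfolding tension_primitive[OF \<psi>D(1) sq] using pos abs_intD(1)[OF sqrt_abs_int[OF sq]]
    by (simp add: integral_nonneg)
qed

lemma const_competitor:
  obtains m where "\<bar>m\<bar> \<le> psi_sup" "\<And>x. x \<in> {0..1} \<Longrightarrow> \<psi> x \<le> m" "competitor \<psi> (\<lambda>_. m) (\<lambda>_. 0) (\<lambda>_. 0)" "E (\<lambda>_. m) \<le> \<sigma>"
proof -
  obtain x1 where x1: "x1 \<in> {0..1}" "\<And>x. x \<in> {0..1} \<Longrightarrow> \<psi> x \<le> \<psi> x1"
    using continuous_attains_sup[OF _ _ \<psi>D(5)] by (metis atLeastAtMost_iff compact_Icc empty_iff order_refl zero_le_one)
  define m where "m = \<psi> x1"
  have prim: "is_primitive (\<lambda>_. c) (\<lambda>_. 0)" for c by (rule primitiveI) auto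
  have sq: "square_integrable (\<lambda>_. 0)" by (rule continuous_square_integrable) auto
  have comp: "competitor \<psi> (\<lambda>_. m) (\<lambda>_. 0) (\<lambda>_. 0)"
    by unfold_locales (use \<psi> prim sq x1 in \<open>auto simp: m_def\<close>)
  then interpret competitor \<psi> "\<lambda>_. m" "\<lambda>_. 0" "\<lambda>_. 0" .
  have "bending C (\<lambda>_. m) = 0" unfolding bending_w D_def by simp
  moreover have "tension \<sigma> (\<lambda>_. m) = \<sigma>" unfolding tension_primitive[OF prim sq] by simp
  moreover have "adhesion \<gamma> \<psi> (\<lambda>_. m) \<ge> 0"
    unfolding adhesion_w using pos abs_intD(1)[OF indicator_mult_abs_int[OF K_sets sqrt_p_int]]
    by (intro mult_nonneg_nonneg integral_nonneg) auto
  ultimately have "E (\<lambda>_. m) \<le> \<sigma>" by (simp add: E_def)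
  then show ?thesis using that[OF _ _ comp] x1 psi_sup(2)[OF x1(1)] by (simp add: m_def)
qed

text \<open>If \<open>E y \<ge> \<sigma>\<close>, a constant above the obstacle has no more energy. Otherwise,
  \<open>y\<close> touches the obstacle, and the turning bound gives \<open>|p| \<le> tan \<phi>1\<close>
  with \<open>\<phi>1 < \<phi>\<^sub>0\<close>; starting from a contact point, this also bounds
  \<open>|y|\<close>. The strict inequality is what keeps recovery sequences inside \<open>X_ball
  S\<close>.\<close>

lemma bounded_competitor:
  assumes y: "y \<in> X2 \<psi>" and S: "psi_sup + 2 * tan \<phi>\<^sub>0 \<le> S"
  obtains w p q m m' where "competitor \<psi> w p q" "E w \<le> E y"
    "\<And>x. x \<in> {0..1} \<Longrightarrow> \<bar>w x\<bar> \<le> m" "\<And>x. x \<in> {0..1} \<Longrightarrow> \<bar>p x\<bar> \<le> m'" "m + m' < S"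
proof (cases "\<sigma> \<le> E y")
  case True
  obtain m where m: "\<bar>m\<bar> \<le> psi_sup" "competitor \<psi> (\<lambda>_. m) (\<lambda>_. 0) (\<lambda>_. 0)" "E (\<lambda>_. m) \<le> \<sigma>"
    using const_competitor by blast
  show ?thesis
    by (rule that[OF m(2), of "\<bar>m\<bar>" 0]) (use m True S tan_pos in auto)
next
  case False
  obtain p q where comp: "competitor \<psi> y p q" using X2_competitor[OF \<psi> y] .
  interpret competitor \<psi> y p q by (rule comp)
  define t where "t = tension \<sigma> \<psi> / \<sigma>"
  define \<phi>1 where "\<phi>1 = 1 / sqrt (2 * C * \<sigma>) * (\<sigma> + \<gamma> * t)"
  have s: "sqrt (2 * C * \<sigma>) > 0" using pos by simp
  have t0: "0 \<le> \<gamma> * t" using psi_tension pos unfolding t_def by (intro mult_nonneg_nonneg) auto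
  have BT: "bending C y + tension \<sigma> y \<le> \<sigma> + \<gamma> * t"
    using False adhesion_le_psi[OF pos(2,3)] unfolding E_def t_def by linarith
  have arc: "\<bar>arctan (p x)\<bar> \<le> \<phi>1" if "x \<in> {0..1}" for x
  proof -
    have "sqrt (2 * C * \<sigma>) * \<bar>arctan (p x)\<bar> \<le> \<sigma> + \<gamma> * t"
      using continuous_turning_bound[OF pos(1,2) that] BT by linarith
    then show ?thesis using s by (simp add: \<phi>1_def field_simps)
  qed
  have \<phi>1: "0 \<le> \<phi>1" "\<phi>1 < \<phi>\<^sub>0"
  proof -
    show "0 \<le> \<phi>1" using t0 pos s by (simp add: \<phi>1_def)
    have "\<sigma> + \<gamma> * t < \<sigma> + 4 * \<gamma> * (t + c\<^sub>0)"
    proof -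
      have "0 < \<gamma> * c\<^sub>0" using pos c0 by simp
      then show ?thesis using t0 by (simp add: distrib_left)
    qed
    then have "\<phi>1 < 1 / sqrt (2 * C * \<sigma>) * (\<sigma> + 4 * \<gamma> * (t + c\<^sub>0))"
      unfolding \<phi>1_def using s by (intro mult_strict_left_mono) auto
    moreover have "0 \<le> arctan (real_of_ereal (W1inf_seminorm \<psi>) + 2 * c\<^sub>0)"
      unfolding W1inf_seminorm_def using real_of_ereal_pos[OF Linf_norm_nonneg] c0 by simp
    ultimately show "\<phi>1 < \<phi>\<^sub>0" using cond unfolding t_def by linarith
  qed
  define m where "m = tan \<phi>1"
  have m: "\<bar>p x\<bar> \<le> m" if "x \<in> {0..1}" for x
    unfolding m_def using \<phi>1 \<phi>0 by (intro abs_le_tan arc that) auto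
  have mt: "m < tan \<phi>\<^sub>0" unfolding m_def using \<phi>1 \<phi>0 by (intro tan_monotone) auto
  have "K \<noteq> {}"
  proof
    assume "K = {}"
    then show False
      using False bending_w_nonneg[OF pos(1)] tension_w_ge[OF pos(2)] adhesion_no_contact[of \<gamma>] by (simp add: E_def)
  qed
  then obtain x0 where x0: "x0 \<in> {0..1}" "y x0 = \<psi> x0" by (auto simp: contact_set_def)
  have "\<bar>y x\<bar> \<le> psi_sup + m" if "x \<in> {0..1}" for x
    using w_lip[OF m that x0(1)] psi_sup(2)[OF x0(1)] x0(2) by linarith
  then show ?thesis using that[OF comp order_refl _ m, of "psi_sup + m"] mt S by auto
qed

lemma energy_X2: "u \<in> X2 \<psi> \<Longrightarrow> energy C \<sigma> \<gamma> \<psi> u = ereal (E u)"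
  by (simp add: energy_def E_def)

abbreviation Eh where "Eh N \<delta> \<rho> v \<equiv> energy_real C \<sigma> \<gamma> \<psi> \<zeta> N \<delta> \<rho> v"
abbreviation near_min where "near_min S N \<delta> \<rho> e v \<equiv> near_minimizer C \<sigma> \<gamma> \<psi> \<zeta> S N \<delta> \<rho> e v"

lemma Eh_bounded_below:
  assumes "N \<ge> 1" "\<delta> > 0" "\<rho> > 0" "v \<in> V_h N"
  shows "- (\<gamma> * (tension \<sigma> \<psi> / \<sigma> + 2 * \<delta> * real N)) \<le> Eh N \<delta> \<rho> v"
  using bending_h_nonneg[OF pos(1) assms(1), of v] tension_ge[OF assms(4,1) pos(2)] pos(2)
    penalty_h_nonneg[OF assms(3), of \<psi> N v] adhesion_h_le[OF \<zeta> pos(3,2) \<psi> assms(1,2), of v]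
  unfolding energy_real_def by linarith

lemma near_minimizer_exists:
  assumes N: "N \<ge> 1" and "\<delta> > 0" "\<rho> > 0" "e > 0" "S \<ge> 0"
  obtains v where "near_min S N \<delta> \<rho> e v"
proof -
  define A where "A = {w. w \<in> V_h N \<and> w \<in> X_ball S}"
  have ne: "A \<noteq> {}" using const_V_h[of 0 N] const_X_ball[of 0 S] assms(5) by (auto simp: A_def)
  have bdd: "bdd_below (Eh N \<delta> \<rho> ` A)"
    using Eh_bounded_below[OF N assms(2,3)] by (intro bdd_belowI2) (auto simp: A_def)
  have "Inf (Eh N \<delta> \<rho> ` A) < Inf (Eh N \<delta> \<rho> ` A) + e" using assms by simp
  then obtain v where v: "v \<in> A" "Eh N \<delta> \<rho> v < Inf (Eh N \<delta> \<rho> ` A) + e"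
    using cInf_lessD[of "Eh N \<delta> \<rho> ` A"] ne by blast
  have "Eh N \<delta> \<rho> v \<le> Eh N \<delta> \<rho> w + e" if "w \<in> A" for w
    using cINF_lower[OF bdd that] v(2) by linarith
  then show ?thesis using that[of v] v(1) by (auto simp: near_minimizer_def A_def)
qed

end

section \<open>Convergence of near-minimizers\<close>

text \<open>The Dirichlet energies of the interpolated slopes are bounded by \<open>J\<close>, so these functions
  are equicontinuous.\<close>

lemma slope_interp_compact:
  assumes N: "\<And>n. N n \<ge> 1"
    and sl: "\<And>n j. 1 \<le> j \<Longrightarrow> j \<le> N n \<Longrightarrow> \<bar>slope (N n) (v n) j\<bar> \<le> M"
    and J: "\<And>n. (\<Sum>j=1..N n. (slope (N n) (v n) (j + 1) - slope (N n) (v n) j)\<^sup>2 * real (N n)) \<le> J"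
  obtains p k where "continuous_on {0..1} p" "strict_mono (k :: nat \<Rightarrow> nat)"
    "\<And>e. e > 0 \<Longrightarrow> \<forall>\<^sub>F n in sequentially. \<forall>x\<in>{0..1}. \<bar>slope_interp (N (k n)) (v (k n)) x - p x\<bar> < e"
proof -
  define F where "F = (\<lambda>n. slope_interp (N n) (v n))"
  have J0: "0 \<le> J" by (rule order_trans[OF _ J[of 0]]) (auto intro: sum_nonneg)
  have bnd: "norm (F n x) \<le> M" if "x \<in> {0..1}" for n x
    unfolding F_def slope_interp_def real_norm_def
  proof (rule interp_bounded[OF N that])
    fix j assume "j \<le> N n"
    moreover note slope_wrap_index[of "N n" "v n" j]
    ultimately show "\<bar>slope (N n) (v n) (j + 1)\<bar> \<le> M"
      using sl[of "wrap_index (N n) (j + 1)" n] wrap_index_range[OF N, of "j + 1" n] by auto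
  qed
  have hold: "\<bar>F n x - F n y\<bar> \<le> sqrt (\<bar>x - y\<bar> * J)" if "x \<in> {0..1}" "y \<in> {0..1}" for n x y
  proof -
    let ?c = "\<lambda>j. slope (N n) (v n) (j + 1)"
    let ?s = "step (N n) (\<lambda>j. (?c j - ?c (j - 1)) * real (N n))"
    have prim: "is_primitive (F n) ?s" unfolding F_def slope_interp_def by (rule interp_primitive[OF N])
    have sq: "square_integrable ?s" by (rule step_square_integrable[OF N])
    have en: "integral {0..1} (\<lambda>x. (?s x)\<^sup>2) \<le> J"
    proof -
      have "integral {0..1} (\<lambda>x. (?s x)\<^sup>2) = (\<Sum>j=1..N n. (?c j - ?c (j - 1))\<^sup>2 * real (N n))"
        by (rule interp_energy[OF N])
      also have "\<dots> = (\<Sum>j=1..N n. (slope (N n) (v n) (j + 1) - slope (N n) (v n) j)\<^sup>2 * real (N n))"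
        by (intro sum.cong) auto
      finally show ?thesis using J[of n] by simp
    qed
    have main: "\<bar>F n b - F n a\<bar> \<le> sqrt ((b - a) * J)" if ab: "0 \<le> a" "a \<le> b" "b \<le> 1" for a b
    proof (rule real_le_rsqrt)
      have "(F n b - F n a)\<^sup>2 \<le> (b - a) * integral {a..b} (\<lambda>x. (?s x)\<^sup>2)"
        by (rule primitive_holder(1)[OF prim sq ab])
      also have "\<dots> \<le> (b - a) * J"
        using primitive_holder(2)[OF prim sq ab] en ab by (intro mult_left_mono) auto
      finally show "\<bar>F n b - F n a\<bar>\<^sup>2 \<le> (b - a) * J" by simp
    qed
    show ?thesis using main[of x y] main[of y x] that by (cases "x \<le> y") (auto simp: abs_minus_commute)
  qed
  obtain g k where g: "continuous_on {0..1} g" "strict_mono (k :: nat \<Rightarrow> nat)"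
    "\<And>e. 0 < e \<Longrightarrow> \<exists>N. \<forall>n x. n \<ge> N \<and> x \<in> {0..1} \<longrightarrow> norm (F (k n) x - g x) < e"
  proof (rule Arzela_Ascoli[of "{0..1::real}" F M])
    fix x e :: real assume x: "x \<in> {0..1}" and e: "0 < e"
    define d where "d = e\<^sup>2 / (J + 1)"
    have d: "d > 0" using e J0 by (simp add: d_def)
    show "\<exists>d>0. \<forall>n y. y \<in> {0..1} \<and> norm (x - y) < d \<longrightarrow> norm (F n x - F n y) < e"
    proof (intro exI[of _ d] conjI allI impI d)
      fix n y assume y: "y \<in> {0..1} \<and> norm (x - y) < d"
      have "\<bar>x - y\<bar> * J \<le> \<bar>x - y\<bar> * (J + 1)" by (intro mult_left_mono) auto
      also have "\<dots> < d * (J + 1)" using y J0 by (intro mult_strict_right_mono) auto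
      also have "\<dots> = e\<^sup>2" using J0 by (simp add: d_def)
      finally have "sqrt (\<bar>x - y\<bar> * J) < sqrt (e\<^sup>2)" by (rule real_sqrt_less_mono)
      then show "norm (F n x - F n y) < e" using hold[OF x, of y n] y e by simp
    qed
  qed (use bnd in auto)
  show ?thesis
  proof (rule that[OF g(1,2)])
    fix e :: real assume "e > 0"
    then obtain n0 where "\<And>n x. n \<ge> n0 \<Longrightarrow> x \<in> {0..1} \<Longrightarrow> norm (F (k n) x - g x) < e" using g(3) by blast
    then show "\<forall>\<^sub>F n in sequentially. \<forall>x\<in>{0..1}. \<bar>slope_interp (N (k n)) (v (k n)) x - g x\<bar> < e"
      unfolding eventually_sequentially F_def real_norm_def by blast
  qed
qed

context obstacle_problem begin

lemma slope_le:
  assumes "N \<ge> 1" "\<delta> > 0" "\<rho> > 0" "\<delta> \<le> c\<^sub>0 * (1 / real N)" "e \<le> 2 * \<gamma> * c\<^sub>0"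
    "near_min S N \<delta> \<rho> e v" "1 \<le> j" "j \<le> N"
  shows "\<bar>slope N v j\<bar> \<le> tan \<phi>\<^sub>0"
  by (rule near_minimizer_slope[OF \<zeta> pos(1,3,2) assms(3,2) \<psi> assms(1,6) c0 assms(4,5) \<phi>0 cond assms(7,8)])

definition contact_bound where "contact_bound = \<gamma> * (tension \<sigma> \<psi> / \<sigma> + 2 * c\<^sub>0)"

lemma delta_N:
  assumes "N \<ge> 1" "\<delta> \<le> c\<^sub>0 * (1 / real N)"
  shows "\<gamma> * (tension \<sigma> \<psi> / \<sigma> + 2 * \<delta> * real N) \<le> contact_bound"
proof -
  have "\<delta> * real N \<le> c\<^sub>0" using assms by (simp add: field_simps)
  then show ?thesis unfolding contact_bound_def using pos by (intro mult_left_mono) auto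
qed

text \<open>The penalty is bounded by comparison with a constant above the obstacle, for which it is zero.\<close>

lemma near_min_bounds:
  assumes N: "N \<ge> 1" and \<delta>\<rho>: "\<delta> > 0" "\<rho> > 0" "\<delta> \<le> c\<^sub>0 * (1 / real N)" and e: "e \<le> 2 * \<gamma> * c\<^sub>0"
    and nm: "near_min S N \<delta> \<rho> e v" and S: "psi_sup \<le> S"
  shows "bending_h C N v \<le> \<sigma> + contact_bound + 2 * \<gamma> * c\<^sub>0" "penalty_h \<psi> N \<rho> v \<le> \<sigma> + contact_bound + 2 * \<gamma> * c\<^sub>0"
    "(\<Sum>j=1..N. (slope N v (j + 1) - slope N v j)\<^sup>2 * real N)
      \<le> (1 + (tan \<phi>\<^sub>0)\<^sup>2) ^ 3 * (2 / C * (\<sigma> + contact_bound + 2 * \<gamma> * c\<^sub>0))"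
proof -
  have v: "v \<in> V_h N" using nm by (simp add: near_minimizer_def)
  have T: "tension \<sigma> v \<ge> \<sigma>" by (rule tension_ge[OF v N pos(2)])
  show B: "bending_h C N v \<le> \<sigma> + contact_bound + 2 * \<gamma> * c\<^sub>0"
    using near_minimizer_bound[OF \<zeta> pos(3,2) \<delta>\<rho>(2,1) \<psi> N nm] delta_N[OF N \<delta>\<rho>(3)] e T pos(2) by linarith
  obtain m where m: "\<bar>m\<bar> \<le> psi_sup" "\<And>x. x \<in> {0..1} \<Longrightarrow> \<psi> x \<le> m" using const_competitor by blast
  have "penalty_h \<psi> N \<rho> (\<lambda>_. m) = 0"
  proof -
    have "nodal N \<psi> j \<le> m" for j
      unfolding nodal_def using N by (intro m) (auto simp: divide_le_eq_1 less_imp_le)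
    then show ?thesis by (simp add: penalty_h_def nodal_def)
  qed
  then have "Eh N \<delta> \<rho> (\<lambda>_. m) \<le> \<sigma>" using const_energy_le[OF \<zeta> pos(3) N, of C \<sigma> \<psi> \<delta> \<rho> m] by simp
  moreover have "Eh N \<delta> \<rho> v \<le> Eh N \<delta> \<rho> (\<lambda>_. m) + e"
    using nm const_V_h[of m N] const_X_ball[of m S] m(1) S unfolding near_minimizer_def by simp
  ultimately show "penalty_h \<psi> N \<rho> v \<le> \<sigma> + contact_bound + 2 * \<gamma> * c\<^sub>0"
    using bending_h_nonneg[OF pos(1) N, of v] T pos(2) e delta_N[OF N \<delta>\<rho>(3)]
      adhesion_h_le[OF \<zeta> pos(3,2) \<psi> N \<delta>\<rho>(1), of v] unfolding energy_real_def by linarith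
  have sl: "\<bar>slope N v j\<bar> \<le> tan \<phi>\<^sub>0" if "1 \<le> j" "j \<le> N + 1" for j
  proof (cases "j = N + 1")
    case True
    then show ?thesis using slope_le[OF N \<delta>\<rho> e nm, of 1] slope_wrap[of N v] N by simp
  next
    case False
    then show ?thesis using slope_le[OF N \<delta>\<rho> e nm, of j] that by simp
  qed
  have "(\<Sum>j=1..N. (slope N v (j + 1) - slope N v j)\<^sup>2 * real N) \<le> (\<Sum>j=1..N. (1 + (tan \<phi>\<^sub>0)\<^sup>2) ^ 3 *
      (bend_term (1 / real N) (slope N v j) (slope N v (j + 1))))"
  proof (rule sum_mono)
    fix j assume j: "j \<in> {1..N}"
    have "(slope N v (j + 1) - slope N v j)\<^sup>2 / (1 / real N) \<le> (1 + (tan \<phi>\<^sub>0)\<^sup>2) ^ 3 *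
      (bend_term (1 / real N) (slope N v j) (slope N v (j + 1)))"
      by (rule bend_term_lower_bounded) (use N j sl in auto)
    then show "(slope N v (j + 1) - slope N v j)\<^sup>2 * real N \<le> (1 + (tan \<phi>\<^sub>0)\<^sup>2) ^ 3 *
      (bend_term (1 / real N) (slope N v j) (slope N v (j + 1)))"
      by simp
  qed
  also have "\<dots> = (1 + (tan \<phi>\<^sub>0)\<^sup>2) ^ 3 * (2 / C * bending_h C N v)"
    unfolding bending_h_eq sum_distrib_left[symmetric] using pos by simp
  also have "\<dots> \<le> (1 + (tan \<phi>\<^sub>0)\<^sup>2) ^ 3 * (2 / C * (\<sigma> + contact_bound + 2 * \<gamma> * c\<^sub>0))"
    using B pos by (intro mult_left_mono) auto
  finally show "(\<Sum>j=1..N. (slope N v (j + 1) - slope N v j)\<^sup>2 * real N)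
      \<le> (1 + (tan \<phi>\<^sub>0)\<^sup>2) ^ 3 * (2 / C * (\<sigma> + contact_bound + 2 * \<gamma> * c\<^sub>0))" .
qed

text \<open>Let \<open>u\<close> be the limit of a convergent subsequence. If some admissible function had less
  energy than \<open>u\<close>, then, by \<open>lower_bound\<close> for \<open>u\<close>, the members of
  its recovery sequence would eventually have less energy than the near-minimizers, by more than the
  errors allow.\<close>

theorem near_minimizers_converge:
  assumes S: "psi_sup + 2 * tan \<phi>\<^sub>0 \<le> S"
    and N: "\<And>n. N n \<ge> 1" "(\<lambda>n. 1 / real (N n)) \<longlonglongrightarrow> 0"
    and \<delta>: "\<And>n. \<delta> n > 0" "\<delta> \<longlonglongrightarrow> 0" "\<And>n. \<delta> n \<le> c\<^sub>0 * (1 / real (N n))"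
    and \<rho>: "\<And>n. \<rho> n > 0" "\<rho> \<longlonglongrightarrow> 0"
    and e: "\<And>n. e n \<le> 2 * \<gamma> * c\<^sub>0" "e \<longlonglongrightarrow> 0"
    and nm: "\<And>n. near_min S (N n) (\<delta> n) (\<rho> n) (e n) (v n)"
  shows "\<exists>u r. minimizer C \<sigma> \<gamma> \<psi> u \<and> strict_mono (r :: nat \<Rightarrow> nat) \<and>
      (\<lambda>n. H1_norm (\<lambda>x. v (r n) x - u x)) \<longlonglongrightarrow> 0"
proof -
  have LS: "psi_sup \<le> S" using S tan_pos by linarith
  have v: "v n \<in> V_h (N n)" "v n \<in> X_ball S" for n using nm[of n] by (auto simp: near_minimizer_def)
  note B = near_min_bounds[OF N(1) \<delta>(1) \<rho>(1) \<delta>(3) e(1) nm LS]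
  define Kb where "Kb = \<sigma> + contact_bound + 2 * \<gamma> * c\<^sub>0"
  define J where "J = (1 + (tan \<phi>\<^sub>0)\<^sup>2) ^ 3 * (2 / C * Kb)"
  have "bounded (range (\<lambda>n. (bending_h C (N n) (v n), v n 0)))"
  proof (rule boundedI)
    fix x assume "x \<in> range (\<lambda>n. (bending_h C (N n) (v n), v n 0))"
    then obtain n where x: "x = (bending_h C (N n) (v n), v n 0)" by auto
    have "norm x \<le> norm (bending_h C (N n) (v n)) + norm (v n 0)" unfolding x by (rule norm_Pair_le)
    also have "\<dots> \<le> Kb + S"
      using B(1)[of n] bending_h_nonneg[OF pos(1) N(1), of n "v n"] X_ball_bound[OF v(2), of 0 n] by (simp add: Kb_def)
    finally show "norm x \<le> Kb + S" .
  qed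
  then obtain l r1 where r1: "strict_mono (r1 :: nat \<Rightarrow> nat)"
    and l: "((\<lambda>n. (bending_h C (N n) (v n), v n 0)) \<circ> r1) \<longlonglongrightarrow> l"
    using bounded_imp_convergent_subsequence by blast
  obtain p k where p: "continuous_on {0..1} p" and k: "strict_mono (k :: nat \<Rightarrow> nat)"
    and p_unif: "\<And>e. e > 0 \<Longrightarrow> \<forall>\<^sub>F n in sequentially. \<forall>x\<in>{0..1}.
        \<bar>slope_interp (N (r1 (k n))) (v (r1 (k n))) x - p x\<bar> < e"
    by (rule slope_interp_compact[of "\<lambda>n. N (r1 n)" "\<lambda>n. v (r1 n)" "tan \<phi>\<^sub>0" J])
       (use N(1) slope_le[OF N(1) \<delta>(1) \<rho>(1) \<delta>(3) e(1) nm] B(3) in \<open>auto simp: J_def Kb_def\<close>)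
  define r where "r = (\<lambda>n. r1 (k n))"
  have r: "strict_mono r" unfolding r_def using r1 k by (simp add: strict_mono_def)
  have sub: "(\<lambda>n. f (r n)) \<longlonglongrightarrow> c" if "f \<longlonglongrightarrow> c" for f :: "nat \<Rightarrow> real" and c
    using LIMSEQ_subseq_LIMSEQ[OF that r] by (simp add: o_def)
  have l': "(\<lambda>n. (bending_h C (N (r n)) (v (r n)), v (r n) 0)) \<longlonglongrightarrow> l"
    using LIMSEQ_subseq_LIMSEQ[OF l k] by (simp add: o_def r_def)
  interpret convergent_sequence C \<sigma> \<gamma> \<psi> \<zeta> "\<lambda>n. N (r n)" "\<lambda>n. \<delta> (r n)" "\<lambda>n. \<rho> (r n)" "\<lambda>n. v (r n)"
    "tan \<phi>\<^sub>0" J Kb "fst l" "snd l" p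
  proof
    show "(\<lambda>n. bending_h C (N (r n)) (v (r n))) \<longlonglongrightarrow> fst l" "(\<lambda>n. v (r n) 0) \<longlonglongrightarrow> snd l"
      using tendsto_fst[OF l'] tendsto_snd[OF l'] by simp_all
    show "\<And>e. e > 0 \<Longrightarrow> \<forall>\<^sub>F n in sequentially. \<forall>x\<in>{0..1}. \<bar>slope_interp (N (r n)) (v (r n)) x - p x\<bar> < e"
      using p_unif by (simp add: r_def)
    show "\<And>n j. 1 \<le> j \<Longrightarrow> j \<le> N (r n) \<Longrightarrow> \<bar>slope (N (r n)) (v (r n)) j\<bar> \<le> tan \<phi>\<^sub>0"
      by (rule slope_le[OF N(1) \<delta>(1) \<rho>(1) \<delta>(3) e(1) nm])
  qed (use pos \<psi> \<zeta> N \<delta> \<rho> v B(2,3) p in \<open>auto intro: sub simp: J_def Kb_def\<close>)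
  obtain q where q: "is_primitive p q" "square_integrable q"
    and lower: "\<And>e. e > 0 \<Longrightarrow> \<forall>\<^sub>F n in sequentially. bending C u + tension \<sigma> u - adhesion \<gamma> \<psi> u - e
        \<le> Eh (N (r n)) (\<delta> (r n)) (\<rho> (r n)) (v (r n))"
    using lower_bound by blast
  have "u \<in> H2_per" by (rule H2_perI[OF u_prim q u_per p_per])
  then have uX: "u \<in> X2 \<psi>" using u_above by (simp add: X2_def)
  have "E u \<le> E y" if y: "y \<in> X2 \<psi>" for y
  proof (rule ccontr)
    assume "\<not> E u \<le> E y"
    then have lt: "E y < E u" by simp
    define \<epsilon> where "\<epsilon> = (E u - E y) / 4"
    have \<epsilon>: "\<epsilon> > 0" using lt by (simp add: \<epsilon>_def)
    obtain w p' q' m m' where w: "competitor \<psi> w p' q'" "E w \<le> E y"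
      "\<And>x. x \<in> {0..1} \<Longrightarrow> \<bar>w x\<bar> \<le> m" "\<And>x. x \<in> {0..1} \<Longrightarrow> \<bar>p' x\<bar> \<le> m'" "m + m' < S"
      using bounded_competitor[OF y S] by metis
    interpret w: competitor \<psi> w p' q' by (rule w(1))
    have "\<forall>\<^sub>F n in sequentially. w.approx (N (r n)) \<in> X_ball S \<and>
        Eh (N (r n)) (\<delta> (r n)) (\<rho> (r n)) (w.approx (N (r n))) \<le> bending C w + tension \<sigma> w - adhesion \<gamma> \<psi> w + \<epsilon>"
      using N w(3,4,5) \<epsilon>
      by (intro w.recovery_sequence[where N = "\<lambda>n. N (r n)" and m = m and m' = m'] pos \<zeta>)
    moreover have "\<forall>\<^sub>F n in sequentially. e (r n) < \<epsilon>"
      by (rule order_tendstoD(2)[OF sub[OF e(2)] \<epsilon>])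
    ultimately have "\<forall>\<^sub>F n in sequentially. False"
      using lower[OF \<epsilon>]
    proof eventually_elim
      case (elim n)
      have "Eh (N (r n)) (\<delta> (r n)) (\<rho> (r n)) (v (r n)) \<le> Eh (N (r n)) (\<delta> (r n)) (\<rho> (r n)) (w.approx (N (r n))) + e (r n)"
        using nm[of "r n"] elim(1) w.approx_V_h[OF N(1)] unfolding near_minimizer_def by blast
      then have "E u - \<epsilon> \<le> E w + \<epsilon> + \<epsilon>" using elim unfolding E_def by linarith
      then show False using w(2) \<epsilon> unfolding \<epsilon>_def by (simp add: field_simps)
    qed
    then show False by simp
  qed
  then have "minimizer C \<sigma> \<gamma> \<psi> u"
    using uX energy_X2[OF uX] unfolding minimizer_def is_arg_min_def
    by (auto simp: X2_def H2_per_def energy_X2 energy_def not_less E_def)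
  then show ?thesis using r H1_conv by blast
qed

lemma minimizer_exists: "\<exists>u. minimizer C \<sigma> \<gamma> \<psi> u"
proof -
  define S where "S = psi_sup + 2 * tan \<phi>\<^sub>0"
  have S: "S \<ge> 0" using psi_sup_nonneg tan_pos by (simp add: S_def)
  define h where "h = (\<lambda>n. inverse (real (Suc n)))"
  have h: "h n > 0" "h n \<le> 1" "h \<longlonglongrightarrow> 0" for n
    unfolding h_def using LIMSEQ_inverse_real_of_nat by (auto simp: field_simps)
  have N: "1 / real (Suc n) = h n" for n by (simp add: h_def inverse_eq_divide)
  have "\<exists>v. near_min S (Suc n) (c\<^sub>0 * h n) (h n) (2 * \<gamma> * c\<^sub>0 * h n) v" for n
    using near_minimizer_exists[of "Suc n" "c\<^sub>0 * h n" "h n" "2 * \<gamma> * c\<^sub>0 * h n" S] h(1)[of n] pos c0 S by auto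
  then obtain v where v: "\<And>n. near_min S (Suc n) (c\<^sub>0 * h n) (h n) (2 * \<gamma> * c\<^sub>0 * h n) (v n)" by metis
  have lim: "(\<lambda>n. c * h n) \<longlonglongrightarrow> 0" for c using tendsto_mult[OF tendsto_const[of c] h(3)] by simp
  have "\<exists>u r. minimizer C \<sigma> \<gamma> \<psi> u \<and> strict_mono (r :: nat \<Rightarrow> nat) \<and>
      (\<lambda>n. H1_norm (\<lambda>x. v (r n) x - u x)) \<longlonglongrightarrow> 0"
  proof (rule near_minimizers_converge[OF _ _ _ _ _ _ _ _ _ _ v])
    show "2 * \<gamma> * c\<^sub>0 * h n \<le> 2 * \<gamma> * c\<^sub>0" for n using h(2)[of n] pos c0 by (simp add: mult_left_le)
    show "(\<lambda>n. 1 / real (Suc n)) \<longlonglongrightarrow> 0" "\<And>n. c\<^sub>0 * h n \<le> c\<^sub>0 * (1 / real (Suc n))"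
      using h(3) by (simp_all only: N order_refl)
  qed (use h c0 lim in \<open>auto simp: S_def\<close>)
  then show ?thesis by blast
qed

end

theorem theorem4p4:
  fixes C \<sigma> \<gamma> c\<^sub>0 \<phi>\<^sub>0 :: real and \<psi> \<zeta> :: "real \<Rightarrow> real"
  assumes "C > 0" and "\<sigma> > 0" and "\<gamma> > 0"
    and "smooth_periodic \<psi>" and "cutoff \<zeta>"
    and "c\<^sub>0 > 0" and "0 < \<phi>\<^sub>0" and "\<phi>\<^sub>0 < pi / 2"
    and "1 / sqrt (2 * C * \<sigma>) * (\<sigma> + 4 * \<gamma> * (tension \<sigma> \<psi> / \<sigma> + c\<^sub>0))
         + arctan (real_of_ereal (W1inf_seminorm \<psi>) + 2 * c\<^sub>0) \<le> \<phi>\<^sub>0"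
  shows
    "(\<forall>S>0. \<forall>N\<ge>1. \<forall>\<delta>>0. \<forall>\<rho>>0. \<forall>v.
        \<delta> \<le> c\<^sub>0 * (1 / real N) \<longrightarrow>
        discrete_minimizer C \<sigma> \<gamma> \<psi> \<zeta> S N \<delta> \<rho> v \<longrightarrow>
        W1inf_seminorm v \<le> ereal (tan \<phi>\<^sub>0)) \<and>
     (\<exists>u. minimizer C \<sigma> \<gamma> \<psi> u) \<and>
     (\<forall>S>0. Linf_norm \<psi> + ereal (2 * tan \<phi>\<^sub>0) \<le> ereal S \<longrightarrow>
        (\<forall>(N :: nat \<Rightarrow> nat) (\<delta> :: nat \<Rightarrow> real) (\<rho> :: nat \<Rightarrow> real) (v :: nat \<Rightarrow> real \<Rightarrow> real).
           (\<forall>n. N n \<ge> 1 \<and> \<delta> n > 0 \<and> \<rho> n > 0 \<and> \<delta> n \<le> c\<^sub>0 * (1 / real (N n)) \<and>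
                discrete_minimizer C \<sigma> \<gamma> \<psi> \<zeta> S (N n) (\<delta> n) (\<rho> n) (v n)) \<longrightarrow>
           (\<lambda>n. 1 / real (N n)) \<longlonglongrightarrow> 0 \<longrightarrow> \<delta> \<longlonglongrightarrow> 0 \<longrightarrow> \<rho> \<longlonglongrightarrow> 0 \<longrightarrow>
           (\<exists>u r. minimizer C \<sigma> \<gamma> \<psi> u \<and> strict_mono (r :: nat \<Rightarrow> nat) \<and>
                  (\<lambda>n. H1_norm (\<lambda>x. v (r n) x - u x)) \<longlonglongrightarrow> 0)))"
proof -
  interpret obstacle_problem C \<sigma> \<gamma> c\<^sub>0 \<phi>\<^sub>0 \<psi> \<zeta>
    using assms by unfold_locales
  have e: "0 \<le> 2 * \<gamma> * c\<^sub>0" using pos c0 by simp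
  show ?thesis
  proof (intro conjI allI impI)
    fix S N \<delta> \<rho> v
    assume "1 \<le> N" "0 < \<delta>" "0 < \<rho>" "\<delta> \<le> c\<^sub>0 * (1 / real N)"
      and dm: "discrete_minimizer C \<sigma> \<gamma> \<psi> \<zeta> S N \<delta> \<rho> v"
    then show "W1inf_seminorm v \<le> ereal (tan \<phi>\<^sub>0)"
      using slope_le[OF _ _ _ _ e discrete_minimizer_near[OF dm]]
      by (intro V_h_seminorm_le[of v N]) (auto simp: discrete_minimizer_def)
  next
    show "\<exists>u. minimizer C \<sigma> \<gamma> \<psi> u" by (rule minimizer_exists)
  next
    fix S :: real and N :: "nat \<Rightarrow> nat" and \<delta> \<rho> :: "nat \<Rightarrow> real" and v :: "nat \<Rightarrow> real \<Rightarrow> real"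
    assume S: "Linf_norm \<psi> + ereal (2 * tan \<phi>\<^sub>0) \<le> ereal S"
      and all: "\<forall>n. N n \<ge> 1 \<and> \<delta> n > 0 \<and> \<rho> n > 0 \<and> \<delta> n \<le> c\<^sub>0 * (1 / real (N n)) \<and>
                discrete_minimizer C \<sigma> \<gamma> \<psi> \<zeta> S (N n) (\<delta> n) (\<rho> n) (v n)"
      and lims: "(\<lambda>n. 1 / real (N n)) \<longlonglongrightarrow> 0" "\<delta> \<longlonglongrightarrow> 0" "\<rho> \<longlonglongrightarrow> 0"
    have "psi_sup + 2 * tan \<phi>\<^sub>0 \<le> S" using S unfolding psi_sup(1) by simp
    then show "\<exists>u r. minimizer C \<sigma> \<gamma> \<psi> u \<and> strict_mono (r :: nat \<Rightarrow> nat) \<and>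
        (\<lambda>n. H1_norm (\<lambda>x. v (r n) x - u x)) \<longlonglongrightarrow> 0"
      using all lims e
      by (intro near_minimizers_converge[where N = N and \<delta> = \<delta> and \<rho> = \<rho> and e = "\<lambda>_. 0" and S = S])
         (auto intro: discrete_minimizer_near)
  qed
qed

end
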